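(* Let $u_0,v_0\in BV(\mathbb{R})$, let $f:\mathbb{R}\to\mathbb{R}$ be convex, and let $u$ and $v$ be the entropy solutions of the scalar conservation law $w_t+f(w)_x=0$, $x\in\mathbb{R}$, $t>0$, with initial data $u_0$ and $v_0$ respectively. If there exists $c>0$ such that $$\left|\int_{y_1}^{y_2}u_0(y)-v_0(y)\,dy\right|\leq c\qquad\text{for all }y_1,y_2\in\mathbb{R},$$ then for any finite time $t>0$ $$\left|\int_{x_1}^{x_2}u(x,t)-v(x,t)\,dx\right|\leq c\qquad\text{for all }x_1,x_2\in\mathbb{R}.$$
   Context: $BV(\mathbb{R})$ denotes functions of bounded variation on $\mathbb{R}$ (in particular bounded). Entropy solution means the unique Kruzkov entropy solution. *)

theory Defs
  imports "HOL-Analysis.Analysis"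
begin

(* Finite total variation over the whole real line.  Integrability is not part of the notion.
   A finite partition s 0 <= ... <= s n is encoded as the initial segment of a monotone sequence. *)
definition bounded_variation :: "(real \<Rightarrow> real) \<Rightarrow> bool" where
  "bounded_variation g \<longleftrightarrow>
     (\<exists>V. \<forall>(s :: nat \<Rightarrow> real) n. mono s \<longrightarrow> (\<Sum>i<n. \<bar>g (s (Suc i)) - g (s i)\<bar>) \<le> V)"

(* Points of the plane are pairs (x, t), space first and time second. *)
definition partial_x :: "(real \<times> real \<Rightarrow> real) \<Rightarrow> real \<times> real \<Rightarrow> real" where
  "partial_x \<phi> p = deriv (\<lambda>x. \<phi> (x, snd p)) (fst p)"

definition partial_t :: "(real \<times> real \<Rightarrow> real) \<Rightarrow> real \<times> real \<Rightarrow> real" where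
  "partial_t \<phi> p = deriv (\<lambda>t. \<phi> (fst p, t)) (snd p)"

primrec Ck :: "nat \<Rightarrow> (real \<times> real \<Rightarrow> real) \<Rightarrow> bool" where
  "Ck 0 \<phi> \<longleftrightarrow> continuous_on UNIV \<phi>"
| "Ck (Suc k) \<phi> \<longleftrightarrow> (\<forall>p. \<phi> differentiable at p) \<and> Ck k (partial_x \<phi>) \<and> Ck k (partial_t \<phi>)"

definition half_plane :: "(real \<times> real) set" where
  "half_plane = UNIV \<times> {0<..}"

(* C_c^\<infinity> of the open half plane; members are extended by zero to the whole plane. *)
definition test_functions :: "(real \<times> real \<Rightarrow> real) set" where
  "test_functions =
     {\<phi>. (\<forall>k. Ck k \<phi>) \<and> compact (closure {p. \<phi> p \<noteq> 0}) \<and> closure {p. \<phi> p \<noteq> 0} \<subseteq> half_plane}"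

(* The Kruzkov entropy solution of w_t + f(w)_x = 0 with initial data w0.  It is a bounded Borel
   function taken in its time-continuous version, i.e. w \<in> C((0,\<infinity>); L^1_loc), so that w(.,t) is
   determined up to null sets for every t > 0; the data are attained in L^1_loc as t -> 0+.
   Values of w at times t <= 0 are irrelevant.  The bound makes every slice w(.,t) locally
   integrable, so none of the integrals below takes its default value 0 (w0 being bounded
   measurable and f continuous). *)
definition entropy_solution ::
  "(real \<Rightarrow> real) \<Rightarrow> (real \<Rightarrow> real) \<Rightarrow> (real \<Rightarrow> real \<Rightarrow> real) \<Rightarrow> bool" where
  "entropy_solution f w0 w \<longleftrightarrow>
     set_borel_measurable borel half_plane (\<lambda>p. w (fst p) (snd p)) \<and>
     (\<exists>M. \<forall>t>0. AE x in lborel. \<bar>w x t\<bar> \<le> M) \<and>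
     (\<forall>t>0. \<forall>R. ((\<lambda>s. LINT x:{-R..R}|lborel. \<bar>w x s - w x t\<bar>) \<longlongrightarrow> 0) (at t)) \<and>
     (\<forall>R. ((\<lambda>s. LINT x:{-R..R}|lborel. \<bar>w x s - w0 x\<bar>) \<longlongrightarrow> 0) (at_right 0)) \<and>
     (\<forall>k. \<forall>\<phi>\<in>test_functions. (\<forall>p. 0 \<le> \<phi> p) \<longrightarrow>
        0 \<le> (LINT p:half_plane|lborel.
               \<bar>w (fst p) (snd p) - k\<bar> * partial_t \<phi> p +
               sgn (w (fst p) (snd p) - k) * (f (w (fst p) (snd p)) - f k) * partial_x \<phi> p))"

end

theory Submission
  imports Defs
begin

text \<open>
  The conservation law is integrated once: the potential \<open>U\<close> with \<open>U\<^sub>x = u\<close>, \<open>U\<^sub>t = - f(u)\<close> solves the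
  Hamilton-Jacobi equation \<open>U\<^sub>t + f(U\<^sub>x) = 0\<close>, and the claim is that the oscillation of \<open>U - V\<close> does not
  increase. Kruzkov's inequality for a single constant \<open>k\<close>, tested with \<open>((\<eta> - (U - \<phi>))\<^sub>+)\<^sup>2\<close>, shows that \<open>U\<close>
  is a viscosity supersolution, since \<open>|u - k| U\<^sub>t + sgn(u - k) (f(u) - f(k)) (U\<^sub>x - k) = - |u - k| f(k)\<close>.
  Convexity makes \<open>V\<close>, mollified in \<open>x\<close> only, a classical subsolution by Jensen's inequality; it is
  \<open>C\<^sup>1\<close> because \<open>v\<close> is continuous in time with values in \<open>L\<^sup>1\<close>. So no doubling of variables is needed to
  get \<open>U - V \<ge> inf (U\<^sub>0 - V\<^sub>0)\<close>, and exchanging \<open>u\<close> and \<open>v\<close> gives the upper bound.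
\<close>

text \<open>Two obstacles shape the argument. The potentials are merely Lipschitz, while Kruzkov's
  inequality is given for smooth test functions: it is therefore extended to C^1 test functions, the
  positive part is squared because the square is C^1, and \<open>U\<close> inside it is mollified in
  \<open>x\<close>, at the price of errors that vanish in L^1_loc. Second, in the tested inequality
  every leading term carries the factor \<open>|u - k|\<close>, so touching a strict subsolution is
  not absurd at once: it only yields \<open>u = k\<close> near the contact point, with
  \<open>k\<close> the slope of the touching function. There \<open>U\<close> is affine in time with
  slope \<open>- f k\<close>, which the time derivative of the touching function must then share;
  this is the contradiction.

  The step from potentials to the claim: increments of \<open>U - V\<close> in \<open>x\<close> are
  integrals of \<open>u - v\<close>, so a bound over all intervals says that sup minus inf of
  \<open>U - V\<close> is at most \<open>c\<close>. Infima at different times can be compared only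
  after the time-dependent constant of each potential has been fixed. Besides Jensen's inequality,
  convexity supplies the local Lipschitz bound on \<open>f\<close>.\<close>

section \<open>A smooth mollifier\<close>

text \<open>The polynomial factor and the powers of \<open>1 / (1 - x\<^sup>2)\<close> make the
  family closed under differentiation, so a single derivative computation gives smoothness of every
  order. The case \<open>p = 1\<close>, \<open>m = 0\<close> is the classical bump.\<close>

definition bump_fun :: "real poly \<Rightarrow> nat \<Rightarrow> real \<Rightarrow> real" where
  "bump_fun p m x = (if \<bar>x\<bar> < 1 then poly p x * (1 / (1 - x\<^sup>2)) ^ m * exp (- (1 / (1 - x\<^sup>2))) else 0)"

lemma power_times_exp_minus_le:
  fixes y :: real
  assumes "y \<ge> 0" "n > 0"
  shows "y ^ n * exp (- y) \<le> real n ^ n"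
proof -
  have "y / n \<le> exp (y / n)" using exp_ge_add_one_self[of "y/n"] by linarith
  then have "(y / n) ^ n \<le> exp (y / n) ^ n" using assms by (intro power_mono) auto
  also have "\<dots> = exp y" using assms by (simp add: exp_of_nat_mult[symmetric])
  finally show ?thesis using assms by (simp add: exp_minus field_simps)
qed

text \<open>The exponential beats every power of \<open>1 / (1 - x\<^sup>2)\<close>. Second order
  decay at the end points is what makes the derivative vanish there.\<close>

lemma bump_fun_quadratic_bound:
  obtains C where "C \<ge> 0" "\<And>x. \<bar>x\<bar> < 1 \<Longrightarrow> \<bar>bump_fun p m x\<bar> \<le> C * (1 - \<bar>x\<bar>)\<^sup>2"
proof -
  have "bounded (poly p ` {-1..1})"
    by (intro compact_imp_bounded compact_continuous_image continuous_intros) auto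
  then obtain P where "\<forall>x\<in>{-1..1}. \<bar>poly p x\<bar> \<le> P"
    by (auto simp: bounded_iff)
  then have P: "\<And>x. \<bar>x\<bar> \<le> 1 \<Longrightarrow> \<bar>poly p x\<bar> \<le> P"
    by (auto simp: abs_le_iff)
  have P0: "P \<ge> 0" using P[of 0] by auto
  \<comment> \<open>The two extra powers of \<open>y\<close> are paid for by
    \<open>(1 / y)\<^sup>2 = (1 - x\<^sup>2)\<^sup>2\<close>, which supplies the quadratic
    decay.\<close>
  define N Q where "N = m + 2" and "Q = real N ^ N"
  have "\<bar>bump_fun p m x\<bar> \<le> (P * Q * 4) * (1 - \<bar>x\<bar>)\<^sup>2" if x: "\<bar>x\<bar> < 1" for x
  proof -
    define y where "y = 1 / (1 - x\<^sup>2)"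
    have "x\<^sup>2 < 1" using x by (simp add: abs_square_less_1)
    then have y: "y > 0" "1 / y = 1 - x\<^sup>2" by (auto simp: y_def)
    have "y ^ m * exp (- y) = (y ^ N * exp (- y)) * (1 / y)\<^sup>2"
      using y by (simp add: N_def power_add power2_eq_square field_simps)
    also have "\<dots> \<le> Q * (1 / y)\<^sup>2"
      using power_times_exp_minus_le[of y N] y by (intro mult_right_mono) (simp_all add: N_def Q_def)
    also have "(1 / y)\<^sup>2 = (1 + \<bar>x\<bar>)\<^sup>2 * (1 - \<bar>x\<bar>)\<^sup>2"
    proof -
      have "1 - x\<^sup>2 = (1 + \<bar>x\<bar>) * (1 - \<bar>x\<bar>)" by (auto simp: algebra_simps power2_eq_square)
      then show ?thesis unfolding y(2) by (simp only: power_mult_distrib)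
    qed
    also have "(Q) * ((1 + \<bar>x\<bar>)\<^sup>2 * (1 - \<bar>x\<bar>)\<^sup>2) \<le> Q * (2\<^sup>2 * (1 - \<bar>x\<bar>)\<^sup>2)"
      using x by (intro mult_left_mono mult_right_mono power_mono) (auto simp: Q_def)
    finally have le: "y ^ m * exp (- y) \<le> Q * (4 * (1 - \<bar>x\<bar>)\<^sup>2)" by simp
    have "\<bar>poly p x\<bar> * (y ^ m * exp (- y)) \<le> P * (Q * (4 * (1 - \<bar>x\<bar>)\<^sup>2))"
      by (rule mult_mono) (use le P[of x] P0 x y in auto)
    then show ?thesis using x y by (simp add: bump_fun_def y_def[symmetric] abs_mult mult_ac)
  qed
  with P0 show thesis by (intro that[of "P * Q * 4"]) (auto simp: Q_def)
qed

lemma bump_fun_has_derivative: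
  "\<exists>q n. \<forall>x. (bump_fun p m has_real_derivative bump_fun q n x) (at x)"
proof -
  \<comment> \<open>Product rule with \<open>y = 1 / (1 - x\<^sup>2)\<close>, whose derivative is
    \<open>2 * x * y\<^sup>2\<close>; the relation \<open>y * (1 - x\<^sup>2) = 1\<close> brings all
    three terms to the common power \<open>m + 2\<close> of \<open>y\<close>.\<close>
  define q where "q = pderiv p * [:1,0,-1:]\<^sup>2 + smult (2 * of_nat m) ([:0,1:] * p * [:1,0,-1:]) - smult 2 ([:0,1:] * p)"
  have "(bump_fun p m has_real_derivative bump_fun q (m + 2) x) (at x)" for x
  proof (cases "\<bar>x\<bar> < 1")
    case True
    define y where "y = 1 / (1 - x\<^sup>2)"
    have x2: "1 - x\<^sup>2 \<noteq> 0" using True by (metis abs_square_less_1 diff_gt_0_iff_gt less_irrefl)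
    then have y1: "y * (1 - x\<^sup>2) = 1" by (simp add: y_def)
    have Y: "((\<lambda>x. 1 / (1 - x\<^sup>2)) has_real_derivative 2 * x * y\<^sup>2) (at x)"
      using x2 by (auto intro!: derivative_eq_intros simp: y_def power2_eq_square divide_simps)
    have "((\<lambda>x. poly p x * (1 / (1 - x\<^sup>2)) ^ m * exp (- (1 / (1 - x\<^sup>2)))) has_real_derivative
       (poly (pderiv p) x * y ^ m + poly p x * (of_nat m * y ^ (m - 1) * (2 * x * y\<^sup>2))) * exp (- y)
         + poly p x * y ^ m * (exp (- y) * (- (2 * x * y\<^sup>2)))) (at x)"
      unfolding y_def
      by (rule derivative_eq_intros Y[unfolded y_def] refl)+ (simp_all add: algebra_simps)
    moreover have "of_nat m * y ^ (m - 1) * (2 * x * y\<^sup>2) = of_nat m * 2 * x * y ^ m * y"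
      by (cases m) (auto simp: power2_eq_square)
    moreover have "(poly (pderiv p) x * y ^ m + poly p x * (of_nat m * 2 * x * y ^ m * y)) * exp (- y)
         + poly p x * y ^ m * (exp (- y) * (- (2 * x * y\<^sup>2)))
       = poly q x * y ^ (m + 2) * exp (- y)"
    proof -
      have *: "y ^ (m + 2) * (1 - x\<^sup>2)\<^sup>2 = y ^ m" "y ^ (m + 2) * (1 - x\<^sup>2) = y ^ m * y"
      proof -
        have "y ^ (m + 2) * (1 - x\<^sup>2)\<^sup>2 = y ^ m * (y * (1 - x\<^sup>2))\<^sup>2"
          by (simp only: power_add power_mult_distrib mult.assoc)
        then show "y ^ (m + 2) * (1 - x\<^sup>2)\<^sup>2 = y ^ m" unfolding y1 by simp
        have "y ^ (m + 2) * (1 - x\<^sup>2) = y ^ m * y * (y * (1 - x\<^sup>2))"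
          by (simp add: power_add power2_eq_square)
        then show "y ^ (m + 2) * (1 - x\<^sup>2) = y ^ m * y" unfolding y1 by simp
      qed
      have q: "poly q x = poly (pderiv p) x * (1 - x\<^sup>2)\<^sup>2 + 2 * of_nat m * x * poly p x * (1 - x\<^sup>2) - 2 * x * poly p x"
        by (simp add: q_def algebra_simps power2_eq_square)
      have "poly q x * y ^ (m + 2) = poly (pderiv p) x * (y ^ (m + 2) * (1 - x\<^sup>2)\<^sup>2)
          + 2 * of_nat m * x * poly p x * (y ^ (m + 2) * (1 - x\<^sup>2)) - 2 * x * poly p x * y ^ (m + 2)"
        unfolding q by (simp only: algebra_simps)
      also have "\<dots> = poly (pderiv p) x * y ^ m + poly p x * (of_nat m * 2 * x * y ^ m * y) - poly p x * y ^ m * (2 * x * y\<^sup>2)"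
        unfolding * by (simp add: power_add power2_eq_square)
      finally have *: "poly q x * y ^ (m + 2) = poly (pderiv p) x * y ^ m + poly p x * (of_nat m * 2 * x * y ^ m * y) - poly p x * y ^ m * (2 * x * y\<^sup>2)" .
      show ?thesis unfolding * by (simp add: algebra_simps)
    qed
    ultimately have "((\<lambda>x. poly p x * (1 / (1 - x\<^sup>2)) ^ m * exp (- (1 / (1 - x\<^sup>2)))) has_real_derivative
       bump_fun q (m + 2) x) (at x)"
      using True by (simp add: bump_fun_def y_def)
    then show ?thesis
      by (rule has_field_derivative_transform_within_open[where S="{-1<..<1}"]) (use True in \<open>auto simp: bump_fun_def\<close>)
  next
    case False
    obtain C where C: "C \<ge> 0" "\<And>x. \<bar>x\<bar> < 1 \<Longrightarrow> \<bar>bump_fun p m x\<bar> \<le> C * (1 - \<bar>x\<bar>)\<^sup>2"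
      by (rule bump_fun_quadratic_bound) blast
    \<comment> \<open>For \<open>x\<close> outside the open unit interval, \<open>1 - |z|\<close> is
      at most \<open>|z - x|\<close>, so the quadratic bound makes the difference quotient of order
      \<open>|z - x|\<close>.\<close>
    have 1: "norm (bump_fun p m z / (z - x)) \<le> C * \<bar>z - x\<bar>" for z
    proof (cases "\<bar>z\<bar> < 1")
      case True
      have "(1 - \<bar>z\<bar>)\<^sup>2 \<le> \<bar>z - x\<bar>\<^sup>2" using True False by (intro power_mono) auto
      then have "\<bar>bump_fun p m z\<bar> \<le> C * \<bar>z - x\<bar>\<^sup>2"
        using C(2)[OF True] C(1) by (meson mult_left_mono order_trans)
      then show ?thesis using True False by (auto simp: field_simps power2_eq_square)
    qed (use C in \<open>auto simp: bump_fun_def\<close>)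
    have "((\<lambda>z. bump_fun p m z / (z - x)) \<longlongrightarrow> 0) (at x)"
    proof (rule Lim_null_comparison)
      show "\<forall>\<^sub>F z in at x. norm (bump_fun p m z / (z - x)) \<le> C * \<bar>z - x\<bar>" using 1 by auto
      show "((\<lambda>z. C * \<bar>z - x\<bar>) \<longlongrightarrow> 0) (at x)" by (auto intro!: tendsto_eq_intros)
    qed
    then show ?thesis using False by (simp add: has_field_derivative_iff bump_fun_def)
  qed
  then show ?thesis by blast
qed

lemma bump_fun_continuous: "continuous_on UNIV (bump_fun p m)"
  using bump_fun_has_derivative[of p m] by (metis DERIV_isCont continuous_at_imp_continuous_on)

definition smooth_bumps :: "(real \<Rightarrow> real) set" where
  "smooth_bumps = {b. \<exists>p m. b = bump_fun p m}"

lemma smooth_bumps_deriv: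
  assumes "b \<in> smooth_bumps" obtains b' where "b' \<in> smooth_bumps" "\<And>x. (b has_real_derivative b' x) (at x)"
  using assms bump_fun_has_derivative unfolding smooth_bumps_def mem_Collect_eq by metis

lemma smooth_bumps_continuous: "b \<in> smooth_bumps \<Longrightarrow> continuous_on S b"
  using bump_fun_continuous continuous_on_subset unfolding smooth_bumps_def by blast

lemma smooth_bumps_support: "b \<in> smooth_bumps \<Longrightarrow> \<bar>x\<bar> \<ge> 1 \<Longrightarrow> b x = 0"
  by (auto simp: smooth_bumps_def bump_fun_def)

lemma smooth_bumps_bounded:
  assumes "b \<in> smooth_bumps" obtains C where "C > 0" "\<And>x. \<bar>b x\<bar> \<le> C"
proof -
  have "bounded (b ` {-1..1})"
    by (intro compact_imp_bounded compact_continuous_image smooth_bumps_continuous assms) auto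
  then obtain P where P: "P > 0" "\<And>x. \<bar>x\<bar> \<le> 1 \<Longrightarrow> \<bar>b x\<bar> \<le> P"
    by (auto simp: bounded_pos abs_le_iff)
  have "\<bar>b x\<bar> \<le> P" for x
    using P smooth_bumps_support[OF assms, of x] by (cases "\<bar>x\<bar> \<le> 1") auto
  with P(1) show thesis by (rule that)
qed

lemma continuous_real_antiderivative:
  fixes g :: "real \<Rightarrow> real"
  assumes "continuous_on UNIV g"
  obtains F where "\<And>x. (F has_real_derivative g x) (at x)"
proof -
  have "((\<lambda>u. LBINT y=0..u. g y) has_real_derivative g x) (at x)" for x
  proof -
    define r where "r = \<bar>x\<bar> + 1"
    have "((\<lambda>u. LBINT y=ereal 0..u. g y) has_vector_derivative g x) (at x within {-r..r})"
      by (rule interval_integral_FTC2) (use assms continuous_on_subset in \<open>auto simp: r_def\<close>)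
    then show ?thesis
      by (simp add: has_real_derivative_iff_has_vector_derivative at_within_Icc_at r_def zero_ereal_def)
  qed
  then show thesis by (rule that)
qed

definition raw_bump :: "real \<Rightarrow> real" where "raw_bump = bump_fun 1 0"

text \<open>Any antiderivative would do: its additive constant cancels in \<open>bump_mass\<close>
  and in \<open>kern_primitive\<close>.\<close>

definition raw_primitive :: "real \<Rightarrow> real" where
  "raw_primitive = (SOME F. \<forall>x. (F has_real_derivative raw_bump x) (at x))"

definition bump_mass :: real where "bump_mass = raw_primitive 1 - raw_primitive (-1)"
definition kern :: "real \<Rightarrow> real" where "kern x = raw_bump x / bump_mass"
definition kern_primitive :: "real \<Rightarrow> real" where "kern_primitive x = (raw_primitive x - raw_primitive (-1)) / bump_mass"

lemma raw_bump_smooth: "raw_bump \<in> smooth_bumps"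
  by (auto simp: smooth_bumps_def raw_bump_def)

lemma raw_bump_nonneg: "raw_bump x \<ge> 0"
  by (auto simp: raw_bump_def bump_fun_def)

lemma raw_primitive_deriv: "(raw_primitive has_real_derivative raw_bump x) (at x)"
proof -
  obtain F where "\<And>x. (F has_real_derivative raw_bump x) (at x)"
    using continuous_real_antiderivative[OF smooth_bumps_continuous[OF raw_bump_smooth]] by blast
  then have "\<exists>F. \<forall>x. (F has_real_derivative raw_bump x) (at x)" by blast
  from someI_ex[OF this] show ?thesis unfolding raw_primitive_def by blast
qed

lemma raw_primitive_mono: "x \<le> y \<Longrightarrow> raw_primitive x \<le> raw_primitive y"
  using DERIV_nonneg_imp_nondecreasing[of x y raw_primitive] raw_primitive_deriv raw_bump_nonneg by blast

text \<open>A nondecreasing primitive with no increment over \<open>{-1..1}\<close> would be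
  constant there, which forces \<open>raw_bump 0 = 0\<close>, whereas the value is
  \<open>exp (-1)\<close>.\<close>

lemma bump_mass_pos: "bump_mass > 0"
proof (rule ccontr)
  assume "\<not> bump_mass > 0"
  then have const: "raw_primitive x = raw_primitive (-1)" if "x \<in> {-1<..<1}" for x
    using that raw_primitive_mono[of "-1" x] raw_primitive_mono[of x 1] by (auto simp: bump_mass_def)
  have "((\<lambda>x. raw_primitive (-1)) has_real_derivative raw_bump 0) (at 0)"
    by (rule has_field_derivative_transform_within_open[OF raw_primitive_deriv, where S="{-1<..<1}"])
       (use const in auto)
  then have "raw_bump 0 = 0" by (metis DERIV_const DERIV_unique)
  then show False by (simp add: raw_bump_def bump_fun_def)
qed

lemma kern_nonneg: "kern x \<ge> 0"
  using raw_bump_nonneg bump_mass_pos by (simp add: kern_def)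

lemma kern_primitive_deriv: "(kern_primitive has_real_derivative kern x) (at x)"
  unfolding kern_primitive_def kern_def using DERIV_cdivide[OF DERIV_diff[OF raw_primitive_deriv DERIV_const]] by simp

lemma raw_primitive_eq:
  assumes "x < y" "y \<le> -1 \<or> 1 \<le> x" shows "raw_primitive x = raw_primitive y"
proof -
  have "\<exists>z>x. z < y \<and> raw_primitive y - raw_primitive x = (y - x) * raw_bump z"
    using assms raw_primitive_deriv by (intro MVT2) auto
  then obtain z where "z > x" "z < y" "raw_primitive y - raw_primitive x = (y - x) * raw_bump z" by blast
  then show ?thesis using assms smooth_bumps_support[OF raw_bump_smooth, of z] by auto
qed

lemma kern_primitive_left: "x \<le> -1 \<Longrightarrow> kern_primitive x = 0"
  using raw_primitive_eq[of x "-1"] by (cases "x = -1") (auto simp: kern_primitive_def)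

lemma kern_primitive_right: "x \<ge> 1 \<Longrightarrow> kern_primitive x = 1"
  using raw_primitive_eq[of 1 x] bump_mass_pos by (cases "x = 1") (auto simp: kern_primitive_def bump_mass_def)

lemma kern_support: "\<bar>x\<bar> \<ge> 1 \<Longrightarrow> kern x = 0"
  using smooth_bumps_support[OF raw_bump_smooth] by (simp add: kern_def)

lemma kern_continuous: "continuous_on S kern"
  unfolding kern_def using bump_mass_pos
  by (intro continuous_intros smooth_bumps_continuous[OF raw_bump_smooth]) auto

lemma kern_lipschitz: obtains C where "C > 0" "\<And>x y. \<bar>kern x - kern y\<bar> \<le> C * \<bar>x - y\<bar>"
proof -
  obtain b' where b': "b' \<in> smooth_bumps" "\<And>x. (raw_bump has_real_derivative b' x) (at x)"
    using smooth_bumps_deriv[OF raw_bump_smooth] by blast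
  obtain C where C: "C > 0" "\<And>x. \<bar>b' x\<bar> \<le> C" using smooth_bumps_bounded[OF b'(1)] by blast
  have d: "(kern has_real_derivative b' x / bump_mass) (at x)" for x
    unfolding kern_def by (rule DERIV_cdivide[OF b'(2)])
  have "\<bar>kern x - kern y\<bar> \<le> C / bump_mass * \<bar>x - y\<bar>" for x y
    using field_differentiable_bound[of UNIV kern "\<lambda>x. b' x / bump_mass" "C / bump_mass" x y] d C bump_mass_pos
    by (auto simp: divide_right_mono)
  then show thesis using that[of "C / bump_mass"] C bump_mass_pos by auto
qed

lemma kern_primitive_mono: "x \<le> y \<Longrightarrow> kern_primitive x \<le> kern_primitive y"
  using DERIV_nonneg_imp_nondecreasing[of x y kern_primitive] kern_primitive_deriv kern_nonneg by blast

lemma kern_primitive_bounds: "0 \<le> kern_primitive x" "kern_primitive x \<le> 1"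
  using kern_primitive_mono[of "min x (-1)" x] kern_primitive_mono[of x "max x 1"] kern_primitive_left[of "min x (-1)"] kern_primitive_right[of "max x 1"] by auto

lemma kern_primitive_continuous: "continuous_on S kern_primitive"
  using kern_primitive_deriv by (meson DERIV_isCont continuous_at_imp_continuous_on)

text \<open>\<open>mol a\<close> is a kernel of unit mass supported in \<open>{-a..a}\<close>. Its
  primitive \<open>ramp a\<close> is a smoothed Heaviside function, which later replaces the
  indicator of a half line.\<close>

definition mol :: "real \<Rightarrow> real \<Rightarrow> real" where "mol a z = kern (z / a) / a"
definition ramp :: "real \<Rightarrow> real \<Rightarrow> real" where "ramp a z = kern_primitive (z / a)"

lemma
  assumes a: "a > 0"
  shows mol_nonneg: "mol a z \<ge> 0"
    and mol_support: "\<bar>z\<bar> \<ge> a \<Longrightarrow> mol a z = 0"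
    and mol_continuous: "continuous_on S (mol a)"
    and ramp_deriv: "(ramp a has_real_derivative mol a z) (at z)"
    and ramp_left: "z \<le> -a \<Longrightarrow> ramp a z = 0"
    and ramp_right: "z \<ge> a \<Longrightarrow> ramp a z = 1"
    and ramp_bounds: "0 \<le> ramp a z" "ramp a z \<le> 1"
    and ramp_mono: "y \<le> z \<Longrightarrow> ramp a y \<le> ramp a z"
    and ramp_continuous: "continuous_on S (ramp a)"
proof -
  show "mol a z \<ge> 0" using a kern_nonneg by (simp add: mol_def)
  show "\<bar>z\<bar> \<ge> a \<Longrightarrow> mol a z = 0" using a kern_support[of "z/a"] by (simp add: mol_def)
  show "continuous_on S (mol a)" unfolding mol_def using a
    by (intro continuous_intros continuous_on_compose2[OF kern_continuous[of UNIV]]) auto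
  show "(ramp a has_real_derivative mol a z) (at z)"
    unfolding ramp_def mol_def using DERIV_chain2[OF kern_primitive_deriv DERIV_cdivide[OF DERIV_ident]] by simp
  show "z \<le> -a \<Longrightarrow> ramp a z = 0" using a by (auto simp: ramp_def intro!: kern_primitive_left simp: field_simps)
  show "z \<ge> a \<Longrightarrow> ramp a z = 1" using a by (auto simp: ramp_def intro!: kern_primitive_right simp: field_simps)
  show "0 \<le> ramp a z" "ramp a z \<le> 1" by (auto simp: ramp_def kern_primitive_bounds)
  show "y \<le> z \<Longrightarrow> ramp a y \<le> ramp a z" using a by (auto simp: ramp_def intro!: kern_primitive_mono divide_right_mono)
  show "continuous_on S (ramp a)" unfolding ramp_def using a
    by (intro continuous_intros continuous_on_compose2[OF kern_primitive_continuous[of UNIV]]) auto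
qed

lemma has_bochner_integral_deriv:
  fixes g :: "real \<Rightarrow> real"
  assumes ab: "a \<le> b" and F: "\<And>x. (F has_real_derivative g x) (at x)" and g: "continuous_on UNIV g"
    and supp: "\<And>x. x \<notin> {a..b} \<Longrightarrow> g x = 0"
  shows "has_bochner_integral lborel g (F b - F a)"
proof -
  have "has_bochner_integral lborel (\<lambda>y. g y * indicator {a..b} y) (F b - F a)"
    using ab F g by (intro has_bochner_integral_FTC_Icc_real) (auto simp: continuous_on_eq_continuous_at)
  moreover have "(\<lambda>y. g y * indicator {a..b} y) = g"
    using supp by (auto simp: fun_eq_iff indicator_def)
  ultimately show ?thesis by simp
qed

lemma ramp_shift_deriv: "a > 0 \<Longrightarrow> ((\<lambda>y. ramp a (y - x)) has_real_derivative mol a (y - x)) (at y)"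
  using DERIV_shift[of "ramp a" "mol a (y - x)" y "- x"] ramp_deriv by simp

lemma mol_shift_continuous: "a > 0 \<Longrightarrow> continuous_on S (\<lambda>y. mol a (y - x))"
  by (intro continuous_on_compose2[OF mol_continuous[of a UNIV]] continuous_intros) auto

lemma mol_has_integral:
  assumes "a > 0" shows "has_bochner_integral lborel (\<lambda>y. mol a (y - x)) 1"
proof -
  have "has_bochner_integral lborel (\<lambda>y. mol a (y - x)) (ramp a (x + a - x) - ramp a (x - a - x))"
    using assms
    by (intro has_bochner_integral_deriv ramp_shift_deriv mol_shift_continuous mol_support) auto
  then show ?thesis using assms by (simp add: ramp_left ramp_right)
qed

lemma mol_le: obtains C where "C > 0" "\<And>a z. a > 0 \<Longrightarrow> mol a z \<le> C / a"
proof -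
  obtain C where "C > 0" "\<And>x. \<bar>raw_bump x\<bar> \<le> C" using smooth_bumps_bounded[OF raw_bump_smooth] by blast
  moreover have "mol a z \<le> (C / bump_mass) / a" if "a > 0" for a z
    using calculation bump_mass_pos that unfolding mol_def kern_def
    by (intro divide_right_mono) (auto simp: abs_le_iff)
  ultimately show thesis using that[of "C / bump_mass"] bump_mass_pos by auto
qed

lemma mol_lipschitz:
  assumes "a > 0" obtains C where "C > 0" "\<And>y z. \<bar>mol a y - mol a z\<bar> \<le> C * \<bar>y - z\<bar>"
proof -
  obtain C where C: "C > 0" "\<And>x y. \<bar>kern x - kern y\<bar> \<le> C * \<bar>x - y\<bar>"
    using kern_lipschitz by blast
  have "\<bar>mol a y - mol a z\<bar> \<le> C / a\<^sup>2 * \<bar>y - z\<bar>" for y z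
  proof -
    have "\<bar>mol a y - mol a z\<bar> = \<bar>kern (y / a) - kern (z / a)\<bar> / a"
      using assms by (simp add: mol_def diff_divide_distrib[symmetric] abs_divide)
    also have "\<dots> \<le> (C * \<bar>y / a - z / a\<bar>) / a" using C(2) assms by (intro divide_right_mono) auto
    also have "\<dots> = C / a\<^sup>2 * \<bar>y - z\<bar>"
      using assms by (simp add: diff_divide_distrib[symmetric] abs_divide power2_eq_square)
    finally show ?thesis .
  qed
  then show thesis using that[of "C / a\<^sup>2"] C assms by auto
qed

section \<open>Entropy inequality for continuously differentiable test functions\<close>

text \<open>Convolution over a fixed compact box, with independent profiles \<open>b\<close> in
  space and \<open>c\<close> in time. A partial derivative replaces one profile by its derivative
  and multiplies by \<open>n\<close>, so it stays in the same family.\<close>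

definition conv :: "real \<Rightarrow> (real \<times> real \<Rightarrow> real) \<Rightarrow> real \<Rightarrow> (real \<Rightarrow> real) \<Rightarrow> (real \<Rightarrow> real) \<Rightarrow> real \<times> real \<Rightarrow> real" where
  "conv X \<psi> n b c p = integral (cbox (-X, -X) (X, X)) (\<lambda>q. \<psi> q * b (n * (fst p - fst q)) * c (n * (snd p - snd q)))"

context
  fixes X n :: real and \<psi> :: "real \<times> real \<Rightarrow> real"
  assumes cont: "continuous_on UNIV \<psi>"
begin

lemma conv_integrand_continuous:
  assumes "b \<in> smooth_bumps" "c \<in> smooth_bumps"
  shows "continuous_on S (\<lambda>(p, q). \<psi> q * b (n * (fst p - fst q)) * c (n * (snd p - snd q)))"
  unfolding case_prod_unfold
  by (intro continuous_intros continuous_on_compose2[OF cont] continuous_on_compose2[OF smooth_bumps_continuous[OF assms(1), of UNIV]]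
      continuous_on_compose2[OF smooth_bumps_continuous[OF assms(2), of UNIV]]) auto

lemma conv_continuous:
  assumes "b \<in> smooth_bumps" "c \<in> smooth_bumps"
  shows "continuous_on S (conv X \<psi> n b c)"
  unfolding conv_def using conv_integrand_continuous[OF assms]
  by (intro integral_continuous_on_param) auto

lemma conv_integrand_integrable:
  assumes "b \<in> smooth_bumps" "c \<in> smooth_bumps"
  shows "(\<lambda>q. \<psi> q * b (n * (fst p - fst q)) * c (n * (snd p - snd q))) integrable_on cbox (-X, -X) (X, X)"
proof -
  have "continuous_on UNIV (\<lambda>q. (\<lambda>(p, q). \<psi> q * b (n * (fst p - fst q)) * c (n * (snd p - snd q))) (p, q))"
    by (intro continuous_on_compose2[OF conv_integrand_continuous[OF assms, of UNIV]] continuous_intros) auto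
  then show ?thesis by (intro integrable_continuous) (auto intro: continuous_on_subset)
qed

lemma conv_has_derivative_fst:
  assumes b: "b \<in> smooth_bumps" "b' \<in> smooth_bumps" "\<And>x. (b has_real_derivative b' x) (at x)" and c: "c \<in> smooth_bumps"
  shows "((\<lambda>x. conv X \<psi> n b c (x, t)) has_real_derivative n * conv X \<psi> n b' c (x, t)) (at x)"
proof -
  let ?fx = "\<lambda>x q. n * (\<psi> q * b' (n * (x - fst q)) * c (n * (t - snd q)))"
  have "((\<lambda>x. integral (cbox (-X, -X) (X, X)) (\<lambda>q. \<psi> q * b (n * (x - fst q)) * c (n * (t - snd q)))) has_field_derivative
      integral (cbox (-X, -X) (X, X)) (?fx x)) (at x within UNIV)"
  proof (rule leibniz_rule_field_derivative)
    show "((\<lambda>x. \<psi> q * b (n * (x - fst q)) * c (n * (t - snd q))) has_field_derivative ?fx x q) (at x within UNIV)" for x q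
      by (rule derivative_eq_intros DERIV_chain2[OF b(3)] refl)+ (simp add: algebra_simps)
    show "(\<lambda>q. \<psi> q * b (n * (x - fst q)) * c (n * (t - snd q))) integrable_on cbox (-X, -X) (X, X)" for x
      using conv_integrand_integrable[OF b(1) c, of "(x, t)"] by simp
    have "continuous_on UNIV (\<lambda>z. n * (\<lambda>(p, q). \<psi> q * b' (n * (fst p - fst q)) * c (n * (snd p - snd q))) ((fst z, t), snd z))"
      by (intro continuous_on_mult continuous_on_compose2[OF conv_integrand_continuous[OF b(2) c, of UNIV]] continuous_intros) auto
    then show "continuous_on (UNIV \<times> cbox (-X, -X) (X, X)) (\<lambda>(x, q). ?fx x q)"
      by (auto simp: case_prod_unfold intro: continuous_on_subset)
  qed auto
  then show ?thesis by (simp add: conv_def)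
qed

lemma conv_has_derivative_snd:
  assumes c: "c \<in> smooth_bumps" "c' \<in> smooth_bumps" "\<And>x. (c has_real_derivative c' x) (at x)" and b: "b \<in> smooth_bumps"
  shows "((\<lambda>t. conv X \<psi> n b c (x, t)) has_real_derivative n * conv X \<psi> n b c' (x, t)) (at t)"
proof -
  let ?ft = "\<lambda>t q. n * (\<psi> q * b (n * (x - fst q)) * c' (n * (t - snd q)))"
  have "((\<lambda>t. integral (cbox (-X, -X) (X, X)) (\<lambda>q. \<psi> q * b (n * (x - fst q)) * c (n * (t - snd q)))) has_field_derivative
      integral (cbox (-X, -X) (X, X)) (?ft t)) (at t within UNIV)"
  proof (rule leibniz_rule_field_derivative)
    show "((\<lambda>t. \<psi> q * b (n * (x - fst q)) * c (n * (t - snd q))) has_field_derivative ?ft t q) (at t within UNIV)" for t q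
      by (rule derivative_eq_intros DERIV_chain2[OF c(3)] refl)+ (simp add: algebra_simps)
    show "(\<lambda>q. \<psi> q * b (n * (x - fst q)) * c (n * (t - snd q))) integrable_on cbox (-X, -X) (X, X)" for t
      using conv_integrand_integrable[OF b c(1), of "(x, t)"] by simp
    have "continuous_on UNIV (\<lambda>z. n * (\<lambda>(p, q). \<psi> q * b (n * (fst p - fst q)) * c' (n * (snd p - snd q))) ((x, fst z), snd z))"
      by (intro continuous_on_mult continuous_on_compose2[OF conv_integrand_continuous[OF b c(2), of UNIV]] continuous_intros) auto
    then show "continuous_on (UNIV \<times> cbox (-X, -X) (X, X)) (\<lambda>(t, q). ?ft t q)"
      by (auto simp: case_prod_unfold intro: continuous_on_subset)
  qed auto
  then show ?thesis by (simp add: conv_def)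
qed

lemma conv_differentiable:
  assumes b: "b \<in> smooth_bumps" and c: "c \<in> smooth_bumps"
  shows "conv X \<psi> n b c differentiable at p"
proof -
  obtain b' where b': "b' \<in> smooth_bumps" "\<And>x. (b has_real_derivative b' x) (at x)" using smooth_bumps_deriv[OF b] by blast
  obtain c' where c': "c' \<in> smooth_bumps" "\<And>x. (c has_real_derivative c' x) (at x)" using smooth_bumps_deriv[OF c] by blast
  obtain x t where p: "p = (x, t)" by force
  define g where "g x t = conv X \<psi> n b c (x, t)" for x t
  define h where "h x t = blinfun_mult_right (n * conv X \<psi> n b c' (x, t))" for x t
  have "((\<lambda>(x, t). g x t) has_derivative
      (\<lambda>(dx, dt). n * conv X \<psi> n b' c (x, t) * dx + blinfun_apply (h x t) dt)) (at (x, t) within UNIV \<times> UNIV)"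
  proof (rule has_derivative_partialsI)
    show "((\<lambda>x. g x t) has_derivative (*) (n * conv X \<psi> n b' c (x, t))) (at x within UNIV)"
      using conv_has_derivative_fst[OF b b' c] by (simp add: g_def has_field_derivative_def)
    show "((\<lambda>t. g x t) has_derivative blinfun_apply (h x t)) (at t within UNIV)" for x t
      using conv_has_derivative_snd[OF c c' b] by (simp add: g_def h_def has_field_derivative_def)
    have "continuous_on UNIV (\<lambda>z. blinfun_mult_right (n * conv X \<psi> n b c' z))"
      by (intro bounded_linear.continuous_on[OF bounded_linear_blinfun_mult_right] continuous_intros conv_continuous b c')
    then show "continuous (at (x, t) within UNIV \<times> UNIV) (\<lambda>(x, t). h x t)"
      by (simp add: h_def case_prod_unfold continuous_on_eq_continuous_at)
  qed auto
  then show ?thesis unfolding p by (auto simp: g_def differentiable_def case_prod_unfold)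
qed

text \<open>The induction needs arbitrary profiles and a free scalar \<open>r\<close>, because each
  differentiation changes a profile and produces a factor \<open>n\<close>.\<close>

lemma conv_smooth:
  assumes "b \<in> smooth_bumps" and "c \<in> smooth_bumps"
  shows "Ck k (\<lambda>p. r * conv X \<psi> n b c p)"
  using assms
proof (induction k arbitrary: b c r)
  case 0
  then show ?case by (auto intro!: continuous_intros conv_continuous)
next
  case (Suc k)
  obtain b' where b': "b' \<in> smooth_bumps" "\<And>x. (b has_real_derivative b' x) (at x)" using smooth_bumps_deriv[OF Suc.prems(1)] by blast
  obtain c' where c': "c' \<in> smooth_bumps" "\<And>x. (c has_real_derivative c' x) (at x)" using smooth_bumps_deriv[OF Suc.prems(2)] by blast
  have "partial_x (\<lambda>p. r * conv X \<psi> n b c p) = (\<lambda>p. (r * n) * conv X \<psi> n b' c p)"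
  proof
    fix p
    show "partial_x (\<lambda>p. r * conv X \<psi> n b c p) p = (r * n) * conv X \<psi> n b' c p"
      unfolding partial_x_def
      using DERIV_cmult[OF conv_has_derivative_fst[OF Suc.prems(1) b' Suc.prems(2), of "snd p" "fst p"], of r, THEN DERIV_imp_deriv]
      by (simp add: mult.assoc)
  qed
  moreover have "partial_t (\<lambda>p. r * conv X \<psi> n b c p) = (\<lambda>p. (r * n) * conv X \<psi> n b c' p)"
  proof
    fix p
    show "partial_t (\<lambda>p. r * conv X \<psi> n b c p) p = (r * n) * conv X \<psi> n b c' p"
      unfolding partial_t_def
      using DERIV_cmult[OF conv_has_derivative_snd[OF Suc.prems(2) c' Suc.prems(1), of "fst p" "snd p"], of r, THEN DERIV_imp_deriv]
      by (simp add: mult.assoc)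
  qed
  moreover have "(\<lambda>p. r * conv X \<psi> n b c p) differentiable at p" for p
    using conv_differentiable[OF Suc.prems] by (intro differentiable_mult) auto
  ultimately show ?case using Suc.IH[OF b'(1) Suc.prems(2)] Suc.IH[OF Suc.prems(1) c'(1)] by simp
qed

end

section \<open>Integrals of bounded functions with compact support\<close>

lemma integrable_const_indicator_cbox: "integrable lborel (\<lambda>p. C * indicator (cbox a b) p :: real)"
  by (intro integrable_mult_right integrable_real_indicator emeasure_lborel_cbox_finite) auto

lemma integrable_bounded_cbox:
  fixes h :: "'a::euclidean_space \<Rightarrow> real"
  assumes "h \<in> borel_measurable borel" and h: "\<And>x. \<bar>h x\<bar> \<le> C" "\<And>x. x \<notin> cbox a b \<Longrightarrow> h x = 0"
  shows "integrable lborel h"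
proof (rule Bochner_Integration.integrable_bound[OF integrable_const_indicator_cbox[of C a b]])
  have "\<bar>h x\<bar> \<le> \<bar>C * indicator (cbox a b) x\<bar>" for x
    using h(1)[of x] h(2)[of x] by (cases "x \<in> cbox a b") auto
  then show "AE x in lborel. norm (h x) \<le> norm (C * indicator (cbox a b) x)" by simp
qed (use assms(1) in simp)

lemma integrable_mult_bounded:
  fixes g h :: "'a::euclidean_space \<Rightarrow> real"
  assumes g: "integrable lborel g" and [measurable]: "h \<in> borel_measurable borel" and h: "\<And>x. \<bar>h x\<bar> \<le> C"
  shows "integrable lborel (\<lambda>x. h x * g x)"
proof (rule Bochner_Integration.integrable_bound[OF integrable_mult_right[OF g, of C]])
  note [measurable] = borel_measurable_integrable[OF g]
  show "(\<lambda>x. h x * g x) \<in> borel_measurable lborel" by measurable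
  have "\<bar>h x * g x\<bar> \<le> \<bar>C * g x\<bar>" for x
    unfolding abs_mult using order_trans[OF h abs_ge_self] by (intro mult_right_mono) auto
  then show "AE x in lborel. norm (h x * g x) \<le> norm (C * g x)" by simp
qed

lemma continuous_compact_support:
  fixes g :: "'a::euclidean_space \<Rightarrow> real"
  assumes "continuous_on UNIV g" and supp: "\<And>x. x \<notin> cbox a b \<Longrightarrow> g x = 0"
  shows "integrable lborel g" "integral\<^sup>L lborel g = integral (cbox a b) g"
proof -
  have eq: "(\<lambda>x. indicator (cbox a b) x *\<^sub>R g x) = g"
    using supp by (auto simp: fun_eq_iff indicator_def)
  have "integrable lborel (\<lambda>x. indicator (cbox a b) x *\<^sub>R g x)"
    using assms(1) by (intro borel_integrable_compact) (auto intro: continuous_on_subset)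
  then show int: "integrable lborel g" by (simp only: eq)
  have "set_integrable lborel (cbox a b) g" using int by (simp only: set_integrable_def eq)
  then have "(LBINT x:cbox a b. g x) = integral (cbox a b) g"
    by (rule set_borel_integral_eq_integral)
  then show "integral\<^sup>L lborel g = integral (cbox a b) g" by (simp only: set_lebesgue_integral_def eq)
qed

lemma lborel_integral_affine:
  fixes f :: "'a::euclidean_space \<Rightarrow> real"
  assumes [measurable]: "f \<in> borel_measurable borel" and "c \<noteq> 0"
  shows "integral\<^sup>L lborel f = \<bar>c\<bar> ^ DIM('a) * (LBINT z. f (t + c *\<^sub>R z))"
proof -
  have "integral\<^sup>L lborel f = integral\<^sup>L (density (distr lborel borel (\<lambda>x. t + c *\<^sub>R x)) (\<lambda>_. ennreal (\<bar>c\<bar> ^ DIM('a)))) f"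
    using lborel_affine[OF assms(2), of t] by (metis ennreal_power abs_ge_zero)
  also have "\<dots> = integral\<^sup>L (distr lborel borel (\<lambda>x. t + c *\<^sub>R x)) (\<lambda>x. \<bar>c\<bar> ^ DIM('a) * f x)"
    by (subst integral_density) auto
  also have "\<dots> = \<bar>c\<bar> ^ DIM('a) * (LBINT z. f (t + c *\<^sub>R z))"
    by (subst integral_distr) auto
  finally show ?thesis .
qed

section \<open>Mollification in space and time together\<close>

lemma kern_has_integral: "has_bochner_integral lborel kern 1"
  using mol_has_integral[of 1 0] by (simp add: mol_def)

lemma kern_measurable [measurable]: "kern \<in> borel_measurable borel"
  by (intro borel_measurable_continuous_onI kern_continuous)

abbreviation kern2 :: "real \<times> real \<Rightarrow> real" where "kern2 z \<equiv> kern (fst z) * kern (snd z)"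

lemma kern2_integral: "integrable lborel (\<lambda>z. kern2 z)"
  "(LBINT z. kern2 z) = 1"
proof -
  have "continuous_on UNIV (\<lambda>z. kern2 z)"
    by (intro continuous_intros continuous_on_compose2[OF kern_continuous[of UNIV]]) auto
  moreover have "kern2 z = 0" if "z \<notin> cbox (-1, -1) (1, 1)" for z
    using that kern_support[of "fst z"] kern_support[of "snd z"] by (cases z) (auto simp: not_le)
  ultimately show int: "integrable lborel (\<lambda>z. kern2 z)"
    by (rule continuous_compact_support)
  have "(LINT z|(lborel \<Otimes>\<^sub>M lborel). kern2 z) = (LBINT x. LBINT y. kern x * kern y)"
    using lborel_pair.integral_fst'[of "\<lambda>z. kern2 z"] int by (simp add: lborel_prod)
  also have "\<dots> = 1" using kern_has_integral by (simp add: has_bochner_integral_iff)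
  finally show "(LBINT z. kern2 z) = 1" by (simp add: lborel_prod)
qed

text \<open>The kernel is kept fixed and the argument of \<open>g\<close> is shifted, so that sign,
  bounds, limits and first derivatives pass directly from \<open>g\<close> to its average.
  Smoothness of all orders is visible in the other form, \<open>conv\<close>.\<close>

definition average :: "(real \<times> real \<Rightarrow> real) \<Rightarrow> real \<Rightarrow> real \<times> real \<Rightarrow> real" where
  "average g n p = (LBINT z. g (p - z /\<^sub>R n) * kern2 z)"

lemma
  assumes g: "continuous_on UNIV g"
  shows average_integrable: "integrable lborel (\<lambda>z. g (p - z /\<^sub>R n) * kern2 z)"
    and average_eq: "average g n p = integral (cbox (-1, -1) (1, 1)) (\<lambda>z. g (p - z /\<^sub>R n) * kern2 z)"
proof -
  have 1: "continuous_on UNIV (\<lambda>z. g (p - z /\<^sub>R n) * kern2 z)"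
    by (intro continuous_intros continuous_on_compose2[OF kern_continuous[of UNIV]] continuous_on_compose2[OF g]) auto
  have 2: "g (p - z /\<^sub>R n) * kern2 z = 0" if "z \<notin> cbox (-1, -1) (1, 1)" for z
    using that kern_support[of "fst z"] kern_support[of "snd z"] by (cases z) (auto simp: not_le)
  show "integrable lborel (\<lambda>z. g (p - z /\<^sub>R n) * kern2 z)"
    using 1 2 by (rule continuous_compact_support)
  show "average g n p = integral (cbox (-1, -1) (1, 1)) (\<lambda>z. g (p - z /\<^sub>R n) * kern2 z)"
    unfolding average_def using 1 2 by (rule continuous_compact_support)
qed

lemma average_bound:
  assumes "continuous_on UNIV g" "\<And>p. \<bar>g p\<bar> \<le> C"
  shows "\<bar>average g n p\<bar> \<le> C"
proof -
  have "\<bar>average g n p\<bar> \<le> (LBINT z. \<bar>g (p - z /\<^sub>R n) * kern2 z\<bar>)"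
    unfolding average_def by (rule integral_abs_bound)
  also have "\<dots> \<le> (LBINT z. C * kern2 z)"
    by (intro integral_mono integrable_abs average_integrable assms integrable_mult_right kern2_integral)
       (auto simp: abs_mult kern_nonneg intro!: mult_right_mono assms mult_nonneg_nonneg)
  also have "\<dots> = C" using kern2_integral by simp
  finally show ?thesis .
qed

lemma average_nonneg: "(\<And>p. g p \<ge> 0) \<Longrightarrow> average g n p \<ge> 0"
  unfolding average_def by (intro integral_nonneg_AE AE_I2 mult_nonneg_nonneg kern_nonneg)

lemma average_tendsto:
  assumes g: "continuous_on UNIV g" "\<And>p. \<bar>g p\<bar> \<le> C"
  shows "(\<lambda>n. average g (real (Suc n)) p) \<longlonglongrightarrow> g p"
proof -
  have "(\<lambda>n. LBINT z. g (p - z /\<^sub>R real (Suc n)) * kern2 z)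
      \<longlonglongrightarrow> (LBINT z. g p * kern2 z)"
  proof (rule integral_dominated_convergence)
    show "integrable lborel (\<lambda>z. C * kern2 z)"
      by (intro integrable_mult_right kern2_integral)
    show "AE z in lborel. (\<lambda>n. g (p - z /\<^sub>R real (Suc n)) * kern2 z) \<longlonglongrightarrow> g p * kern2 z"
    proof (intro AE_I2 tendsto_intros)
      fix z :: "real \<times> real"
      have "(\<lambda>n. p - inverse (real (Suc n)) *\<^sub>R z) \<longlonglongrightarrow> p - 0 *\<^sub>R z"
        by (intro tendsto_intros LIMSEQ_inverse_real_of_nat)
      then have "(\<lambda>n. p - z /\<^sub>R real (Suc n)) \<longlonglongrightarrow> p" by simp
      moreover have "isCont g p" using g(1) by (cases p) (simp add: continuous_on_eq_continuous_at)
      ultimately show "(\<lambda>n. g (p - z /\<^sub>R real (Suc n))) \<longlonglongrightarrow> g p"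
        by (rule isCont_tendsto_compose[rotated])
    qed
    show "AE z in lborel. norm (g (p - z /\<^sub>R real (Suc n)) * kern2 z) \<le> C * kern2 z" for n
      by (auto simp: abs_mult kern_nonneg intro!: mult_right_mono g mult_nonneg_nonneg)
    show "(\<lambda>z. g (p - z /\<^sub>R real (Suc n)) * kern2 z) \<in> borel_measurable lborel" for n
      using average_integrable[OF g(1)] by (rule borel_measurable_integrable)
    show "(\<lambda>z. g p * kern2 z) \<in> borel_measurable lborel"
      using kern2_integral by (intro borel_measurable_integrable integrable_mult_right)
  qed
  then show ?thesis using kern2_integral by (simp add: average_def)
qed

lemma average_support:
  assumes "n > 0" and supp: "\<And>p. p \<notin> cbox (a, b) (c, d) \<Longrightarrow> g p = 0"
    and p: "p \<notin> cbox (a - 1 / n, b - 1 / n) (c + 1 / n, d + 1 / n)"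
  shows "average g n p = 0"
proof -
  have "g (p - z /\<^sub>R n) * kern2 z = 0" for z
  proof (cases "\<bar>fst z\<bar> \<ge> 1 \<or> \<bar>snd z\<bar> \<ge> 1")
    case False
    then have "\<bar>fst z\<bar> / n \<le> 1 / n" "\<bar>snd z\<bar> / n \<le> 1 / n"
      using assms(1) by (auto intro: divide_right_mono)
    then have "\<bar>fst z / n\<bar> \<le> 1 / n" "\<bar>snd z / n\<bar> \<le> 1 / n"
      using assms(1) by (simp_all only: abs_divide abs_of_pos)
    then have "- (1 / n) \<le> fst z / n" "fst z / n \<le> 1 / n" "- (1 / n) \<le> snd z / n" "snd z / n \<le> 1 / n"
      by linarith+
    moreover have "p - z /\<^sub>R n = (fst p - fst z / n, snd p - snd z / n)"
      by (cases p, cases z) (simp add: divide_inverse_commute)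
    moreover have "cbox (a, b) (c, d) = {a..c} \<times> {b..d}" "cbox (a - 1 / n, b - 1 / n) (c + 1 / n, d + 1 / n) = {a - 1 / n..c + 1 / n} \<times> {b - 1 / n..d + 1 / n}"
      by (simp_all add: cbox_Pair_eq)
    ultimately have "p - z /\<^sub>R n \<notin> cbox (a, b) (c, d)"
      using p by (simp add: mem_Times_iff) linarith
    then show ?thesis using supp by simp
  qed (auto simp: kern_support)
  then show ?thesis by (simp only: average_def Bochner_Integration.integral_zero)
qed

text \<open>Substitution \<open>q = p - z / n\<close> in the plane: the Jacobian accounts for
  \<open>n\<^sup>2\<close>, the normalisation of the two kernels for
  \<open>bump_mass\<^sup>2\<close>. The support of \<open>g\<close> allows the integral to be cut
  down to the box.\<close>

lemma average_eq_conv: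
  assumes g: "continuous_on UNIV g" and n: "n > 0" and supp: "\<And>p. p \<notin> cbox (-X, -X) (X, X) \<Longrightarrow> g p = 0"
  shows "average g n p = (n\<^sup>2 / bump_mass\<^sup>2) * conv X g n raw_bump raw_bump p"
proof -
  define h where "h q = g q * raw_bump (n * (fst p - fst q)) * raw_bump (n * (snd p - snd q))" for q
  have h: "continuous_on UNIV h" unfolding h_def
    by (intro continuous_intros continuous_on_compose2[OF g] continuous_on_compose2[OF smooth_bumps_continuous[OF raw_bump_smooth, of UNIV]]) auto
  have "conv X g n raw_bump raw_bump p = integral\<^sup>L lborel h"
    using continuous_compact_support(2)[OF h, of "(-X, -X)" "(X, X)"] supp by (simp add: conv_def h_def[abs_def])
  also have "\<dots> = \<bar>- inverse n\<bar> ^ DIM(real \<times> real) * (LBINT z. h (p + (- inverse n) *\<^sub>R z))"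
    using n h by (intro lborel_integral_affine borel_measurable_continuous_onI) auto
  also have "(LBINT z. h (p + (- inverse n) *\<^sub>R z)) = (LBINT z. bump_mass\<^sup>2 * (g (p - z /\<^sub>R n) * kern2 z))"
  proof (intro Bochner_Integration.integral_cong refl)
    fix z :: "real \<times> real"
    show "h (p + (- inverse n) *\<^sub>R z) = bump_mass\<^sup>2 * (g (p - z /\<^sub>R n) * kern2 z)"
      using bump_mass_pos n by (simp add: h_def kern_def power2_eq_square mult.assoc[symmetric])
  qed
  also have "\<dots> = bump_mass\<^sup>2 * average g n p" by (simp add: average_def)
  finally show ?thesis using n bump_mass_pos by (simp add: field_simps power2_eq_square)
qed

lemma average_has_derivative:
  assumes g: "continuous_on UNIV g" and gx: "continuous_on UNIV gx" and gt: "continuous_on UNIV gt"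
    and dx: "\<And>x t. ((\<lambda>x. g (x, t)) has_real_derivative gx (x, t)) (at x)"
    and dt: "\<And>x t. ((\<lambda>t. g (x, t)) has_real_derivative gt (x, t)) (at t)"
  shows "((\<lambda>x. average g n (x, t)) has_real_derivative average gx n (x, t)) (at x)"
    and "((\<lambda>t. average g n (x, t)) has_real_derivative average gt n (x, t)) (at t)"
proof -
  have 1: "(\<lambda>z. g (p - z /\<^sub>R n) * kern2 z) integrable_on cbox (-1, -1) (1, 1)" for p
  proof -
    have "continuous_on UNIV (\<lambda>z. g (p - z /\<^sub>R n) * kern2 z)"
      by (intro continuous_intros continuous_on_compose2[OF kern_continuous[of UNIV]] continuous_on_compose2[OF g]) auto
    then show ?thesis by (intro integrable_continuous) (auto intro: continuous_on_subset)
  qed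
  show "((\<lambda>x. average g n (x, t)) has_real_derivative average gx n (x, t)) (at x)"
    unfolding average_eq[OF g] average_eq[OF gx]
  proof (rule leibniz_rule_field_derivative[where U=UNIV])
    fix x and z :: "real \<times> real"
    show "((\<lambda>x. g ((x, t) - z /\<^sub>R n) * kern2 z) has_field_derivative gx ((x, t) - z /\<^sub>R n) * kern2 z) (at x)"
      using DERIV_cmult_right[OF DERIV_shift[THEN iffD1, OF dx[of "t - snd z /\<^sub>R n" "x + - (fst z /\<^sub>R n)"]]]
      by (cases z) simp
    show "continuous_on (UNIV \<times> cbox (-1, -1) (1, 1)) (\<lambda>(x, z). gx ((x, t) - z /\<^sub>R n) * kern2 z)"
      unfolding case_prod_unfold
      by (intro continuous_intros continuous_on_compose2[OF kern_continuous[of UNIV]] continuous_on_compose2[OF gx]) auto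
  qed (use 1 in auto)
  show "((\<lambda>t. average g n (x, t)) has_real_derivative average gt n (x, t)) (at t)"
    unfolding average_eq[OF g] average_eq[OF gt]
  proof (rule leibniz_rule_field_derivative[where U=UNIV])
    fix t and z :: "real \<times> real"
    show "((\<lambda>t. g ((x, t) - z /\<^sub>R n) * kern2 z) has_field_derivative gt ((x, t) - z /\<^sub>R n) * kern2 z) (at t)"
      using DERIV_cmult_right[OF DERIV_shift[THEN iffD1, OF dt[of "x - fst z /\<^sub>R n" "t + - (snd z /\<^sub>R n)"]]]
      by (cases z) simp
    show "continuous_on (UNIV \<times> cbox (-1, -1) (1, 1)) (\<lambda>(t, z). gt ((x, t) - z /\<^sub>R n) * kern2 z)"
      unfolding case_prod_unfold
      by (intro continuous_intros continuous_on_compose2[OF kern_continuous[of UNIV]] continuous_on_compose2[OF gt]) auto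
  qed (use 1 in auto)
qed

text \<open>The partial derivatives are carried as explicit functions. The lower edge
  \<open>\<alpha>\<close> keeps the support away from the initial line; one \<open>X\<close> serves
  for the three other edges.\<close>

definition C1_test :: "(real \<times> real \<Rightarrow> real) \<Rightarrow> (real \<times> real \<Rightarrow> real) \<Rightarrow> (real \<times> real \<Rightarrow> real) \<Rightarrow> bool" where
  "C1_test \<psi> \<psi>x \<psi>t \<longleftrightarrow> continuous_on UNIV \<psi> \<and> continuous_on UNIV \<psi>x \<and> continuous_on UNIV \<psi>t \<and>
     (\<forall>x t. ((\<lambda>x. \<psi> (x, t)) has_real_derivative \<psi>x (x, t)) (at x)) \<and>
     (\<forall>x t. ((\<lambda>t. \<psi> (x, t)) has_real_derivative \<psi>t (x, t)) (at t)) \<and>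
     (\<exists>\<alpha>>0. \<exists>X. \<forall>p. p \<notin> cbox (-X, \<alpha>) (X, X) \<longrightarrow> \<psi> p = 0)"

lemma vanishing_partials:
  assumes dx: "\<And>x t. ((\<lambda>x. \<psi> (x, t)) has_real_derivative \<psi>x (x, t)) (at x)"
    and dt: "\<And>x t. ((\<lambda>t. \<psi> (x, t)) has_real_derivative \<psi>t (x, t)) (at t)"
    and supp: "\<And>p. p \<notin> S \<Longrightarrow> \<psi> p = 0" and "closed S" and "p \<notin> S"
  shows "\<psi>x p = (0::real)" "\<psi>t p = (0::real)"
proof -
  obtain x t where p: "p = (x, t)" by force
  have "continuous_on UNIV (\<lambda>x. (x, t))" "continuous_on UNIV (\<lambda>t. (x, t))"
    by (intro continuous_intros)+
  then have o1: "open {x. (x, t) \<notin> S}" and o2: "open {t. (x, t) \<notin> S}"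
    using open_vimage[of "- S" "\<lambda>x. (x, t)"] open_vimage[of "- S" "\<lambda>t. (x, t)"] \<open>closed S\<close>
    by (auto simp: vimage_def)
  have "((\<lambda>x. 0) has_real_derivative \<psi>x (x, t)) (at x)"
    by (rule has_field_derivative_transform_within_open[OF dx o1]) (use \<open>p \<notin> S\<close> supp p in auto)
  then show "\<psi>x p = 0" unfolding p by (metis DERIV_const DERIV_unique)
  have "((\<lambda>t. 0) has_real_derivative \<psi>t (x, t)) (at t)"
    by (rule has_field_derivative_transform_within_open[OF dt o2]) (use \<open>p \<notin> S\<close> supp p in auto)
  then show "\<psi>t p = 0" unfolding p by (metis DERIV_const DERIV_unique)
qed

lemma bounded_of_compact_support:
  fixes g :: "real \<times> real \<Rightarrow> real"
  assumes "continuous_on UNIV g" "\<And>p. p \<notin> cbox a b \<Longrightarrow> g p = 0"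
  obtains C where "C > 0" "\<And>p. \<bar>g p\<bar> \<le> C"
proof -
  have "bounded (g ` cbox a b)"
    using assms(1) by (intro compact_imp_bounded compact_continuous_image compact_cbox) (auto intro: continuous_on_subset)
  then obtain C where "C > 0" "\<forall>p\<in>cbox a b. \<bar>g p\<bar> \<le> C" by (auto simp: bounded_pos)
  then have "\<bar>g p\<bar> \<le> C" for p using assms(2)[of p] by (cases "p \<in> cbox a b") auto
  with \<open>C > 0\<close> show thesis by (rule that)
qed

text \<open>The test function is mollified and the smooth inequality passes to the limit by
  dominated convergence: averages of the partial derivatives converge pointwise, with a common bound
  and a common support. \<open>A\<close> and \<open>B\<close> stand for the Kruzkov entropy and its
  flux.\<close>

lemma entropy_inequality_C1:
  assumes A: "A \<in> borel_measurable borel" "\<And>p. \<bar>A p\<bar> \<le> M" and B: "B \<in> borel_measurable borel" "\<And>p. \<bar>B p\<bar> \<le> M"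
    and smooth: "\<And>\<phi>. \<phi> \<in> test_functions \<Longrightarrow> (\<And>p. 0 \<le> \<phi> p) \<Longrightarrow>
       0 \<le> (LBINT p:half_plane. A p * partial_t \<phi> p + B p * partial_x \<phi> p)"
    and \<psi>: "C1_test \<psi> \<psi>x \<psi>t" and nonneg: "\<And>p. 0 \<le> \<psi> p"
  shows "0 \<le> (LBINT p. A p * \<psi>t p + B p * \<psi>x p)"
proof -
  note [measurable] = A(1) B(1)
  from \<psi> obtain \<alpha> X where \<alpha>: "\<alpha> > 0" and supp: "\<And>p. p \<notin> cbox (-X, \<alpha>) (X, X) \<Longrightarrow> \<psi> p = 0"
    and cont: "continuous_on UNIV \<psi>" "continuous_on UNIV \<psi>x" "continuous_on UNIV \<psi>t"
    and dx: "\<And>x t. ((\<lambda>x. \<psi> (x, t)) has_real_derivative \<psi>x (x, t)) (at x)"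
    and dt: "\<And>x t. ((\<lambda>t. \<psi> (x, t)) has_real_derivative \<psi>t (x, t)) (at t)"
    by (auto simp: C1_test_def) metis
  have suppd: "\<psi>x p = 0" "\<psi>t p = 0" if "p \<notin> cbox (-X, \<alpha>) (X, X)" for p
    using vanishing_partials[OF dx dt supp closed_cbox that] by auto
  have suppX: "\<psi> p = 0" if "p \<notin> cbox (-X, -X) (X, X)" for p
    using that \<alpha> by (intro supp) (cases p, auto)
  obtain C1 where C1: "C1 > 0" "\<And>p. \<bar>\<psi>x p\<bar> \<le> C1" using bounded_of_compact_support[OF cont(2) suppd(1)] by blast
  obtain C2 where C2: "C2 > 0" "\<And>p. \<bar>\<psi>t p\<bar> \<le> C2" using bounded_of_compact_support[OF cont(3) suppd(2)] by blast
  \<comment> \<open>The scales satisfy \<open>1 / m i \<le> min 1 (\<alpha> / 2)\<close>, so all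
    mollified supports lie in the one box \<open>S\<close>, still inside the open half
    plane.\<close>
  define N where "N = nat \<lceil>max 1 (2 / \<alpha>)\<rceil>"
  define m where "m i = real (Suc (i + N))" for i
  have m: "m i > 0" "1 / m i \<le> 1" "1 / m i \<le> \<alpha> / 2" for i
  proof -
    have "real N \<ge> max 1 (2 / \<alpha>)" unfolding N_def by linarith
    then have "m i \<ge> 1" "m i \<ge> 2 / \<alpha>" by (auto simp: m_def)
    then show "m i > 0" "1 / m i \<le> 1" "1 / m i \<le> \<alpha> / 2" using \<alpha> by (auto simp: field_simps)
  qed
  define S where "S = cbox (-X - 1, \<alpha> / 2) (X + 1, X + 1)"
  have avg_supp: "average g (m i) p = 0" if "\<And>p. p \<notin> cbox (-X, \<alpha>) (X, X) \<Longrightarrow> g p = 0" "p \<notin> S" for g i p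
  proof (rule average_support[OF m(1) that(1)])
    show "p \<notin> cbox (- X - 1 / m i, \<alpha> - 1 / m i) (X + 1 / m i, X + 1 / m i)"
      using m(2,3)[of i] that(2) by (cases p) (auto simp: S_def)
  qed
  define \<phi> where "\<phi> i = average \<psi> (m i)" for i
  have px: "partial_x (\<phi> i) = average \<psi>x (m i)" for i
    using average_has_derivative(1)[OF cont dx dt, THEN DERIV_imp_deriv]
    by (auto simp: partial_x_def \<phi>_def fun_eq_iff)
  have pt: "partial_t (\<phi> i) = average \<psi>t (m i)" for i
    using average_has_derivative(2)[OF cont dx dt, THEN DERIV_imp_deriv]
    by (auto simp: partial_t_def \<phi>_def fun_eq_iff)
  have test: "\<phi> i \<in> test_functions" for i
  proof -
    have "\<phi> i = (\<lambda>p. ((m i)\<^sup>2 / bump_mass\<^sup>2) * conv X \<psi> (m i) raw_bump raw_bump p)"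
      unfolding \<phi>_def using average_eq_conv[OF cont(1) m(1) suppX] by auto
    then have "Ck k (\<phi> i)" for k
      by (simp only: conv_smooth[OF cont(1) raw_bump_smooth raw_bump_smooth])
    moreover have cl: "closure {p. \<phi> i p \<noteq> 0} \<subseteq> S"
    proof (rule closure_minimal)
      show "{p. \<phi> i p \<noteq> 0} \<subseteq> S" unfolding \<phi>_def using avg_supp[of \<psi>] supp by blast
    qed (unfold S_def, rule closed_cbox)
    moreover have "compact (closure {p. \<phi> i p \<noteq> 0})"
      using cl compact_cbox compact_eq_bounded_closed bounded_subset closed_closure unfolding S_def by meson
    moreover have "S \<subseteq> half_plane" using \<alpha> by (auto simp: S_def half_plane_def)
    ultimately show ?thesis by (auto simp: test_functions_def)
  qed
  have ineq: "0 \<le> (LBINT p. indicator half_plane p *\<^sub>R (A p * average \<psi>t (m i) p + B p * average \<psi>x (m i) p))" for i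
    using smooth[OF test, of i] average_nonneg[OF nonneg] unfolding set_lebesgue_integral_def px pt by (auto simp: \<phi>_def)
  have half[measurable]: "half_plane \<in> sets borel"
    by (auto simp: half_plane_def intro!: borel_open open_Times)
  have lim: "(\<lambda>i. average g (m i) p) \<longlonglongrightarrow> g p" if "continuous_on UNIV g" "\<And>p. \<bar>g p\<bar> \<le> C" for g C p
    unfolding m_def using LIMSEQ_ignore_initial_segment[OF average_tendsto[OF that], of N] by simp
  have "M \<ge> 0" using A(2)[of "(0,0)"] by auto
  have "(\<lambda>i. LBINT p. indicator half_plane p *\<^sub>R (A p * average \<psi>t (m i) p + B p * average \<psi>x (m i) p))
      \<longlonglongrightarrow> (LBINT p. indicator half_plane p *\<^sub>R (A p * \<psi>t p + B p * \<psi>x p))"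
  proof (rule integral_dominated_convergence)
    have cm: "continuous_on UNIV (average g (m i))" if "continuous_on UNIV g" "\<And>p. p \<notin> cbox (-X, \<alpha>) (X, X) \<Longrightarrow> g p = 0" for g i
    proof -
      have "g p = 0" if "p \<notin> cbox (-X, -X) (X, X)" for p
        using that \<alpha> by (intro \<open>\<And>p. p \<notin> cbox (-X, \<alpha>) (X, X) \<Longrightarrow> g p = 0\<close>) (cases p, auto)
      then have "average g (m i) = (\<lambda>p. ((m i)\<^sup>2 / bump_mass\<^sup>2) * conv X g (m i) raw_bump raw_bump p)"
        using average_eq_conv[OF that(1) m(1)] by auto
      then show ?thesis by (simp only:) (intro continuous_on_mult continuous_on_const conv_continuous[OF that(1)] raw_bump_smooth)
    qed
    have [measurable]: "average \<psi>t (m i) \<in> borel_measurable borel" "average \<psi>x (m i) \<in> borel_measurable borel" for i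
      using cm[OF cont(3) suppd(2)] cm[OF cont(2) suppd(1)] by (auto intro: borel_measurable_continuous_onI)
    have [measurable]: "\<psi>t \<in> borel_measurable borel" "\<psi>x \<in> borel_measurable borel"
      using cont by (auto intro: borel_measurable_continuous_onI)
    show "(\<lambda>p. indicator half_plane p *\<^sub>R (A p * average \<psi>t (m i) p + B p * average \<psi>x (m i) p)) \<in> borel_measurable lborel" for i
      by measurable
    show "(\<lambda>p. indicator half_plane p *\<^sub>R (A p * \<psi>t p + B p * \<psi>x p)) \<in> borel_measurable lborel"
      by measurable
    show "integrable lborel (\<lambda>p. indicator S p *\<^sub>R (M * C2 + M * C1))"
      unfolding S_def by (intro borel_integrable_compact compact_cbox continuous_intros)
    show "AE p in lborel. (\<lambda>i. indicator half_plane p *\<^sub>R (A p * average \<psi>t (m i) p + B p * average \<psi>x (m i) p)) \<longlonglongrightarrow>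
        indicator half_plane p *\<^sub>R (A p * \<psi>t p + B p * \<psi>x p)"
      by (intro AE_I2 tendsto_intros lim[OF cont(3) C2(2)] lim[OF cont(2) C1(2)])
    show "AE p in lborel. norm (indicator half_plane p *\<^sub>R (A p * average \<psi>t (m i) p + B p * average \<psi>x (m i) p))
        \<le> indicator S p *\<^sub>R (M * C2 + M * C1)" for i
    proof (rule AE_I2)
      fix p
      show "norm (indicator half_plane p *\<^sub>R (A p * average \<psi>t (m i) p + B p * average \<psi>x (m i) p))
        \<le> indicator S p *\<^sub>R (M * C2 + M * C1)"
      proof (cases "p \<in> S")
        case True
        have "\<bar>A p * average \<psi>t (m i) p\<bar> \<le> M * C2" "\<bar>B p * average \<psi>x (m i) p\<bar> \<le> M * C1"
          unfolding abs_mult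
          by (intro mult_mono A B average_bound cont C1 C2 \<open>M \<ge> 0\<close> abs_ge_zero)+
        then show ?thesis using True by (auto simp: indicator_def)
      next
        case False
        then show ?thesis using avg_supp[OF suppd(1)] avg_supp[OF suppd(2)] by auto
      qed
    qed
  qed
  then have "0 \<le> (LBINT p. indicator half_plane p *\<^sub>R (A p * \<psi>t p + B p * \<psi>x p))"
    using ineq by (intro LIMSEQ_le_const) auto
  also have "\<dots> = (LBINT p. A p * \<psi>t p + B p * \<psi>x p)"
  proof (intro Bochner_Integration.integral_cong refl)
    fix p
    show "indicator half_plane p *\<^sub>R (A p * \<psi>t p + B p * \<psi>x p) = A p * \<psi>t p + B p * \<psi>x p"
    proof (cases "p \<in> half_plane")
      case False
      then have "p \<notin> cbox (-X, \<alpha>) (X, X)" using \<alpha> by (cases p) (auto simp: half_plane_def)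
      then show ?thesis using suppd by simp
    qed simp
  qed
  finally show ?thesis .
qed

lemma mol_measurable [measurable]: "a > 0 \<Longrightarrow> mol a \<in> borel_measurable borel"
  by (intro borel_measurable_continuous_onI mol_continuous)

section \<open>Mollification in space\<close>

lemma integrable_const_indicator_Icc: "integrable lborel (\<lambda>p. C * indicator {a..b::real} p :: real)"
  using integrable_const_indicator_cbox[of C a b] by (simp only: cbox_interval)

lemma integrable_bounded_support:
  fixes h :: "real \<Rightarrow> real"
  assumes [measurable]: "h \<in> borel_measurable borel" and "\<And>y. \<bar>h y\<bar> \<le> C" "\<And>y. y \<notin> {a..b} \<Longrightarrow> h y = 0"
  shows "integrable lborel h" "\<bar>integral\<^sup>L lborel h\<bar> \<le> C * max 0 (b - a)"
proof -
  note i = integrable_const_indicator_Icc[of C a b]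
  have b: "\<bar>h y\<bar> \<le> C * indicator {a..b} y" for y using assms(2,3)[of y] by (auto simp: indicator_def)
  show int: "integrable lborel h"
    using integrable_bounded_cbox[of h C a b] assms by auto
  have "\<bar>integral\<^sup>L lborel h\<bar> \<le> (LBINT y. \<bar>h y\<bar>)" by (rule integral_abs_bound)
  also have "\<dots> \<le> (LBINT y. C * indicator {a..b} y)" using int i b by (intro integral_mono) auto
  also have "\<dots> = C * max 0 (b - a)" by (cases "a \<le> b") (auto simp: max_def)
  finally show "\<bar>integral\<^sup>L lborel h\<bar> \<le> C * max 0 (b - a)" .
qed

lemma mol_pairing_integrable:
  assumes "a > 0" and "g \<in> borel_measurable borel" and "\<And>y. \<bar>g y\<bar> \<le> M"
  shows "integrable lborel (\<lambda>y. g y * mol a (y - x))"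
  using mol_has_integral[OF assms(1), of x] assms(2,3)
  by (intro integrable_mult_bounded) (auto simp: has_bochner_integral_iff)

text \<open>The pairing is an average of \<open>g\<close> over \<open>{x - a..x + a}\<close> with
  nonnegative weights of total mass one.\<close>

lemma mol_pairing_close:
  assumes a: "a > 0" and g: "g \<in> borel_measurable borel" "\<And>y. \<bar>g y\<bar> \<le> M"
    and close: "\<And>y. \<bar>y - x\<bar> \<le> a \<Longrightarrow> \<bar>g y - v\<bar> \<le> e"
  shows "\<bar>(LBINT y. g y * mol a (y - x)) - v\<bar> \<le> e"
proof -
  have m: "integrable lborel (\<lambda>y. mol a (y - x))" "(LBINT y. mol a (y - x)) = 1"
    using mol_has_integral[OF a, of x] by (auto simp: has_bochner_integral_iff)
  note i = mol_pairing_integrable[OF a g]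
  have "\<bar>(LBINT y. g y * mol a (y - x)) - v\<bar> = \<bar>(LBINT y. g y * mol a (y - x)) - (LBINT y. v * mol a (y - x))\<bar>"
    using m by simp
  also have "\<dots> = \<bar>LBINT y. (g y - v) * mol a (y - x)\<bar>"
    using i m by (simp add: left_diff_distrib)
  also have "\<dots> \<le> (LBINT y. \<bar>(g y - v) * mol a (y - x)\<bar>)" by (rule integral_abs_bound)
  also have "\<dots> \<le> (LBINT y. e * mol a (y - x))"
  proof (intro integral_mono)
    show "\<bar>(g y - v) * mol a (y - x)\<bar> \<le> e * mol a (y - x)" for y
    proof (cases "\<bar>y - x\<bar> \<le> a")
      case True
      then show ?thesis using close mol_nonneg[OF a] by (auto simp: abs_mult intro!: mult_right_mono)
    qed (use mol_support[OF a, of "y - x"] in auto)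
  qed (use i m in \<open>auto simp: left_diff_distrib\<close>)
  also have "\<dots> = e" using m by simp
  finally show ?thesis .
qed

lemma mol_pairing_bound:
  assumes "a > 0" "g \<in> borel_measurable borel" "\<And>y. \<bar>g y\<bar> \<le> M"
  shows "\<bar>LBINT y. g y * mol a (y - x)\<bar> \<le> M"
  using mol_pairing_close[OF assms, of x 0 M] assms(3) by simp

lemma mol_pairing_tendsto:
  fixes g :: "real \<Rightarrow> real"
  assumes g: "g \<in> borel_measurable borel" "\<And>y. \<bar>g y\<bar> \<le> M" and cont: "isCont g x"
    and a: "\<And>n. a n > 0" "a \<longlonglongrightarrow> 0"
  shows "(\<lambda>n. LBINT y. g y * mol (a n) (y - x)) \<longlonglongrightarrow> g x"
proof (rule LIMSEQ_I)
  fix r :: real assume "r > 0"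
  then obtain d where d: "d > 0" "\<And>y. \<bar>y - x\<bar> < d \<Longrightarrow> \<bar>g y - g x\<bar> < r / 2"
    using cont unfolding continuous_at_eps_delta by (metis dist_real_def half_gt_zero)
  have "\<forall>\<^sub>F n in sequentially. a n < d" using a(2) d(1) by (rule order_tendstoD)
  then obtain N where N: "\<And>n. n \<ge> N \<Longrightarrow> a n < d" by (auto simp: eventually_sequentially)
  have "\<bar>(LBINT y. g y * mol (a n) (y - x)) - g x\<bar> \<le> r / 2" if "n \<ge> N" for n
    using N[OF that] d by (intro mol_pairing_close[OF a(1) g]) (meson less_imp_le order_le_less_trans)
  then show "\<exists>N. \<forall>n\<ge>N. norm ((LBINT y. g y * mol (a n) (y - x)) - g x) < r"
    using \<open>r > 0\<close> by (intro exI[of _ N]) (force intro: order_le_less_trans)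
qed

lemma mol_pairing_measurable:
  assumes "a > 0" and [measurable]: "(\<lambda>p. q (fst p) (snd p)) \<in> borel_measurable borel"
  shows "(\<lambda>p. LBINT y. q y (snd p) * mol a (y - fst p)) \<in> borel_measurable (borel :: (real \<times> real) measure)"
proof -
  have q: "(\<lambda>p. q (fst p) (snd p)) \<in> borel_measurable (borel \<Otimes>\<^sub>M borel)"
    using assms(2) by (simp add: borel_prod)
  have "(\<lambda>z. (snd z, snd (fst z))) \<in> (borel \<Otimes>\<^sub>M borel) \<Otimes>\<^sub>M lborel \<rightarrow>\<^sub>M (borel :: real measure) \<Otimes>\<^sub>M (borel :: real measure)"
    by measurable
  from measurable_compose[OF this q]
  have [measurable]: "(\<lambda>z. q (snd z) (snd (fst z))) \<in> borel_measurable ((borel \<Otimes>\<^sub>M borel) \<Otimes>\<^sub>M lborel)"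
    by simp
  have [measurable]: "mol a \<in> borel_measurable borel" using assms(1) by simp
  have "(\<lambda>z. q (snd z) (snd (fst z)) * mol a (snd z - fst (fst z))) \<in> borel_measurable ((borel \<Otimes>\<^sub>M borel) \<Otimes>\<^sub>M lborel)"
    by measurable
  then have "(\<lambda>p. LBINT y. q y (snd p) * mol a (y - fst p)) \<in> borel_measurable (borel \<Otimes>\<^sub>M borel)"
    by (intro lborel.borel_measurable_lebesgue_integral) (simp add: case_prod_unfold)
  then show ?thesis by (simp add: borel_prod)
qed

text \<open>A measurable function is an almost everywhere limit of continuous ones. Truncation at
  level \<open>M\<close> keeps the bound without changing the limit, and then dominated convergence
  applies on the bounded interval.\<close>

lemma L1_continuous_approx:
  fixes g :: "real \<Rightarrow> real"
  assumes [measurable]: "g \<in> borel_measurable borel" and bd: "\<And>y. \<bar>g y\<bar> \<le> M" and "e > 0"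
  obtains c where "continuous_on UNIV c" "\<And>y. \<bar>c y\<bar> \<le> M" "(LBINT y:{a..b}. \<bar>g y - c y\<bar>) < e"
proof -
  have "g \<in> borel_measurable lebesgue" by (simp add: measurable_completion)
  then have "g measurable_on UNIV" by (simp add: measurable_on_iff_borel_measurable)
  then obtain N h where N: "negligible N" and h: "\<And>n. continuous_on UNIV (h n)"
    and lim: "\<And>x. x \<notin> N \<Longrightarrow> (\<lambda>n. h n x) \<longlonglongrightarrow> g x"
    by (auto simp: measurable_on_def)
  define c where "c n y = max (-M) (min M (h n y))" for n y
  have "M \<ge> 0" using bd[of 0] by simp
  have c: "continuous_on UNIV (c n)" for n unfolding c_def by (intro continuous_intros h)
  have cM: "\<bar>c n y\<bar> \<le> M" for n y using \<open>M \<ge> 0\<close> by (auto simp: c_def)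
  have [measurable]: "c n \<in> borel_measurable borel" for n using c by (rule borel_measurable_continuous_onI)
  have "(\<lambda>n. LBINT y. indicator {a..b} y *\<^sub>R \<bar>g y - c n y\<bar>) \<longlonglongrightarrow> (LBINT y::real. (0::real))"
  proof (rule integral_dominated_convergence)
    show "integrable lborel (\<lambda>y. 2 * M * indicator {a..b} y)" by (rule integrable_const_indicator_Icc)
    have "AE y in lebesgue. y \<notin> N" using N by (simp add: negligible_iff_null_sets AE_not_in)
    then have "AE y in lborel. y \<notin> N" by (simp add: AE_completion_iff)
    then show "AE y in lborel. (\<lambda>n. indicator {a..b} y *\<^sub>R \<bar>g y - c n y\<bar>) \<longlonglongrightarrow> 0"
    proof eventually_elim
      fix y assume "y \<notin> N"
      then have "(\<lambda>n. c n y) \<longlonglongrightarrow> max (-M) (min M (g y))" unfolding c_def by (intro tendsto_intros lim)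
      moreover have "max (-M) (min M (g y)) = g y" using bd[of y] by auto
      ultimately have "(\<lambda>n. indicator {a..b} y *\<^sub>R \<bar>g y - c n y\<bar>) \<longlonglongrightarrow> indicator {a..b} y *\<^sub>R \<bar>g y - g y\<bar>"
        by (intro tendsto_intros) auto
      then show "(\<lambda>n. indicator {a..b} y *\<^sub>R \<bar>g y - c n y\<bar>) \<longlonglongrightarrow> 0" by simp
    qed
    show "AE y in lborel. norm (indicator {a..b} y *\<^sub>R \<bar>g y - c n y\<bar>) \<le> 2 * M * indicator {a..b} y" for n
    proof (rule AE_I2)
      fix y show "norm (indicator {a..b} y *\<^sub>R \<bar>g y - c n y\<bar>) \<le> 2 * M * indicator {a..b} y"
        using bd[of y] cM[of n y] by (auto simp: indicator_def)
    qed
  qed auto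
  then have "\<forall>\<^sub>F n in sequentially. (LBINT y. indicator {a..b} y *\<^sub>R \<bar>g y - c n y\<bar>) < e"
    using \<open>e > 0\<close> by (intro order_tendstoD) auto
  then obtain n where "(LBINT y:{a..b}. \<bar>g y - c n y\<bar>) < e"
    unfolding set_lebesgue_integral_def by (auto simp: eventually_sequentially)
  then show thesis using that c cM by blast
qed

text \<open>Local form of Young's inequality: the two integrals of
  \<open>|d y| * mol a (y - x)\<close> are exchanged. As \<open>a \<le> 1\<close>, only values of
  \<open>d\<close> within distance one of the window enter.\<close>

lemma L1_mol_bound:
  fixes d :: "real \<Rightarrow> real"
  assumes a: "0 < a" "a \<le> 1" and [measurable]: "d \<in> borel_measurable borel" and bd: "\<And>y. \<bar>d y\<bar> \<le> M"
  shows "(LBINT x:{-X..X}. \<bar>LBINT y. d y * mol a (y - x)\<bar>) \<le> (LBINT y:{-X-1..X+1}. \<bar>d y\<bar>)"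
proof -
  have [measurable]: "mol a \<in> borel_measurable borel" using a by simp
  define F where "F x y = indicator {-X..X} x * (\<bar>d y\<bar> * mol a (y - x))" for x y
  obtain C where C: "C > 0" "\<And>a z. a > 0 \<Longrightarrow> mol a z \<le> C / a" using mol_le by blast
  have F0: "F x y \<ge> 0" for x y using mol_nonneg[OF a(1)] by (auto simp: F_def)
  have "M \<ge> 0" using bd[of 0] by auto
  have FM: "F x y \<le> M * (C / a)" for x y
  proof -
    have "\<bar>d y\<bar> * mol a (y - x) \<le> M * (C / a)"
      by (rule mult_mono) (use C(2)[OF a(1)] bd \<open>M \<ge> 0\<close> mol_nonneg[OF a(1)] in auto)
    then show ?thesis using \<open>M \<ge> 0\<close> C a by (auto simp: F_def indicator_def)
  qed
  have Fy: "F x y = 0" if "y \<notin> {-X-1..X+1}" for x y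
    using that a mol_support[OF a(1), of "y - x"] by (auto simp: F_def indicator_def)
  have Fx: "F x y = 0" if "x \<notin> {-X..X}" for x y using that by (auto simp: F_def)
  have Fmeas: "(\<lambda>p. F (fst p) (snd p)) \<in> borel_measurable (lborel \<Otimes>\<^sub>M lborel)"
    unfolding F_def by measurable
  have "integrable lborel (\<lambda>p. F (fst p) (snd p))"
  proof (rule integrable_bounded_cbox)
    show "\<bar>F (fst p) (snd p)\<bar> \<le> M * (C / a)" for p using F0[of "fst p" "snd p"] FM[of "fst p" "snd p"] by linarith
    show "F (fst p) (snd p) = 0" if "p \<notin> cbox (-X, -X-1) (X, X+1)" for p
      using that Fx[of "fst p" "snd p"] Fy[of "snd p" "fst p"] by (cases p) auto
  qed (use Fmeas in \<open>simp add: lborel_prod\<close>)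
  then have Fpair: "integrable (lborel \<Otimes>\<^sub>M lborel) (\<lambda>p. F (fst p) (snd p))" by (simp only: lborel_prod)
  have Fub: "(LBINT x. LBINT y. F x y) = (LBINT y. LBINT x. F x y)"
    using lborel_pair.Fubini_integral[of F] Fpair by (simp add: case_prod_unfold)
  have ix: "integrable lborel (\<lambda>x. LBINT y. F x y)"
    using lborel_pair.integrable_fst'[OF Fpair] by simp
  have iy: "integrable lborel (\<lambda>y. LBINT x. F x y)"
    using lborel_pair.integrable_snd[of F] Fpair by (simp add: case_prod_unfold)
  have "(LBINT x:{-X..X}. \<bar>LBINT y. d y * mol a (y - x)\<bar>) \<le> (LBINT x. LBINT y. F x y)"
    unfolding set_lebesgue_integral_def
  proof (rule integral_mono'[OF ix])
    show "indicator {-X..X} x *\<^sub>R \<bar>LBINT y. d y * mol a (y - x)\<bar> \<le> (LBINT y. F x y)" for x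
    proof (cases "x \<in> {-X..X}")
      case True
      have "\<bar>LBINT y. d y * mol a (y - x)\<bar> \<le> (LBINT y. \<bar>d y * mol a (y - x)\<bar>)" by (rule integral_abs_bound)
      also have "\<dots> = (LBINT y. F x y)"
        using True mol_nonneg[OF a(1)] by (simp add: F_def abs_mult)
      finally show ?thesis using True by simp
    qed (simp add: F_def)
  qed (intro integral_nonneg_AE AE_I2 F0)
  also note Fub
  also have "(LBINT y. LBINT x. F x y) \<le> (LBINT y:{-X-1..X+1}. \<bar>d y\<bar>)"
    unfolding set_lebesgue_integral_def
  proof (rule integral_mono[OF iy])
    show "integrable lborel (\<lambda>y. indicator {-X-1..X+1} y *\<^sub>R \<bar>d y\<bar>)"
      by (rule integrable_bounded_support[of _ M "-X-1" "X+1"]) (use bd \<open>M \<ge> 0\<close> in \<open>auto simp: indicator_def\<close>)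
    fix y
    \<comment> \<open>After the exchange the kernel is integrated in its other variable, so its unit
      mass has to be carried over by a reflection.\<close>
    have rot: "has_bochner_integral lborel (\<lambda>x. mol a (y - x)) 1"
    proof -
      have "has_bochner_integral lborel (\<lambda>x. mol a (x - 0)) 1" by (rule mol_has_integral[OF a(1)])
      then have "has_bochner_integral lborel (mol a) 1" by simp
      then have "has_bochner_integral lborel (\<lambda>x. mol a (y + (-1) * x)) (1 /\<^sub>R \<bar>-1\<bar>)"
        by (subst (asm) lborel_has_bochner_integral_real_affine_iff[where c="-1" and t=y]) auto
      then show ?thesis by simp
    qed
    show "(LBINT x. F x y) \<le> indicator {-X-1..X+1} y *\<^sub>R \<bar>d y\<bar>"
    proof (cases "y \<in> {-X-1..X+1}")
      case True
      have "(LBINT x. F x y) \<le> (LBINT x. \<bar>d y\<bar> * mol a (y - x))"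
        using rot mol_nonneg[OF a(1)]
        by (intro integral_mono') (auto simp: F_def indicator_def has_bochner_integral_iff intro!: mult_nonneg_nonneg)
      also have "\<dots> = \<bar>d y\<bar>" using rot by (simp add: has_bochner_integral_iff)
      finally show ?thesis using True by simp
    qed (use Fy in auto)
  qed
  finally show ?thesis .
qed

text \<open>Density argument: for a continuous \<open>c\<close> close to \<open>g\<close> the
  convergence is pointwise and dominated, while the remainder \<open>g - c\<close> is controlled
  uniformly in \<open>n\<close> by \<open>L1_mol_bound\<close>.\<close>

lemma L1_mol_tendsto:
  fixes g :: "real \<Rightarrow> real"
  assumes [measurable]: "g \<in> borel_measurable borel" and bd: "\<And>y. \<bar>g y\<bar> \<le> M"
    and a: "\<And>n. 0 < a n" "\<And>n. a n \<le> 1" "a \<longlonglongrightarrow> 0"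
  shows "(\<lambda>n. LBINT x:{-X..X}. \<bar>(LBINT y. g y * mol (a n) (y - x)) - g x\<bar>) \<longlonglongrightarrow> 0"
proof (rule LIMSEQ_I)
  fix r :: real assume "r > 0"
  then obtain c where c: "continuous_on UNIV c" "\<And>y. \<bar>c y\<bar> \<le> M" and small: "(LBINT y:{-X-1..X+1}. \<bar>g y - c y\<bar>) < r / 4"
    using L1_continuous_approx[OF assms(1) bd, of "r/4" "-X-1" "X+1"] by auto
  have [measurable]: "c \<in> borel_measurable borel" using c(1) by (rule borel_measurable_continuous_onI)
  have "M \<ge> 0" using bd[of 0] by auto
  define d where "d y = g y - c y" for y
  have [measurable]: "d \<in> borel_measurable borel" unfolding d_def by measurable
  have dM: "\<bar>d y\<bar> \<le> 2 * M" for y using bd[of y] c(2)[of y] by (auto simp: d_def)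
  define cv where "cv h n x = (LBINT y. h y * mol (a n) (y - x))" for h n x
  have cvm [measurable]: "cv h n \<in> borel_measurable borel" if [measurable]: "h \<in> borel_measurable borel" for h n
  proof -
    have [measurable]: "mol (a n) \<in> borel_measurable borel" using a(1) by simp
    show ?thesis unfolding cv_def by measurable
  qed
  have cvb: "\<bar>cv h n x\<bar> \<le> B" if "h \<in> borel_measurable borel" "\<And>y. \<bar>h y\<bar> \<le> B" for h n x B
    unfolding cv_def using mol_pairing_bound[OF a(1) that] .
  have ibs: "integrable lborel (\<lambda>x. indicator {l..u} x *\<^sub>R \<bar>h x\<bar>)" if [measurable]: "h \<in> borel_measurable borel" and "\<And>x. \<bar>h x\<bar> \<le> B" for h and B l u :: real
  proof (rule integrable_bounded_support[of _ B l u])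
    show "\<bar>indicator {l..u} y *\<^sub>R \<bar>h y\<bar>\<bar> \<le> B" for y using that(2)[of y] by (auto simp: indicator_def)
  qed auto
  have "(\<lambda>n. LBINT x. indicator {-X..X} x *\<^sub>R \<bar>cv c n x - c x\<bar>) \<longlonglongrightarrow> (LBINT x::real. (0::real))"
  proof (rule integral_dominated_convergence)
    show "integrable lborel (\<lambda>y. 2 * M * indicator {-X..X} y)" by (rule integrable_const_indicator_Icc)
    show "AE x in lborel. (\<lambda>n. indicator {-X..X} x *\<^sub>R \<bar>cv c n x - c x\<bar>) \<longlonglongrightarrow> 0"
    proof (rule AE_I2)
      fix x
      have "(\<lambda>n. cv c n x) \<longlonglongrightarrow> c x" unfolding cv_def
        using c a by (intro mol_pairing_tendsto) (auto simp: continuous_on_eq_continuous_at)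
      then have "(\<lambda>n. indicator {-X..X} x *\<^sub>R \<bar>cv c n x - c x\<bar>) \<longlonglongrightarrow> indicator {-X..X} x *\<^sub>R \<bar>c x - c x\<bar>"
        by (intro tendsto_intros)
      then show "(\<lambda>n. indicator {-X..X} x *\<^sub>R \<bar>cv c n x - c x\<bar>) \<longlonglongrightarrow> 0" by simp
    qed
    show "AE x in lborel. norm (indicator {-X..X} x *\<^sub>R \<bar>cv c n x - c x\<bar>) \<le> 2 * M * indicator {-X..X} x" for n
    proof (rule AE_I2)
      fix x
      have "\<bar>cv c n x\<bar> \<le> M" using c(2) by (intro cvb) auto
      then show "norm (indicator {-X..X} x *\<^sub>R \<bar>cv c n x - c x\<bar>) \<le> 2 * M * indicator {-X..X} x"
        using c(2)[of x] by (auto simp: indicator_def)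
    qed
  qed auto
  then have "\<forall>\<^sub>F n in sequentially. (LBINT x. indicator {-X..X} x *\<^sub>R \<bar>cv c n x - c x\<bar>) < r / 4"
    using \<open>r > 0\<close> by (intro order_tendstoD) auto
  then obtain N where N: "\<And>n. n \<ge> N \<Longrightarrow> (LBINT x. indicator {-X..X} x *\<^sub>R \<bar>cv c n x - c x\<bar>) < r / 4"
    by (auto simp: eventually_sequentially)
  have "(LBINT x. indicator {-X..X} x *\<^sub>R \<bar>cv g n x - g x\<bar>) < r" if "n \<ge> N" for n
  proof -
    have split: "cv g n x = cv d n x + cv c n x" for x
      unfolding cv_def d_def
      using mol_pairing_integrable[OF a(1) assms(1) bd] mol_pairing_integrable[OF a(1) \<open>c \<in> borel_measurable borel\<close> c(2)]
      by (simp add: left_diff_distrib)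
    have bounds: "\<bar>cv g n x\<bar> \<le> M" "\<bar>cv c n x\<bar> \<le> M" "\<bar>cv d n x\<bar> \<le> 2 * M" for x
    proof -
      show "\<bar>cv g n x\<bar> \<le> M" using assms(1) bd by (rule cvb)
      show "\<bar>cv c n x\<bar> \<le> M" using \<open>c \<in> borel_measurable borel\<close> c(2) by (rule cvb)
      show "\<bar>cv d n x\<bar> \<le> 2 * M" using \<open>d \<in> borel_measurable borel\<close> dM by (rule cvb)
    qed
    have ig: "integrable lborel (\<lambda>x. indicator {-X..X} x *\<^sub>R \<bar>cv g n x - g x\<bar>)"
    proof (rule ibs[where B="2 * M"])
      show "\<bar>cv g n x - g x\<bar> \<le> 2 * M" for x using bounds(1)[of x] bd[of x] by linarith
    qed measurable
    have ic: "integrable lborel (\<lambda>x. indicator {-X..X} x *\<^sub>R \<bar>cv c n x - c x\<bar>)"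
    proof (rule ibs[where B="2 * M"])
      show "\<bar>cv c n x - c x\<bar> \<le> 2 * M" for x using bounds(2)[of x] c(2)[of x] by linarith
    qed measurable
    have id: "integrable lborel (\<lambda>x. indicator {-X..X} x *\<^sub>R \<bar>cv d n x\<bar>)"
    proof (rule ibs[where B="2 * M"])
      show "\<bar>cv d n x\<bar> \<le> 2 * M" for x by (rule bounds)
    qed measurable
    have id': "integrable lborel (\<lambda>x. indicator {-X-1..X+1} x *\<^sub>R \<bar>d x\<bar>)"
    proof (rule ibs[where B="2 * M"])
      show "\<bar>d x\<bar> \<le> 2 * M" for x by (rule dM)
    qed measurable
    have "(LBINT x. indicator {-X..X} x *\<^sub>R \<bar>cv g n x - g x\<bar>) \<le>
      (LBINT x. indicator {-X..X} x *\<^sub>R \<bar>cv d n x\<bar> + indicator {-X..X} x *\<^sub>R \<bar>cv c n x - c x\<bar> + indicator {-X-1..X+1} x *\<^sub>R \<bar>d x\<bar>)"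
    proof (intro integral_mono ig Bochner_Integration.integrable_add id ic id')
      fix x
      show "indicator {-X..X} x *\<^sub>R \<bar>cv g n x - g x\<bar> \<le> indicator {-X..X} x *\<^sub>R \<bar>cv d n x\<bar> + indicator {-X..X} x *\<^sub>R \<bar>cv c n x - c x\<bar> + indicator {-X-1..X+1} x *\<^sub>R \<bar>d x\<bar>"
        unfolding split d_def by (auto simp: indicator_def)
    qed
    also have "\<dots> = (LBINT x. indicator {-X..X} x *\<^sub>R \<bar>cv d n x\<bar>) + (LBINT x. indicator {-X..X} x *\<^sub>R \<bar>cv c n x - c x\<bar>)
        + (LBINT x. indicator {-X-1..X+1} x *\<^sub>R \<bar>d x\<bar>)"
      by (simp only: Bochner_Integration.integral_add id ic id' Bochner_Integration.integrable_add)
    also have "\<dots> < r / 4 + r / 4 + r / 4"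
    proof (intro add_strict_mono N that)
      show "(LBINT x. indicator {-X-1..X+1} x *\<^sub>R \<bar>d x\<bar>) < r / 4"
        using small by (simp add: d_def set_lebesgue_integral_def)
      moreover have "(LBINT x:{-X..X}. \<bar>LBINT y. d y * mol (a n) (y - x)\<bar>) \<le> (LBINT y:{-X-1..X+1}. \<bar>d y\<bar>)"
        by (rule L1_mol_bound[OF a(1) a(2) \<open>d \<in> borel_measurable borel\<close> dM])
      ultimately show "(LBINT x. indicator {-X..X} x *\<^sub>R \<bar>cv d n x\<bar>) < r / 4"
        by (simp add: cv_def set_lebesgue_integral_def)
    qed
    finally show ?thesis using \<open>r > 0\<close> by simp
  qed
  moreover have "(LBINT x. indicator {-X..X} x *\<^sub>R \<bar>cv g n x - g x\<bar>) \<ge> 0" for n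
    by (intro integral_nonneg_AE) auto
  ultimately show "\<exists>N. \<forall>n\<ge>N. norm ((LBINT x:{-X..X}. \<bar>(LBINT y. g y * mol (a n) (y - x)) - g x\<bar>) - 0) < r"
    unfolding set_lebesgue_integral_def cv_def[symmetric] by auto
qed

text \<open>Common frame for \<open>u\<close>, \<open>f(u)\<close>, \<open>|u - k|\<close> and
  constants. Time \<open>0\<close> is included, with one-sided continuity, so that the initial data
  are an ordinary slice; the bound holds at every point, which spares almost everywhere
  arguments.\<close>

locale L1_continuous =
  fixes q :: "real \<Rightarrow> real \<Rightarrow> real" and M :: real
  assumes meas: "(\<lambda>p. q (fst p) (snd p)) \<in> borel_measurable borel"
    and bound: "\<bar>q x t\<bar> \<le> M"
    and cont: "t \<ge> 0 \<Longrightarrow> ((\<lambda>s. LBINT x:{-R..R}. \<bar>q x s - q x t\<bar>) \<longlongrightarrow> 0) (at t within {0..})"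
begin

lemma slice_measurable [measurable]: "(\<lambda>x. q x t) \<in> borel_measurable borel"
proof -
  have "(\<lambda>x. (x, t)) \<in> borel \<rightarrow>\<^sub>M (borel :: (real \<times> real) measure)"
    by (intro borel_measurable_continuous_onI continuous_intros)
  from measurable_compose[OF this meas] show ?thesis by simp
qed

lemma bound_nonneg: "M \<ge> 0" using bound[of 0 0] by auto

lemma bound_diff: "\<bar>q x s - q y t\<bar> \<le> 2 * M"
  using bound[of x s] bound[of y t] by linarith

lemma pairing_integrable:
  assumes [measurable]: "\<eta> \<in> borel_measurable borel" and "\<And>y. \<bar>\<eta> y\<bar> \<le> C" "\<And>y. y \<notin> {a..b} \<Longrightarrow> \<eta> y = 0"
  shows "integrable lborel (\<lambda>y. q y t * \<eta> y)" "\<bar>LBINT y. q y t * \<eta> y\<bar> \<le> M * C * max 0 (b - a)"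
proof -
  have "\<bar>q y t * \<eta> y\<bar> \<le> M * C" for y
    unfolding abs_mult by (intro mult_mono bound assms bound_nonneg abs_ge_zero)
  then show "integrable lborel (\<lambda>y. q y t * \<eta> y)" "\<bar>LBINT y. q y t * \<eta> y\<bar> \<le> M * C * max 0 (b - a)"
    using assms(3) by (intro integrable_bounded_support[where C="M * C"]; auto)+
qed

lemma cont_seq:
  assumes "t \<ge> 0" "\<And>n. s n \<ge> (0::real)" "s \<longlonglongrightarrow> t"
  shows "(\<lambda>n. LBINT x:{-R..R}. \<bar>q x (s n) - q x t\<bar>) \<longlonglongrightarrow> 0"
proof -
  let ?J = "\<lambda>s. LBINT x:{-R..R}. \<bar>q x s - q x t\<bar>"
  have "continuous (at t within {0..}) ?J"
    using cont[OF assms(1), of R] by (simp add: continuous_within)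
  then have "(\<lambda>n. ?J (s n)) \<longlonglongrightarrow> ?J t"
    using assms by (auto simp: continuous_within_sequentially o_def)
  then show ?thesis by simp
qed

lemma pairing_continuous:
  fixes \<eta> :: "real \<Rightarrow> real \<Rightarrow> real"
  assumes \<eta>: "continuous_on UNIV (\<lambda>(x, y). \<eta> x y)"
    and supp: "\<And>X. \<exists>R C. \<forall>x y. \<bar>x\<bar> \<le> X \<longrightarrow> \<bar>\<eta> x y\<bar> \<le> C \<and> (\<bar>y\<bar> > R \<longrightarrow> \<eta> x y = 0)"
  shows "continuous_on (UNIV \<times> {0..}) (\<lambda>(x, t). LBINT y. q y t * \<eta> x y)"
  unfolding continuous_on_sequentially
proof (intro ballI allI impI)
  fix p0 :: "real \<times> real" and p :: "nat \<Rightarrow> real \<times> real"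
  assume p0: "p0 \<in> UNIV \<times> {0..}" and p: "(\<forall>n. p n \<in> UNIV \<times> {0..}) \<and> p \<longlonglongrightarrow> p0"
  obtain x0 t0 where x0: "p0 = (x0, t0)" by force
  define x t where "x n = fst (p n)" and "t n = snd (p n)" for n
  have pn: "p n = (x n, t n)" for n by (simp add: x_def t_def)
  have lim: "x \<longlonglongrightarrow> x0" "t \<longlonglongrightarrow> t0" using p x0 tendsto_fst[of p p0 sequentially] tendsto_snd[of p p0 sequentially] unfolding x_def t_def by auto
  have t: "t n \<ge> 0" "t0 \<ge> 0" for n using p p0 x0 by (auto simp: t_def mem_Times_iff)
  have "Bseq x" using lim(1) convergentI convergent_imp_Bseq by blast
  then obtain X where X: "X > 0" "\<And>n. \<bar>x n\<bar> \<le> X" by (auto simp: Bseq_def)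
  have X0: "\<bar>x0\<bar> \<le> X" using LIMSEQ_le_const2[OF tendsto_rabs[OF lim(1)]] X(2) by blast
  obtain R C where RC: "\<And>x y. \<bar>x\<bar> \<le> X \<Longrightarrow> \<bar>\<eta> x y\<bar> \<le> C" "\<And>x y. \<bar>x\<bar> \<le> X \<Longrightarrow> \<bar>y\<bar> > R \<Longrightarrow> \<eta> x y = 0"
    using supp[of X] by blast
  have C0: "C \<ge> 0" using RC(1)[of x0 0] X0 by auto
  have \<eta>c: "continuous_on UNIV (\<eta> x)" for x
  proof -
    have "continuous_on UNIV (\<lambda>y. (x, y))" by (intro continuous_intros)
    then show ?thesis using continuous_on_compose2[OF \<eta>, of UNIV "\<lambda>y. (x, y)"] by auto
  qed
  have \<eta>m [measurable]: "\<eta> x \<in> borel_measurable borel" for x using \<eta>c by (rule borel_measurable_continuous_onI)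
  have int: "integrable lborel (\<lambda>y. q y s * \<eta> z y)" if "\<bar>z\<bar> \<le> X" for s z
    using RC that by (intro pairing_integrable[where C=C and a="-R" and b=R]) (auto simp: abs_le_iff not_le)
  have "(\<lambda>n. LBINT y. q y t0 * \<eta> (x n) y) \<longlonglongrightarrow> (LBINT y. q y t0 * \<eta> x0 y)"
  proof (rule integral_dominated_convergence)
    show "integrable lborel (\<lambda>y. M * C * indicator {-R..R} y)" by (rule integrable_const_indicator_Icc)
    show "AE y in lborel. (\<lambda>n. q y t0 * \<eta> (x n) y) \<longlonglongrightarrow> q y t0 * \<eta> x0 y"
    proof (intro AE_I2 tendsto_intros)
      fix y :: real
      have "continuous_on UNIV (\<lambda>x. (x, y))" by (intro continuous_intros)
      then have "continuous_on UNIV (\<lambda>x. \<eta> x y)"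
        using continuous_on_compose2[OF \<eta>, of UNIV "\<lambda>x. (x, y)"] by auto
      then show "(\<lambda>n. \<eta> (x n) y) \<longlonglongrightarrow> \<eta> x0 y"
        using lim(1) by (auto simp: continuous_on_eq_continuous_at intro: isCont_tendsto_compose)
    qed
    show "AE y in lborel. norm (q y t0 * \<eta> (x n) y) \<le> M * C * indicator {-R..R} y" for n
    proof (rule AE_I2)
      fix y :: real
      have "\<bar>q y t0 * \<eta> (x n) y\<bar> \<le> M * C"
        unfolding abs_mult by (intro mult_mono bound RC X bound_nonneg abs_ge_zero)
      then show "norm (q y t0 * \<eta> (x n) y) \<le> M * C * indicator {-R..R} y"
        using RC(2)[OF X(2)[of n], of y] by (cases "\<bar>y\<bar> \<le> R") (auto simp: indicator_def)
    qed
  qed auto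
  moreover have "(\<lambda>n. (LBINT y. q y (t n) * \<eta> (x n) y) - (LBINT y. q y t0 * \<eta> (x n) y)) \<longlonglongrightarrow> 0"
  proof (rule Lim_null_comparison)
    show "(\<lambda>n. C * (LBINT x:{-R..R}. \<bar>q x (t n) - q x t0\<bar>)) \<longlonglongrightarrow> 0"
      using tendsto_mult_right_zero[OF cont_seq[OF t(2) t(1) lim(2)]] by simp
    show "\<forall>\<^sub>F n in sequentially. norm ((LBINT y. q y (t n) * \<eta> (x n) y) - (LBINT y. q y t0 * \<eta> (x n) y))
       \<le> C * (LBINT x:{-R..R}. \<bar>q x (t n) - q x t0\<bar>)"
    proof (intro always_eventually allI)
      fix n
      have i2: "integrable lborel (\<lambda>y. indicator {-R..R} y *\<^sub>R \<bar>q y (t n) - q y t0\<bar>)"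
        by (rule integrable_bounded_support[of _ "2 * M" "-R" R])
           (auto simp: indicator_def bound_nonneg bound_diff)
      have "\<bar>(LBINT y. q y (t n) * \<eta> (x n) y) - (LBINT y. q y t0 * \<eta> (x n) y)\<bar>
         = \<bar>LBINT y. q y (t n) * \<eta> (x n) y - q y t0 * \<eta> (x n) y\<bar>"
        using int[OF X(2)] by simp
      also have "\<dots> \<le> (LBINT y. \<bar>q y (t n) * \<eta> (x n) y - q y t0 * \<eta> (x n) y\<bar>)" by (rule integral_abs_bound)
      also have "\<dots> \<le> (LBINT y. C * (indicator {-R..R} y *\<^sub>R \<bar>q y (t n) - q y t0\<bar>))"
      proof (rule integral_mono)
        fix y :: real
        show "\<bar>q y (t n) * \<eta> (x n) y - q y t0 * \<eta> (x n) y\<bar> \<le> C * (indicator {-R..R} y *\<^sub>R \<bar>q y (t n) - q y t0\<bar>)"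
        proof (cases "\<bar>y\<bar> \<le> R")
          case True
          have "\<bar>q y (t n) - q y t0\<bar> * \<bar>\<eta> (x n) y\<bar> \<le> \<bar>q y (t n) - q y t0\<bar> * C"
            by (intro mult_left_mono RC X) auto
          moreover have "\<bar>q y (t n) * \<eta> (x n) y - q y t0 * \<eta> (x n) y\<bar> = \<bar>q y (t n) - q y t0\<bar> * \<bar>\<eta> (x n) y\<bar>"
            by (simp only: left_diff_distrib[symmetric] abs_mult)
          ultimately show ?thesis using True by (auto simp: indicator_def mult.commute)
        qed (use RC(2)[OF X(2)[of n], of y] C0 in auto)
      qed (use int[OF X(2)] i2 in auto)
      also have "\<dots> = C * (LBINT x:{-R..R}. \<bar>q x (t n) - q x t0\<bar>)"
        by (simp add: set_lebesgue_integral_def)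
      finally show "norm ((LBINT y. q y (t n) * \<eta> (x n) y) - (LBINT y. q y t0 * \<eta> (x n) y))
       \<le> C * (LBINT x:{-R..R}. \<bar>q x (t n) - q x t0\<bar>)" by simp
    qed
  qed
  ultimately have "(\<lambda>n. ((LBINT y. q y (t n) * \<eta> (x n) y) - (LBINT y. q y t0 * \<eta> (x n) y)) + (LBINT y. q y t0 * \<eta> (x n) y))
      \<longlonglongrightarrow> 0 + (LBINT y. q y t0 * \<eta> x0 y)"
    by (rule tendsto_add[rotated])
  then show "((\<lambda>(x, t). LBINT y. q y t * \<eta> x y) \<circ> p) \<longlonglongrightarrow> (\<lambda>(x, t). LBINT y. q y t * \<eta> x y) p0"
    by (simp add: x0 pn o_def)
qed

definition mollified :: "real \<Rightarrow> real \<Rightarrow> real \<Rightarrow> real" where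
  "mollified a x t = (LBINT y. q y t * mol a (y - x))"

lemma mollified_bound: "a > 0 \<Longrightarrow> \<bar>mollified a x t\<bar> \<le> M"
  unfolding mollified_def by (intro mol_pairing_bound bound) auto

lemma mollified_continuous:
  assumes a: "a > 0"
  shows "continuous_on (UNIV \<times> {0..}) (\<lambda>(x, t). mollified a x t)"
  unfolding mollified_def
proof (rule pairing_continuous)
  show "continuous_on UNIV (\<lambda>(x, y). mol a (y - x))"
    unfolding case_prod_unfold by (intro continuous_on_compose2[OF mol_continuous[OF a, of UNIV]] continuous_intros) auto
  obtain C where C: "C > 0" "\<And>a z. a > 0 \<Longrightarrow> mol a z \<le> C / a" using mol_le by blast
  fix X
  have "\<bar>mol a (y - x)\<bar> \<le> C / a" "\<bar>y\<bar> > X + a \<Longrightarrow> mol a (y - x) = 0" if "\<bar>x\<bar> \<le> X" for x y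
    using C(2)[OF a] mol_nonneg[OF a] mol_support[OF a, of "y - x"] that by auto
  then show "\<exists>R C. \<forall>x y. \<bar>x\<bar> \<le> X \<longrightarrow> \<bar>mol a (y - x)\<bar> \<le> C \<and> (\<bar>y\<bar> > R \<longrightarrow> mol a (y - x) = 0)"
    by (intro exI[of _ "X + a"] exI[of _ "C / a"]) blast
qed

lemma mollified_measurable: "a > 0 \<Longrightarrow> (\<lambda>p. mollified a (fst p) (snd p)) \<in> borel_measurable borel"
  unfolding mollified_def by (rule mol_pairing_measurable[OF _ meas])

text \<open>By Fubini it suffices to treat time slices: each converges by
  \<open>L1_mol_tendsto\<close>, and the slice integrals are uniformly bounded.\<close>

lemma mollified_L1:
  "(\<lambda>n. LBINT p. indicator (cbox (-X, T0) (X, T1)) p * \<bar>mollified (1 / real (Suc n)) (fst p) (snd p) - q (fst p) (snd p)\<bar>) \<longlonglongrightarrow> 0"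
proof -
  define a where "a n = 1 / real (Suc n)" for n
  have a: "a n > 0" "a n \<le> 1" for n by (auto simp: a_def)
  have al: "a \<longlonglongrightarrow> 0" unfolding a_def using LIMSEQ_inverse_real_of_nat by (simp add: inverse_eq_divide)
  define F where "F n p = indicator (cbox (-X, T0) (X, T1)) p * \<bar>mollified (a n) (fst p) (snd p) - q (fst p) (snd p)\<bar>" for n p
  note [measurable] = meas mollified_measurable[OF a(1)]
  have [measurable]: "F n \<in> borel_measurable borel" for n unfolding F_def by measurable
  have d: "\<bar>mollified (a n) x t - q x t\<bar> \<le> 2 * M" for n x t
    using mollified_bound[OF a(1)[of n], of x t] bound[of x t] by linarith
  have FM: "\<bar>F n p\<bar> \<le> 2 * M * indicator (cbox (-X, T0) (X, T1)) p" for n p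
    using d[of n "fst p" "snd p"] by (auto simp: F_def indicator_def)
  have Fint: "integrable lborel (F n)" for n
    by (rule Bochner_Integration.integrable_bound[OF integrable_const_indicator_cbox[of "2 * M" "(-X, T0)" "(X, T1)"]])
       (use FM order_trans[OF FM abs_ge_self] in auto)
  then have Fpair: "integrable (lborel \<Otimes>\<^sub>M lborel) (\<lambda>(x, t). F n (x, t))" for n by (simp add: lborel_prod)
  have Ft: "F n (x, t) = indicator {T0..T1} t * (indicator {-X..X} x *\<^sub>R \<bar>(LBINT y. q y t * mol (a n) (y - x)) - q x t\<bar>)" for n x t
    by (auto simp: F_def indicator_def mollified_def)
  have eq: "integral\<^sup>L lborel (F n) = (LBINT t. LBINT x. F n (x, t))" for n
    using lborel_pair.integral_snd[of "\<lambda>x t. F n (x, t)", OF Fpair] by (simp add: lborel_prod)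
  have "(\<lambda>n. LBINT t. LBINT x. F n (x, t)) \<longlonglongrightarrow> (LBINT t::real. (0::real))"
  proof (rule integral_dominated_convergence)
    show "integrable lborel (\<lambda>t. 2 * M * max 0 (X - - X) * indicator {T0..T1} t)" by (rule integrable_const_indicator_Icc)
    show "(\<lambda>t. LBINT x. F n (x, t)) \<in> borel_measurable lborel" for n
      using lborel_pair.integrable_snd[of "\<lambda>x t. F n (x, t)", OF Fpair] by (intro borel_measurable_integrable)
    show "AE t in lborel. (\<lambda>n. LBINT x. F n (x, t)) \<longlonglongrightarrow> 0"
    proof (rule AE_I2)
      fix t
      have "(\<lambda>n. LBINT x:{-X..X}. \<bar>(LBINT y. q y t * mol (a n) (y - x)) - q x t\<bar>) \<longlonglongrightarrow> 0"
        by (rule L1_mol_tendsto[OF _ _ a al, where M=M]) (auto intro: bound)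
      from tendsto_mult_right_zero[OF this, of "indicator {T0..T1} t"]
      show "(\<lambda>n. LBINT x. F n (x, t)) \<longlonglongrightarrow> 0"
        unfolding Ft set_lebesgue_integral_def by simp
    qed
    show "AE t in lborel. norm (LBINT x. F n (x, t)) \<le> 2 * M * max 0 (X - - X) * indicator {T0..T1} t" for n
    proof (rule AE_I2)
      fix t
      have "(\<lambda>x. (x, t)) \<in> borel \<rightarrow>\<^sub>M (borel :: (real \<times> real) measure)"
        by (intro borel_measurable_continuous_onI continuous_intros)
      from measurable_compose[OF this] have [measurable]: "(\<lambda>x. F n (x, t)) \<in> borel_measurable borel" by measurable
      have "\<bar>LBINT x. F n (x, t)\<bar> \<le> 2 * M * max 0 (X - - X)"
      proof (rule integrable_bounded_support(2))
        show "\<bar>F n (x, t)\<bar> \<le> 2 * M" for x using FM[of n "(x, t)"] bound_nonneg by (cases "x \<in> {-X..X} \<and> t \<in> {T0..T1}") (auto simp: indicator_def)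
        show "F n (x, t) = 0" if "x \<notin> {-X..X}" for x using that by (simp add: Ft)
      qed measurable
      then show "norm (LBINT x. F n (x, t)) \<le> 2 * M * max 0 (X - - X) * indicator {T0..T1} t"
        by (cases "t \<in> {T0..T1}") (auto simp: Ft)
    qed
  qed auto
  then show ?thesis unfolding eq[symmetric] by (simp add: F_def[abs_def] a_def)
qed

end

text \<open>Both bounds on \<open>f\<close> are asked only on \<open>{-M..M}\<close>, where
  \<open>u\<close> takes its values; the disjunction encodes this restriction. The L^1 distance of
  two slices then grows at most by the factor \<open>L\<close>.\<close>

lemma L1_continuous_compose:
  assumes "L1_continuous u M" and "\<And>x. \<bar>f x\<bar> \<le> B \<or> \<bar>x\<bar> > M" and f: "continuous_on UNIV f"
    and lip: "\<And>x y. \<bar>x\<bar> \<le> M \<Longrightarrow> \<bar>y\<bar> \<le> M \<Longrightarrow> \<bar>f x - f y\<bar> \<le> L * \<bar>x - y\<bar>"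
  shows "L1_continuous (\<lambda>x t. f (u x t)) B"
proof -
  interpret u: L1_continuous u M by fact
  have [measurable]: "f \<in> borel_measurable borel" using f by (rule borel_measurable_continuous_onI)
  note [measurable] = u.meas
  show ?thesis
  proof
    show "(\<lambda>p. f (u (fst p) (snd p))) \<in> borel_measurable borel" by measurable
    show "\<bar>f (u x t)\<bar> \<le> B" for x t using assms(2)[of "u x t"] u.bound[of x t] by auto
    fix t R :: real assume t: "t \<ge> 0"
    let ?I = "\<lambda>s. LBINT x:{-R..R}. \<bar>f (u x s) - f (u x t)\<bar>"
    show "(?I \<longlongrightarrow> 0) (at t within {0..})"
    proof (rule Lim_null_comparison)
      show "((\<lambda>s. L * (LBINT x:{-R..R}. \<bar>u x s - u x t\<bar>)) \<longlongrightarrow> 0) (at t within {0..})"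
        using tendsto_mult_right_zero[OF u.cont[OF t]] .
      show "\<forall>\<^sub>F s in at t within {0..}. norm (?I s) \<le> L * (LBINT x:{-R..R}. \<bar>u x s - u x t\<bar>)"
      proof (intro always_eventually allI)
        fix s
        have i: "integrable lborel (\<lambda>x. L * (indicator {-R..R} x *\<^sub>R \<bar>u x s - u x t\<bar>))"
          by (intro integrable_mult_right, rule integrable_bounded_support[of _ "2 * M" "-R" R])
             (auto simp: indicator_def u.bound_nonneg u.bound_diff)
        have "?I s \<le> (LBINT x. L * (indicator {-R..R} x *\<^sub>R \<bar>u x s - u x t\<bar>))"
          unfolding set_lebesgue_integral_def
          by (rule integral_mono'[OF i]) (auto simp: indicator_def intro!: lip u.bound order_trans[OF abs_ge_zero lip])
        moreover have "?I s \<ge> 0" unfolding set_lebesgue_integral_def by (intro integral_nonneg_AE) auto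
        ultimately show "norm (?I s) \<le> L * (LBINT x:{-R..R}. \<bar>u x s - u x t\<bar>)"
          by (simp add: set_lebesgue_integral_def)
      qed
    qed
  qed
qed

section \<open>Potential of a bounded entropy solution\<close>

lemma convex_on_UNIV_continuous: "convex_on UNIV (f :: real \<Rightarrow> real) \<Longrightarrow> continuous_on UNIV f"
  by (rule convex_on_continuous) auto

lemma convex_subgradient:
  fixes f :: "real \<Rightarrow> real"
  assumes "convex_on UNIV f"
  obtains m where "\<And>y. f y \<ge> f x + m * (y - x)"
  using convex_le_Inf_differential[OF assms, of x] by auto

text \<open>A subgradient at \<open>x\<close>, tested at the neighbours \<open>x + 1\<close> and
  \<open>x - 1\<close>, has modulus at most \<open>2 * B\<close>, where \<open>B\<close> bounds
  \<open>f\<close> on the interval enlarged by one.\<close>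

lemma convex_locally_lipschitz:
  fixes f :: "real \<Rightarrow> real"
  assumes f: "convex_on UNIV f"
  obtains L where "L > 0" "\<And>x y. \<bar>x\<bar> \<le> N \<Longrightarrow> \<bar>y\<bar> \<le> N \<Longrightarrow> \<bar>f x - f y\<bar> \<le> L * \<bar>x - y\<bar>"
proof -
  have "bounded (f ` {-N-1..N+1})"
    using convex_on_UNIV_continuous[OF f]
    by (intro compact_imp_bounded compact_continuous_image) (auto intro: continuous_on_subset)
  then obtain B where B: "B > 0" "\<forall>x\<in>{-N-1..N+1}. \<bar>f x\<bar> \<le> B" by (auto simp: bounded_pos)
  have *: "f x - f y \<le> 2 * B * \<bar>x - y\<bar>" if "\<bar>x\<bar> \<le> N" for x y
  proof -
    obtain m where m: "\<And>y. f y \<ge> f x + m * (y - x)" using convex_subgradient[OF f] by blast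
    have "x \<in> {-N-1..N+1}" "x + 1 \<in> {-N-1..N+1}" "x - 1 \<in> {-N-1..N+1}" using that by auto
    then have "\<bar>f x\<bar> \<le> B" "\<bar>f (x + 1)\<bar> \<le> B" "\<bar>f (x - 1)\<bar> \<le> B" using B(2) by blast+
    then have "\<bar>m\<bar> \<le> 2 * B" using m[of "x + 1"] m[of "x - 1"] by (simp add: abs_le_iff)
    then have "\<bar>m * (x - y)\<bar> \<le> 2 * B * \<bar>x - y\<bar>" unfolding abs_mult by (intro mult_right_mono) auto
    then show ?thesis using m[of y] by (simp add: algebra_simps abs_le_iff)
  qed
  have "\<bar>f x - f y\<bar> \<le> 2 * B * \<bar>x - y\<bar>" if "\<bar>x\<bar> \<le> N" "\<bar>y\<bar> \<le> N" for x y
    using *[OF that(1), of y] *[OF that(2), of x] by (simp add: abs_le_iff abs_minus_commute)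
  then show thesis using that[of "2 * B"] B by auto
qed

section \<open>Weak formulation against product test functions\<close>

lemma deriv_zero_off_support:
  fixes g :: "real \<Rightarrow> real"
  assumes "(g has_real_derivative d) (at x)" "\<And>x. x \<notin> {a..b} \<Longrightarrow> g x = 0" "x \<notin> {a..b}"
  shows "d = 0"
proof -
  have "((\<lambda>x. 0) has_real_derivative d) (at x)"
    by (rule has_field_derivative_transform_within_open[OF assms(1), where S="- {a..b}"]) (use assms in auto)
  then show ?thesis by (metis DERIV_const DERIV_unique)
qed

lemma C1_test_product:
  assumes \<eta>: "\<And>x. (\<eta> has_real_derivative \<eta>' x) (at x)" "continuous_on UNIV \<eta>'" "\<And>x. x \<notin> {-X..X} \<Longrightarrow> \<eta> x = 0"
    and \<theta>: "\<And>t. (\<theta> has_real_derivative \<theta>' t) (at t)" "continuous_on UNIV \<theta>'" "\<And>t. t \<notin> {\<alpha>..T} \<Longrightarrow> \<theta> t = 0" and "\<alpha> > 0"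
  shows "C1_test (\<lambda>p. \<theta> (snd p) * \<eta> (fst p)) (\<lambda>p. \<theta> (snd p) * \<eta>' (fst p)) (\<lambda>p. \<theta>' (snd p) * \<eta> (fst p))"
proof -
  have c: "continuous_on UNIV \<eta>" "continuous_on UNIV \<theta>"
    using \<eta>(1) \<theta>(1) by (meson DERIV_isCont continuous_at_imp_continuous_on)+
  have "\<theta> (snd p) * \<eta> (fst p) = 0" if "p \<notin> cbox (- (max X T), \<alpha>) (max X T, max X T)" for p
  proof -
    have "fst p \<notin> {-X..X} \<or> snd p \<notin> {\<alpha>..T}" using that by (cases p) auto
    then show ?thesis using \<eta>(3)[of "fst p"] \<theta>(3)[of "snd p"] by auto
  qed
  then show ?thesis
    unfolding C1_test_def using \<open>\<alpha> > 0\<close>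
    by (intro conjI allI exI[of _ \<alpha>] exI[of _ "max X T"] continuous_on_mult
        continuous_on_compose2[OF c(1)] continuous_on_compose2[OF c(2)] continuous_on_compose2[OF \<eta>(2)]
        continuous_on_compose2[OF \<theta>(2)] continuous_on_fst continuous_on_snd continuous_on_id)
       (auto intro!: derivative_eq_intros \<eta>(1) \<theta>(1))
qed

lemma (in L1_continuous) product_integral:
  assumes a: "continuous_on UNIV a" "\<forall>x. x \<notin> {-X..X} \<longrightarrow> a x = 0"
    and b: "continuous_on UNIV b" "\<forall>t. t \<notin> {\<alpha>..T} \<longrightarrow> b t = 0"
  shows "integrable lborel (\<lambda>p. q (fst p) (snd p) * (b (snd p) * a (fst p)))"
    and "integrable lborel (\<lambda>t. b t * (LBINT y. q y t * a y))"
    and "(LBINT p. q (fst p) (snd p) * (b (snd p) * a (fst p))) = (LBINT t. b t * (LBINT y. q y t * a y))"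
proof -
  have "continuous_on UNIV (\<lambda>p. b (snd p) * a (fst p))"
    by (intro continuous_on_mult continuous_on_compose2[OF a(1)] continuous_on_compose2[OF b(1)] continuous_intros) auto
  moreover have "b (snd p) * a (fst p) = 0" if "p \<notin> cbox (-X, \<alpha>) (X, T)" for p
  proof -
    have "fst p \<notin> {-X..X} \<or> snd p \<notin> {\<alpha>..T}" using that by (cases p) auto
    then show ?thesis using a(2)[rule_format, of "fst p"] b(2)[rule_format, of "snd p"] by auto
  qed
  ultimately have i1: "integrable lborel (\<lambda>p. b (snd p) * a (fst p))" by (rule continuous_compact_support)
  show "integrable lborel (\<lambda>p. q (fst p) (snd p) * (b (snd p) * a (fst p)))"
    by (rule integrable_mult_bounded[OF i1 meas bound])
  then have i3: "integrable (lborel \<Otimes>\<^sub>M lborel) (\<lambda>(x, t). q x t * (b t * a x))"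
    by (simp add: lborel_prod case_prod_unfold)
  have eq: "(LBINT y. q y t * (b t * a y)) = b t * (LBINT y. q y t * a y)" for t
    by (simp add: mult.left_commute)
  show "integrable lborel (\<lambda>t. b t * (LBINT y. q y t * a y))"
    using lborel_pair.integrable_snd[OF i3] by (simp only: eq)
  show "(LBINT p. q (fst p) (snd p) * (b (snd p) * a (fst p))) = (LBINT t. b t * (LBINT y. q y t * a y))"
    using lborel_pair.integral_snd[OF i3] by (simp add: eq lborel_prod case_prod_unfold)
qed

lemma L1_continuous_const: "L1_continuous (\<lambda>_ _. 1) 1"
  by standard auto

text \<open>\<open>B\<close> bounds the flux on the range of \<open>u\<close> and will be the
  Lipschitz constant of the potential in time. The entropy integral may run over the whole plane
  because a \<open>C1_test\<close> function vanishes below some positive time.\<close>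

locale bounded_entropy_solution = L1_continuous u M for u M +
  fixes f :: "real \<Rightarrow> real" and B :: real
  assumes f_convex: "convex_on UNIV f"
    and f_bound: "\<bar>x\<bar> \<le> M \<Longrightarrow> \<bar>f x\<bar> \<le> B"
    and entropy: "C1_test \<psi> \<psi>x \<psi>t \<Longrightarrow> (\<And>p. 0 \<le> \<psi> p) \<Longrightarrow>
      0 \<le> (LBINT p. \<bar>u (fst p) (snd p) - k\<bar> * \<psi>t p + sgn (u (fst p) (snd p) - k) * (f (u (fst p) (snd p)) - f k) * \<psi>x p)"
begin

sublocale fu: L1_continuous "\<lambda>x t. f (u x t)" B
proof -
  obtain L where "\<And>x y. \<bar>x\<bar> \<le> M \<Longrightarrow> \<bar>y\<bar> \<le> M \<Longrightarrow> \<bar>f x - f y\<bar> \<le> L * \<bar>x - y\<bar>"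
    using convex_locally_lipschitz[OF f_convex] by blast
  then show "L1_continuous (\<lambda>x t. f (u x t)) B"
    using f_bound by (intro L1_continuous_compose[OF L1_continuous_axioms _ convex_on_UNIV_continuous[OF f_convex]]) force+
qed

text \<open>For \<open>k\<close> above or below the range of \<open>u\<close> the sign of
  \<open>u - k\<close> is constant and Kruzkov's inequality becomes linear. The two choices give
  opposite inequalities, hence equality.\<close>

lemma weak_product_form:
  assumes \<eta>: "\<And>x. (\<eta> has_real_derivative \<eta>' x) (at x)" "continuous_on UNIV \<eta>'" "\<And>x. x \<notin> {-X..X} \<Longrightarrow> \<eta> x = 0" "\<And>x. \<eta> x \<ge> 0"
    and \<theta>: "\<And>t. (\<theta> has_real_derivative \<theta>' t) (at t)" "continuous_on UNIV \<theta>'" "\<And>t. t \<notin> {\<alpha>..T} \<Longrightarrow> \<theta> t = 0" "\<And>t. \<theta> t \<ge> 0"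
    and "\<alpha> > 0" "X \<ge> 0" "T \<ge> \<alpha>"
  shows "(LBINT t. \<theta>' t * (LBINT y. u y t * \<eta> y)) + (LBINT t. \<theta> t * (LBINT y. f (u y t) * \<eta>' y)) = 0"
proof -
  have c: "continuous_on UNIV \<eta>" "continuous_on UNIV \<theta>"
    using \<eta>(1) \<theta>(1) by (meson DERIV_isCont continuous_at_imp_continuous_on)+
  have \<eta>'0: "\<eta>' x = 0" if "x \<notin> {-X..X}" for x
    using deriv_zero_off_support[OF \<eta>(1,3) that] by simp
  have \<theta>'0: "\<theta>' x = 0" if "x \<notin> {\<alpha>..T}" for x
    using deriv_zero_off_support[OF \<theta>(1,3) that] by simp
  interpret one: L1_continuous "\<lambda>_ _. 1" 1 by (rule L1_continuous_const)
  let ?\<psi>t = "\<lambda>p. \<theta>' (snd p) * \<eta> (fst p)" and ?\<psi>x = "\<lambda>p. \<theta> (snd p) * \<eta>' (fst p)"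
  have off: "\<forall>x. x \<notin> {-X..X} \<longrightarrow> \<eta> x = 0" "\<forall>x. x \<notin> {-X..X} \<longrightarrow> \<eta>' x = 0"
    "\<forall>t. t \<notin> {\<alpha>..T} \<longrightarrow> \<theta> t = 0" "\<forall>t. t \<notin> {\<alpha>..T} \<longrightarrow> \<theta>' t = 0"
    using \<eta>(3) \<eta>'0 \<theta>(3) \<theta>'0 by blast+
  note Pt = product_integral[OF c(1) off(1) \<theta>(2) off(4)]
    and Px = fu.product_integral[OF \<eta>(2) off(2) c(2) off(3)]
    and Ct = one.product_integral[OF c(1) off(1) \<theta>(2) off(4)]
    and Cx = one.product_integral[OF \<eta>(2) off(2) c(2) off(3)]
  \<comment> \<open>The constants \<open>k\<close> and \<open>f k\<close> drop out, because
    derivatives of compactly supported functions integrate to zero.\<close>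
  have zt: "(LBINT p. ?\<psi>t p) = 0"
  proof -
    have "has_bochner_integral lborel \<theta>' (\<theta> (T + 1) - \<theta> (\<alpha> - 1))"
      using \<open>T \<ge> \<alpha>\<close> \<theta>'0 by (intro has_bochner_integral_deriv \<theta>) auto
    then have "integral\<^sup>L lborel \<theta>' = 0" using \<theta>(3) by (simp add: has_bochner_integral_iff)
    then show ?thesis using Ct(3) by simp
  qed
  have zx: "(LBINT p. ?\<psi>x p) = 0"
  proof -
    have "has_bochner_integral lborel \<eta>' (\<eta> (X + 1) - \<eta> (- X - 1))"
      using \<open>X \<ge> 0\<close> \<eta>'0 by (intro has_bochner_integral_deriv \<eta>) auto
    then have "integral\<^sup>L lborel \<eta>' = 0" using \<eta>(3) by (simp add: has_bochner_integral_iff)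
    then show ?thesis using Cx(3) by simp
  qed
  let ?W = "(LBINT p. u (fst p) (snd p) * ?\<psi>t p) + (LBINT p. f (u (fst p) (snd p)) * ?\<psi>x p)"
  have key: "(LBINT p. s * (u (fst p) (snd p) - k) * ?\<psi>t p + s * (f (u (fst p) (snd p)) - f k) * ?\<psi>x p) = s * ?W" for s k
  proof -
    have "(LBINT p. s * (u (fst p) (snd p) - k) * ?\<psi>t p + s * (f (u (fst p) (snd p)) - f k) * ?\<psi>x p)
      = (LBINT p. s * (u (fst p) (snd p) * ?\<psi>t p) - (s * k) * ?\<psi>t p + (s * (f (u (fst p) (snd p)) * ?\<psi>x p) - (s * f k) * ?\<psi>x p))"
      by (intro Bochner_Integration.integral_cong refl) (simp add: algebra_simps)
    also have "\<dots> = s * (LBINT p. u (fst p) (snd p) * ?\<psi>t p) - (s * k) * (LBINT p. ?\<psi>t p)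
        + (s * (LBINT p. f (u (fst p) (snd p)) * ?\<psi>x p) - (s * f k) * (LBINT p. ?\<psi>x p))"
      using Pt(1) Px(1) Ct(1) Cx(1)
      by (simp only: Bochner_Integration.integral_add Bochner_Integration.integral_diff integral_mult_right_zero
          Bochner_Integration.integrable_add Bochner_Integration.integrable_diff integrable_mult_right mult_1_left)
    finally show ?thesis by (simp only: zt zx) (simp add: algebra_simps)
  qed
  have test: "C1_test (\<lambda>p. \<theta> (snd p) * \<eta> (fst p)) ?\<psi>x ?\<psi>t"
    by (rule C1_test_product[OF \<eta>(1-3) \<theta>(1-3) \<open>\<alpha> > 0\<close>])
  have pos: "\<theta> (snd p) * \<eta> (fst p) \<ge> 0" for p using \<eta>(4) \<theta>(4) by simp
  have "0 \<le> -1 * ?W"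
  proof -
    have "\<bar>u x t - (M + 1)\<bar> = -1 * (u x t - (M + 1))" "sgn (u x t - (M + 1)) = -1" for x t
      using bound[of x t] by auto
    then show ?thesis using entropy[OF test pos, of "M + 1"] unfolding key[symmetric, of "-1" "M + 1"] by (simp only:)
  qed
  moreover have "0 \<le> 1 * ?W"
  proof -
    have "\<bar>u x t - (- M - 1)\<bar> = 1 * (u x t - (- M - 1))" "sgn (u x t - (- M - 1)) = 1" for x t
      using bound[of x t] by auto
    then show ?thesis using entropy[OF test pos, of "- M - 1"] unfolding key[symmetric, of 1 "- M - 1"] by (simp only:)
  qed
  ultimately have "?W = 0" by simp
  then show ?thesis unfolding Pt(3) Px(3) .
qed

text \<open>The weak form is upgraded to a classical derivative: with \<open>\<Gamma>\<close> an
  antiderivative of the flux pairing \<open>G\<close>, the difference \<open>g - \<Gamma>\<close> is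
  shown to be constant by testing with smoothed indicators of time intervals. Continuity of
  \<open>g\<close> in time gives this for all times. The sign of \<open>\<eta>\<close> is what
  Kruzkov's inequality demands of a test function.\<close>

lemma weak_time_derivative_nonneg:
  assumes \<eta>: "\<And>x. (\<eta> has_real_derivative \<eta>' x) (at x)" "continuous_on UNIV \<eta>'" "\<And>x. x \<notin> {-X..X} \<Longrightarrow> \<eta> x = 0" "\<And>x. \<eta> x \<ge> 0"
    and "X \<ge> 0" "t > 0"
  shows "((\<lambda>t. LBINT y. u y t * \<eta> y) has_real_derivative (LBINT y. f (u y t) * \<eta>' y)) (at t)"
proof -
  have c: "continuous_on UNIV \<eta>"
    using \<eta>(1) by (meson DERIV_isCont continuous_at_imp_continuous_on)
  have \<eta>'0: "\<eta>' x = 0" if "x \<notin> {-X..X}" for x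
    using deriv_zero_off_support[OF \<eta>(1,3) that] by simp
  have bdd: "\<exists>C. \<forall>y. \<bar>a y\<bar> \<le> C" if "continuous_on UNIV a" "\<And>x. x \<notin> {-X..X} \<Longrightarrow> a x = 0" for a :: "real \<Rightarrow> real"
  proof -
    have "bounded (a ` {-X..X})"
      using that(1) by (intro compact_imp_bounded compact_continuous_image) (auto intro: continuous_on_subset)
    then obtain C where "C > 0" "\<forall>x\<in>{-X..X}. \<bar>a x\<bar> \<le> C" by (auto simp: bounded_pos)
    then have "\<bar>a y\<bar> \<le> C" for y using that(2)[of y] by (cases "y \<in> {-X..X}") auto
    then show ?thesis by blast
  qed
  have slice: "continuous_on {0..} (\<lambda>t. LBINT y. q y t * a y)"
    if q: "L1_continuous q M'" and ac: "continuous_on UNIV a" and a0: "\<And>x. x \<notin> {-X..X} \<Longrightarrow> a x = 0" for q M' a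
  proof -
    interpret q: L1_continuous q M' by fact
    obtain C where C: "\<And>y. \<bar>a y\<bar> \<le> C" using bdd[OF ac a0] by blast
    have "continuous_on (UNIV \<times> {0..}) (\<lambda>(x::real, t). LBINT y. q y t * a y)"
    proof (rule q.pairing_continuous)
      show "continuous_on UNIV (\<lambda>(x, y). a y)"
        unfolding case_prod_unfold by (intro continuous_on_compose2[OF ac] continuous_intros) auto
      show "\<exists>R C. \<forall>x y. \<bar>x\<bar> \<le> Z \<longrightarrow> \<bar>a y\<bar> \<le> C \<and> (R < \<bar>y\<bar> \<longrightarrow> a y = 0)" for Z
        using C a0 by (intro exI[of _ X] exI[of _ C]) force
    qed
    then have "continuous_on {0..} (\<lambda>t. (\<lambda>(x::real, t). LBINT y. q y t * a y) (0, t))"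
      by (rule continuous_on_compose2) (auto intro!: continuous_intros)
    then show ?thesis by simp
  qed
  define g where "g t = (LBINT y. u y t * \<eta> y)" for t
  define G where "G t = (LBINT y. f (u y t) * \<eta>' y)" for t
  have gc: "continuous_on {0..} g" unfolding g_def by (rule slice[OF L1_continuous_axioms c \<eta>(3)])
  have Gc: "continuous_on {0..} G" unfolding G_def by (rule slice[OF fu.L1_continuous_axioms \<eta>(2) \<eta>'0])
  have Gc': "continuous_on UNIV (\<lambda>t. G (max 0 t))"
    by (rule continuous_on_compose2[OF Gc]) (auto intro!: continuous_intros)
  obtain \<Gamma> where \<Gamma>: "\<And>t. (\<Gamma> has_real_derivative G (max 0 t)) (at t)"
    using continuous_real_antiderivative[OF Gc'] by blast
  have \<Gamma>c: "continuous_on UNIV \<Gamma>" using \<Gamma> by (meson DERIV_isCont continuous_at_imp_continuous_on)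
  have const: "g s1 - \<Gamma> s1 = g s2 - \<Gamma> s2" if s: "0 < s1" "s1 < s2" for s1 s2
  proof -
    \<comment> \<open>Clamping the time turns \<open>g - \<Gamma>\<close> into a bounded continuous
      function on the whole line, to which \<open>mol_pairing_tendsto\<close> applies, without
      changing it on the support of the test functions.\<close>
    define cl where "cl t = max (s1 / 2) (min (s2 + 1) t)" for t
    have clc: "continuous_on UNIV cl" unfolding cl_def by (intro continuous_intros)
    have cl: "cl t \<in> {s1/2..s2+1}" for t using s by (auto simp: cl_def)
    have cl0: "cl ` UNIV \<subseteq> {0..}" using s by (auto simp: cl_def)
    define h where "h t = g (cl t) - \<Gamma> (cl t)" for t
    have hc: "continuous_on UNIV h" unfolding h_def
      by (intro continuous_on_diff continuous_on_compose2[OF gc clc cl0] continuous_on_compose2[OF \<Gamma>c clc]) simp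
    have "continuous_on {s1/2..s2+1} (\<lambda>t. g t - \<Gamma> t)"
      using s by (intro continuous_on_diff continuous_on_subset[OF gc] continuous_on_subset[OF \<Gamma>c]) auto
    then have "bounded ((\<lambda>t. g t - \<Gamma> t) ` {s1/2..s2+1})"
      by (intro compact_imp_bounded compact_continuous_image compact_Icc)
    then obtain C where C: "\<forall>t\<in>{s1/2..s2+1}. \<bar>g t - \<Gamma> t\<bar> \<le> C" by (auto simp: bounded_iff)
    have hb: "\<bar>h t\<bar> \<le> C" for t unfolding h_def using C cl by blast
    have hm: "h \<in> borel_measurable borel" using hc by (rule borel_measurable_continuous_onI)
    \<comment> \<open>These scales keep the transition zones around \<open>s1\<close> and
      \<open>s2\<close> inside \<open>{s1/2..s2+1}\<close>, away from time zero.\<close>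
    define a where "a n = min (s1 / 2) 1 / real (Suc n)" for n
    have a: "a n > 0" "a n \<le> s1 / 2" "a n \<le> 1" for n
    proof -
      show "a n > 0" using s by (simp add: a_def)
      have "a n \<le> min (s1 / 2) 1" unfolding a_def
        using divide_left_mono[of 1 "real (Suc n)" "min (s1 / 2) 1"] s by simp
      then show "a n \<le> s1 / 2" "a n \<le> 1" by auto
    qed
    have al: "a \<longlonglongrightarrow> 0" unfolding a_def divide_inverse[of _ "real (Suc _)"]
      by (rule tendsto_mult_right_zero[OF LIMSEQ_inverse_real_of_nat])
    have eq: "(LBINT t. h t * mol (a n) (t - s1)) = (LBINT t. h t * mol (a n) (t - s2))" for n
    proof -
      \<comment> \<open>A smoothed indicator of \<open>{s1..s2}\<close>: its derivative is a kernel
        at \<open>s1\<close> minus a kernel at \<open>s2\<close>, so in the limit it compares the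
        values at these two times.\<close>
      define \<theta> \<theta>' where "\<theta> t = ramp (a n) (t - s1) - ramp (a n) (t - s2)"
        and "\<theta>' t = mol (a n) (t - s1) - mol (a n) (t - s2)" for t
      have \<theta>: "(\<theta> has_real_derivative \<theta>' t) (at t)" for t
        unfolding \<theta>_def \<theta>'_def by (intro DERIV_diff ramp_shift_deriv a)
      have \<theta>'c: "continuous_on UNIV \<theta>'" unfolding \<theta>'_def by (intro continuous_intros mol_shift_continuous a)
      have \<theta>c: "continuous_on UNIV \<theta>" using \<theta> by (meson DERIV_isCont continuous_at_imp_continuous_on)
      have \<theta>0: "\<theta> t = 0" if "t \<notin> {s1/2..s2+1}" for t
      proof (cases "t < s1 / 2")
        case True
        then show ?thesis using s a[of n] ramp_left[OF a(1), of "t - s1" n] ramp_left[OF a(1), of "t - s2" n] by (simp add: \<theta>_def)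
      next
        case False
        then show ?thesis using s that a[of n] ramp_right[OF a(1), of n "t - s1"] ramp_right[OF a(1), of n "t - s2"] by (simp add: \<theta>_def)
      qed
      have \<theta>'0: "\<theta>' t = 0" if "t \<notin> {s1/2..s2+1}" for t
        using s a[of n] that by (auto simp: \<theta>'_def mol_support[OF a(1)])
      have \<theta>pos: "\<theta> t \<ge> 0" for t using s ramp_mono[OF a(1), of "t - s2" "t - s1" n] by (simp add: \<theta>_def)
      have "(LBINT t. \<theta>' t * g t) + (LBINT t. \<theta> t * G t) = 0"
        unfolding g_def G_def using s \<open>X \<ge> 0\<close>
        by (intro weak_product_form[OF \<eta>(1,2) _ \<eta>(4) \<theta> \<theta>'c _ \<theta>pos, where X=X and \<alpha>="s1/2" and T="s2+1"] \<eta>(3) \<theta>0) auto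
      \<comment> \<open>Integration by parts without boundary terms. Subtracted from the weak form,
        it leaves the pairing of \<open>\<theta>'\<close> with \<open>g - \<Gamma>\<close>.\<close>
      moreover have "(LBINT t. \<theta>' t * \<Gamma> t) + (LBINT t. \<theta> t * G t) = 0"
      proof -
        have d: "((\<lambda>t. \<theta> t * \<Gamma> t) has_real_derivative \<theta>' t * \<Gamma> t + \<theta> t * G (max 0 t)) (at t)" for t
          using DERIV_mult[OF \<theta> \<Gamma>, of t] by (simp add: mult.commute)
        have "has_bochner_integral lborel (\<lambda>t. \<theta>' t * \<Gamma> t + \<theta> t * G (max 0 t)) (\<theta> (s2 + 2) * \<Gamma> (s2 + 2) - \<theta> (s1/2 - 1) * \<Gamma> (s1/2 - 1))"
          using s by (intro has_bochner_integral_deriv d continuous_intros \<theta>'c \<theta>c Gc' \<Gamma>c) (auto simp: \<theta>0 \<theta>'0)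
        then have "(LBINT t. \<theta>' t * \<Gamma> t + \<theta> t * G (max 0 t)) = 0"
          using s by (simp add: has_bochner_integral_iff \<theta>0)
        moreover have "integrable lborel (\<lambda>t. \<theta>' t * \<Gamma> t)"
          using \<theta>'0 by (intro continuous_compact_support(1)[of _ "s1/2" "s2+1"] continuous_intros \<theta>'c \<Gamma>c) auto
        moreover have "integrable lborel (\<lambda>t. \<theta> t * G (max 0 t))"
          using \<theta>0 by (intro continuous_compact_support(1)[of _ "s1/2" "s2+1"] continuous_intros \<theta>c Gc') auto
        moreover have "\<theta> t * G (max 0 t) = \<theta> t * G t" for t using \<theta>0[of t] s by (cases "t \<ge> 0") auto
        ultimately show ?thesis by simp
      qed
      moreover have "integrable lborel (\<lambda>t. \<theta>' t * \<Gamma> t)"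
        using \<theta>'0 by (intro continuous_compact_support(1)[of _ "s1/2" "s2+1"] continuous_intros \<theta>'c \<Gamma>c) auto
      moreover have "integrable lborel (\<lambda>t. \<theta>' t * g t)"
      proof -
        have "integrable lborel (\<lambda>t. \<theta>' t * g (cl t))"
          by (intro continuous_compact_support(1)[of _ "s1/2" "s2+1"] continuous_intros \<theta>'c continuous_on_compose2[OF gc clc cl0])
             (simp add: \<theta>'0)
        moreover have "\<theta>' t * g (cl t) = \<theta>' t * g t" for t using \<theta>'0[of t] by (cases "t \<in> {s1/2..s2+1}") (auto simp: cl_def)
        ultimately show ?thesis by (simp only:)
      qed
      ultimately have zero: "(LBINT t. \<theta>' t * g t - \<theta>' t * \<Gamma> t) = 0" by simp
      have point: "\<theta>' t * g t - \<theta>' t * \<Gamma> t = h t * mol (a n) (t - s1) - h t * mol (a n) (t - s2)" for t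
      proof (cases "t \<in> {s1/2..s2+1}")
        case True
        then have "cl t = t" by (auto simp: cl_def)
        then show ?thesis by (simp add: h_def \<theta>'_def algebra_simps)
      next
        case False
        then have "\<theta>' t = 0" by (rule \<theta>'0)
        moreover have "h t * mol (a n) (t - s1) - h t * mol (a n) (t - s2) = h t * \<theta>' t" unfolding \<theta>'_def by (rule right_diff_distrib[symmetric])
        ultimately show ?thesis by (simp only: mult_zero_left mult_zero_right diff_self)
      qed
      have "(LBINT t. h t * mol (a n) (t - s1) - h t * mol (a n) (t - s2)) = 0" using zero by (simp only: point)
      then show ?thesis
        unfolding Bochner_Integration.integral_diff[OF mol_pairing_integrable[OF a(1) hm hb] mol_pairing_integrable[OF a(1) hm hb]] by linarith
    qed
    have hc': "isCont h s" for s using hc by (simp add: continuous_on_eq_continuous_at)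
    have "(\<lambda>n. LBINT t. h t * mol (a n) (t - s1)) \<longlonglongrightarrow> h s1"
      by (rule mol_pairing_tendsto[OF hm hb hc' a(1) al])
    moreover have "(\<lambda>n. LBINT t. h t * mol (a n) (t - s2)) \<longlonglongrightarrow> h s2"
      by (rule mol_pairing_tendsto[OF hm hb hc' a(1) al])
    ultimately have "h s1 = h s2" unfolding eq by (rule LIMSEQ_unique)
    then show ?thesis using s by (simp add: h_def cl_def)
  qed
  have eq: "g s = g t - \<Gamma> t + \<Gamma> s" if "s > 0" for s
  proof (cases s t rule: linorder_cases)
    case less
    show ?thesis using const[OF that less] by linarith
  next
    case greater
    show ?thesis using const[OF \<open>t > 0\<close> greater] by linarith
  qed simp
  have "((\<lambda>s. g t - \<Gamma> t + \<Gamma> s) has_real_derivative G t) (at t)"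
    using DERIV_add[OF DERIV_const \<Gamma>[of t], of "g t - \<Gamma> t"] \<open>t > 0\<close> by (simp add: max_def)
  then have "(g has_real_derivative G t) (at t)"
  proof (rule has_field_derivative_transform_within_open)
    show "open {0::real<..}" "t \<in> {0<..}" using \<open>t > 0\<close> by auto
    show "g t - \<Gamma> t + \<Gamma> s = g s" if "s \<in> {0<..}" for s using eq[of s] that by (simp only: greaterThan_iff)
  qed
  then show ?thesis unfolding g_def G_def .
qed

text \<open>The weight \<open>ramp 1 y - ramp a (y - x)\<close> need not have a sign. It is the
  difference of two nonnegative weights that both start with a smoothed step at \<open>- N\<close>;
  the flux through that step cancels.\<close>

lemma weak_time_derivative_step:
  assumes a: "a > 0" and t: "t > 0"
  shows "((\<lambda>t. LBINT y. u y t * (ramp 1 y - ramp a (y - x))) has_real_derivative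
      fu.mollified 1 0 t - fu.mollified a x t) (at t)"
proof -
  \<comment> \<open>Far enough to the left that the step at \<open>- N\<close> is complete before
    the step at \<open>x\<close> or the one at \<open>0\<close> begins.\<close>
  define N where "N = \<bar>x\<bar> + a + 2"
  have base: "((\<lambda>t. LBINT y. u y t * (ramp 1 (y - - N) - ramp b (y - z))) has_real_derivative
      fu.mollified 1 (- N) t - fu.mollified b z t) (at t)" if b: "b > 0" and z: "\<bar>z\<bar> + b \<le> N - 1" for b z
  proof -
    have "((\<lambda>t. LBINT y. u y t * (ramp 1 (y - - N) - ramp b (y - z))) has_real_derivative
        (LBINT y. f (u y t) * (mol 1 (y - - N) - mol b (y - z)))) (at t)"
    proof (rule weak_time_derivative_nonneg[where X="N + 1"])
      show "((\<lambda>y. ramp 1 (y - - N) - ramp b (y - z)) has_real_derivative mol 1 (y - - N) - mol b (y - z)) (at y)" for y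
        using b by (intro DERIV_diff ramp_shift_deriv) auto
      show "continuous_on UNIV (\<lambda>y. mol 1 (y - - N) - mol b (y - z))"
        using b by (intro continuous_intros mol_shift_continuous) auto
      show "ramp 1 (y - - N) - ramp b (y - z) = 0" if "y \<notin> {- (N + 1)..N + 1}" for y
      proof (cases "y < - (N + 1)")
        case True
        then show ?thesis using b z ramp_left[of 1 "y - - N"] ramp_left[of b "y - z"] by auto
      next
        case False
        then have "y > N + 1" using that by auto
        moreover have "N \<ge> 0" using b z by auto
        ultimately show ?thesis using b z ramp_right[of 1 "y - - N"] ramp_right[of b "y - z"] by auto
      qed
      show "ramp 1 (y - - N) - ramp b (y - z) \<ge> 0" for y
      proof (cases "y - z \<le> - b")
        case True
        then show ?thesis using b ramp_left[of b "y - z"] ramp_bounds(1)[of 1 "y - - N"] by simp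
      next
        case False
        then have "y - - N \<ge> 1" using z by auto
        then show ?thesis using b ramp_right[of 1 "y - - N"] ramp_bounds(2)[of b "y - z"] by simp
      qed
      show "N + 1 \<ge> 0" using b z by auto
    qed (rule t)
    moreover have "(LBINT y. f (u y t) * (mol 1 (y - - N) - mol b (y - z))) = fu.mollified 1 (- N) t - fu.mollified b z t"
    proof -
      have "integrable lborel (\<lambda>y. f (u y t) * mol 1 (y - - N))" "integrable lborel (\<lambda>y. f (u y t) * mol b (y - z))"
        by (rule mol_pairing_integrable[where M=B], use b fu.bound in \<open>simp_all del: diff_minus_eq_add\<close>)+
      then show ?thesis
        unfolding fu.mollified_def by (simp only: right_diff_distrib Bochner_Integration.integral_diff)
    qed
    ultimately show ?thesis by simp
  qed
  have int: "integrable lborel (\<lambda>y. u y t * (ramp 1 (y - - N) - ramp b (y - z)))" if b: "b > 0" and z: "\<bar>z\<bar> + b \<le> N - 1" for b z t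
  proof (rule pairing_integrable[where C=1 and a="-N-1" and b="N+1"])
    have "continuous_on UNIV (\<lambda>y. ramp 1 (y - - N) - ramp b (y - z))"
      using b by (intro continuous_on_diff continuous_on_compose2[OF ramp_continuous[of _ UNIV]] continuous_intros) auto
    then show "(\<lambda>y. ramp 1 (y - - N) - ramp b (y - z)) \<in> borel_measurable borel" by (rule borel_measurable_continuous_onI)
    show "\<bar>ramp 1 (y - - N) - ramp b (y - z)\<bar> \<le> 1" for y
      using ramp_bounds[of 1 "y - - N"] ramp_bounds[OF b, of "y - z"] by auto
    show "ramp 1 (y - - N) - ramp b (y - z) = 0" if "y \<notin> {- N - 1..N + 1}" for y
    proof (cases "y < - (N + 1)")
      case True
      then show ?thesis using b z ramp_left[of 1 "y - - N"] ramp_left[of b "y - z"] by auto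
    next
      case False
      then have "y > N + 1" using that by auto
      moreover have "N \<ge> 0" using b z by auto
      ultimately show ?thesis using b z ramp_right[of 1 "y - - N"] ramp_right[of b "y - z"] by auto
    qed
  qed
  have N: "\<bar>x\<bar> + a \<le> N - 1" "\<bar>0\<bar> + 1 \<le> N - 1" using a by (auto simp: N_def)
  have "(LBINT y. u y t * (ramp 1 y - ramp a (y - x))) =
     (LBINT y. u y t * (ramp 1 (y - - N) - ramp a (y - x))) - (LBINT y. u y t * (ramp 1 (y - - N) - ramp 1 (y - 0)))" for t
  proof -
    have "u y t * (ramp 1 y - ramp a (y - x)) = u y t * (ramp 1 (y - - N) - ramp a (y - x)) - u y t * (ramp 1 (y - - N) - ramp 1 (y - 0))" for y
      by (simp add: algebra_simps)
    then show ?thesis using int[OF a N(1), of t] int[OF _ N(2), of t] by (simp only: zero_less_one Bochner_Integration.integral_diff)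
  qed
  moreover have "((\<lambda>t. (LBINT y. u y t * (ramp 1 (y - - N) - ramp a (y - x))) - (LBINT y. u y t * (ramp 1 (y - - N) - ramp 1 (y - 0)))) has_real_derivative
      (fu.mollified 1 (- N) t - fu.mollified a x t) - (fu.mollified 1 (- N) t - fu.mollified 1 0 t)) (at t)"
    by (intro DERIV_diff base a N zero_less_one)
  ultimately show ?thesis by simp
qed

text \<open>Fixes the additive constant in time of the potential.\<close>

definition drift :: "real \<Rightarrow> real" where
  "drift = (SOME D. \<forall>t. (D has_real_derivative fu.mollified 1 0 (max 0 t)) (at t))"

lemma drift_deriv: "(drift has_real_derivative fu.mollified 1 0 (max 0 t)) (at t)"
proof -
  have "continuous_on UNIV (\<lambda>t. (\<lambda>(x, t). fu.mollified 1 x t) (0, max 0 t))"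
    by (rule continuous_on_compose2[OF fu.mollified_continuous[of 1]]) (auto intro!: continuous_intros)
  then obtain D where "\<And>t. (D has_real_derivative fu.mollified 1 0 (max 0 t)) (at t)"
    using continuous_real_antiderivative[of "\<lambda>t. fu.mollified 1 0 (max 0 t)"] by auto
  then have "\<exists>D. \<forall>t. (D has_real_derivative fu.mollified 1 0 (max 0 t)) (at t)" by blast
  from someI_ex[OF this] show ?thesis unfolding drift_def by blast
qed

text \<open>A bounded \<open>u\<close> need not be integrable on the line, so the primitive starts
  from a smeared origin and the weight has compact support. The smearing makes the flux through the
  origin equal to \<open>fu.mollified 1 0 t\<close>, a continuous function of time, and subtracting
  \<open>drift\<close> removes exactly this contribution.\<close>

definition potential :: "real \<Rightarrow> real \<Rightarrow> real" where
  "potential x t = (LBINT y. u y t * (ramp 1 y - indicator {x..} y)) - drift t"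

text \<open>Averaging the indicator of \<open>{x..}\<close> in \<open>x\<close> against
  \<open>mol a\<close> produces \<open>ramp a (y - x)\<close>; hence this is the potential mollified
  in \<open>x\<close> at scale \<open>a\<close>.\<close>

definition mollified_potential :: "real \<Rightarrow> real \<Rightarrow> real \<Rightarrow> real" where
  "mollified_potential a x t = (LBINT y. u y t * (ramp 1 y - ramp a (y - x))) - drift t"

lemma potential_integrable: "integrable lborel (\<lambda>y. u y t * (ramp 1 y - indicator {x..} y))"
proof (rule pairing_integrable[where C=1 and a="-\<bar>x\<bar>-1" and b="\<bar>x\<bar>+1"])
  have [measurable]: "ramp 1 \<in> borel_measurable borel" by (intro borel_measurable_continuous_onI ramp_continuous) auto
  show "(\<lambda>y. ramp 1 y - indicator {x..} y) \<in> borel_measurable borel" by measurable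
  show "\<bar>ramp 1 y - indicator {x..} y\<bar> \<le> 1" for y using ramp_bounds[of 1 y] by (auto simp: indicator_def)
  show "ramp 1 y - indicator {x..} y = 0" if "y \<notin> {-\<bar>x\<bar>-1..\<bar>x\<bar>+1}" for y
    using that ramp_left[of 1 y] ramp_right[of 1 y] by (cases "y < -\<bar>x\<bar>-1") (auto simp: indicator_def)
qed

lemma ramp_pair_support:
  assumes "a > 0" "y \<notin> {-\<bar>x\<bar>-a-1..\<bar>x\<bar>+a+1}"
  shows "ramp 1 y - ramp a (y - x) = 0"
proof (cases "y < -\<bar>x\<bar>-a-1")
  case True
  then show ?thesis using assms ramp_left[of 1 y] ramp_left[of a "y - x"] by auto
next
  case False
  then show ?thesis using assms ramp_right[of 1 y] ramp_right[of a "y - x"] by auto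
qed

lemma mollified_potential_integrable:
  assumes a: "a > 0" shows "integrable lborel (\<lambda>y. u y t * (ramp 1 y - ramp a (y - x)))"
proof (rule pairing_integrable[where C=1])
  have "continuous_on UNIV (\<lambda>y. ramp 1 y - ramp a (y - x))"
    using a by (intro continuous_on_diff ramp_continuous continuous_on_compose2[OF ramp_continuous[of _ UNIV]] continuous_intros) auto
  then show "(\<lambda>y. ramp 1 y - ramp a (y - x)) \<in> borel_measurable borel" by (rule borel_measurable_continuous_onI)
  show "\<bar>ramp 1 y - ramp a (y - x)\<bar> \<le> 1" for y using ramp_bounds[of 1 y] ramp_bounds[OF a, of "y - x"] by auto
qed (rule ramp_pair_support[OF a])

text \<open>The two weights differ by at most one, and only on
  \<open>{x - a..x + a}\<close>.\<close>

lemma mollified_potential_close: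
  assumes a: "a > 0" shows "\<bar>mollified_potential a x t - potential x t\<bar> \<le> 2 * M * a"
proof -
  have "\<bar>LBINT y. u y t * (indicator {x..} y - ramp a (y - x))\<bar> \<le> M * 1 * max 0 ((x + a) - (x - a))"
  proof (rule pairing_integrable(2))
    have "continuous_on UNIV (\<lambda>y. ramp a (y - x))"
      using a by (intro continuous_on_compose2[OF ramp_continuous[of _ UNIV]] continuous_intros) auto
    then have [measurable]: "(\<lambda>y. ramp a (y - x)) \<in> borel_measurable borel" by (rule borel_measurable_continuous_onI)
    show "(\<lambda>y. indicator {x..} y - ramp a (y - x)) \<in> borel_measurable borel" by measurable
    show "\<bar>indicator {x..} y - ramp a (y - x)\<bar> \<le> 1" for y using ramp_bounds[OF a, of "y - x"] by (auto simp: indicator_def)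
    show "indicator {x..} y - ramp a (y - x) = 0" if "y \<notin> {x - a..x + a}" for y
      using that a ramp_left[OF a, of "y - x"] ramp_right[OF a, of "y - x"] by (cases "y < x - a") (auto simp: indicator_def)
  qed
  moreover have "mollified_potential a x t - potential x t = (LBINT y. u y t * (indicator {x..} y - ramp a (y - x)))"
  proof -
    have "mollified_potential a x t - potential x t = (LBINT y. u y t * (ramp 1 y - ramp a (y - x)) - u y t * (ramp 1 y - indicator {x..} y))"
      unfolding mollified_potential_def potential_def using mollified_potential_integrable[OF a] potential_integrable by simp
    also have "\<dots> = (LBINT y. u y t * (indicator {x..} y - ramp a (y - x)))"
      by (intro Bochner_Integration.integral_cong refl) (simp add: algebra_simps)
    finally show ?thesis .
  qed
  ultimately show ?thesis using a by simp
qed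

lemma mollified_potential_deriv_t:
  assumes "a > 0" "t > 0" shows "((\<lambda>t. mollified_potential a x t) has_real_derivative - fu.mollified a x t) (at t)"
  using DERIV_diff[OF weak_time_derivative_step[OF assms, of x] drift_deriv[of t]] assms(2)
  by (simp add: mollified_potential_def max_def)

text \<open>First order expansion of \<open>ramp a\<close> with a quadratic remainder, which comes
  from the Lipschitz bound on \<open>mol a\<close> and is integrated over a window of fixed
  length.\<close>

lemma mollified_potential_deriv_x:
  assumes a: "a > 0" shows "((\<lambda>x. mollified_potential a x t) has_real_derivative mollified a x t) (at x)"
proof -
  obtain C where C: "C > 0" "\<And>y z. \<bar>mol a y - mol a z\<bar> \<le> C * \<bar>y - z\<bar>" using mol_lipschitz[OF a] by blast
  \<comment> \<open>For \<open>|h| \<le> 1\<close> the window \<open>{- R..R}\<close> contains the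
    transition zones of the original and of the shifted step.\<close>
  define R where "R = \<bar>x\<bar> + 1 + a"
  have taylor: "\<bar>ramp a z - ramp a (z - h) - h * mol a z\<bar> \<le> C * h\<^sup>2" for z h
  proof -
    have "\<exists>\<xi>. \<bar>\<xi> - z\<bar> \<le> \<bar>h\<bar> \<and> ramp a z - ramp a (z - h) = h * mol a \<xi>"
    proof (cases h "0::real" rule: linorder_cases)
      case less
      then obtain \<xi> where "z < \<xi>" "\<xi> < z - h" "ramp a (z - h) - ramp a z = (z - h - z) * mol a \<xi>"
        using MVT2[of z "z - h" "ramp a" "mol a"] ramp_deriv[OF a] by auto
      then show ?thesis using less by (intro exI[of _ \<xi>]) (auto simp: algebra_simps)
    next
      case greater
      then obtain \<xi> where "z - h < \<xi>" "\<xi> < z" "ramp a z - ramp a (z - h) = (z - (z - h)) * mol a \<xi>"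
        using MVT2[of "z - h" z "ramp a" "mol a"] ramp_deriv[OF a] by auto
      then show ?thesis using greater by (intro exI[of _ \<xi>]) (auto simp: algebra_simps)
    qed auto
    then obtain \<xi> where \<xi>: "\<bar>\<xi> - z\<bar> \<le> \<bar>h\<bar>" "ramp a z - ramp a (z - h) = h * mol a \<xi>" by blast
    have "\<bar>h * mol a \<xi> - h * mol a z\<bar> = \<bar>h\<bar> * \<bar>mol a \<xi> - mol a z\<bar>" by (simp add: right_diff_distrib[symmetric] abs_mult)
    also have "\<dots> \<le> \<bar>h\<bar> * (C * \<bar>\<xi> - z\<bar>)" by (intro mult_left_mono C) auto
    also have "\<dots> \<le> \<bar>h\<bar> * (C * \<bar>h\<bar>)" using C(1) \<xi>(1) by (intro mult_left_mono) auto
    also have "\<dots> = C * h\<^sup>2" by (simp add: power2_eq_square)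
    finally show ?thesis using \<xi>(2) by simp
  qed
  have est: "\<bar>mollified_potential a (x + h) t - mollified_potential a x t - h * mollified a x t\<bar> \<le> (M * C * (2 * R)) * h\<^sup>2" if h: "\<bar>h\<bar> \<le> 1" for h
  proof -
    have i: "integrable lborel (\<lambda>y. u y t * mol a (y - x))" by (rule mol_pairing_integrable[OF a _ bound]) measurable
    have "mollified_potential a (x + h) t - mollified_potential a x t - h * mollified a x t =
      (LBINT y. (u y t * (ramp 1 y - ramp a (y - (x + h))) - u y t * (ramp 1 y - ramp a (y - x))) - h * (u y t * mol a (y - x)))"
      unfolding mollified_potential_def mollified_def using mollified_potential_integrable[OF a] i by simp
    also have "\<dots> = (LBINT y. u y t * (ramp a (y - x) - ramp a ((y - x) - h) - h * mol a (y - x)))"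
      by (intro Bochner_Integration.integral_cong refl) (simp add: algebra_simps)
    finally have eq: "mollified_potential a (x + h) t - mollified_potential a x t - h * mollified a x t =
       (LBINT y. u y t * (ramp a (y - x) - ramp a ((y - x) - h) - h * mol a (y - x)))" .
    have "\<bar>LBINT y. u y t * (ramp a (y - x) - ramp a ((y - x) - h) - h * mol a (y - x))\<bar> \<le> M * (C * h\<^sup>2) * max 0 (R - - R)"
    proof (rule pairing_integrable(2))
      have "continuous_on UNIV (\<lambda>y. ramp a (y - x) - ramp a ((y - x) - h) - h * mol a (y - x))"
        using a by (intro continuous_on_diff continuous_on_mult continuous_on_compose2[OF ramp_continuous[of _ UNIV]] mol_shift_continuous continuous_intros) auto
      then show "(\<lambda>y. ramp a (y - x) - ramp a ((y - x) - h) - h * mol a (y - x)) \<in> borel_measurable borel" by (rule borel_measurable_continuous_onI)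
      show "\<bar>ramp a (y - x) - ramp a ((y - x) - h) - h * mol a (y - x)\<bar> \<le> C * h\<^sup>2" for y by (rule taylor)
      show "ramp a (y - x) - ramp a ((y - x) - h) - h * mol a (y - x) = 0" if "y \<notin> {- R..R}" for y
      proof (cases "y < - R")
        case True
        then have "y - x \<le> - a" "y - x - h \<le> - a" using h by (auto simp: R_def)
        then show ?thesis using a ramp_left[OF a, of "y - x"] ramp_left[OF a, of "y - x - h"] mol_support[OF a, of "y - x"] by simp
      next
        case False
        then have "y - x \<ge> a" "y - x - h \<ge> a" using that h by (auto simp: R_def)
        then show ?thesis using a ramp_right[OF a, of "y - x"] ramp_right[OF a, of "y - x - h"] mol_support[OF a, of "y - x"] by simp
      qed
    qed
    also have "max 0 (R - - R) = 2 * R" using a by (simp add: R_def)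
    finally show ?thesis unfolding eq by (simp add: mult_ac)
  qed
  have "((\<lambda>h. (mollified_potential a (x + h) t - mollified_potential a x t) / h - mollified a x t) \<longlongrightarrow> 0) (at 0)"
  proof (rule Lim_null_comparison)
    show "((\<lambda>h. (M * C * (2 * R)) * \<bar>h\<bar>) \<longlongrightarrow> 0) (at 0)" by (auto intro!: tendsto_eq_intros)
    have "\<forall>\<^sub>F h in at (0::real). \<bar>h\<bar> \<le> 1 \<and> h \<noteq> 0"
      unfolding eventually_at by (intro exI[of _ 1]) (auto simp: dist_real_def)
    then show "\<forall>\<^sub>F h in at 0. norm ((mollified_potential a (x + h) t - mollified_potential a x t) / h - mollified a x t) \<le> (M * C * (2 * R)) * \<bar>h\<bar>"
    proof eventually_elim
      case (elim h)
      have "norm ((mollified_potential a (x + h) t - mollified_potential a x t) / h - mollified a x t)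
          = \<bar>mollified_potential a (x + h) t - mollified_potential a x t - h * mollified a x t\<bar> / \<bar>h\<bar>"
        using elim by (simp add: abs_divide[symmetric] diff_divide_distrib)
      also have "\<dots> \<le> (M * C * (2 * R)) * h\<^sup>2 / \<bar>h\<bar>" using est elim by (intro divide_right_mono) auto
      also have "\<dots> = (M * C * (2 * R)) * \<bar>h\<bar>" using elim by (simp add: power2_eq_square abs_if)
      finally show ?case .
    qed
  qed
  then show ?thesis unfolding DERIV_def by (simp add: LIM_zero_iff)
qed

lemma mollified_potential_continuous:
  assumes a: "a > 0" shows "continuous_on (UNIV \<times> {0..}) (\<lambda>(x, t). mollified_potential a x t)"
proof -
  have 1: "continuous_on (UNIV \<times> {0..}) (\<lambda>(x, t). LBINT y. u y t * (ramp 1 y - ramp a (y - x)))"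
  proof (rule pairing_continuous)
    show "continuous_on UNIV (\<lambda>(x, y). ramp 1 y - ramp a (y - x))"
      unfolding case_prod_unfold using a
      by (intro continuous_on_diff continuous_on_compose2[OF ramp_continuous[of _ UNIV]] continuous_intros) auto
    fix X
    have "\<bar>ramp 1 y - ramp a (y - x)\<bar> \<le> 1" "\<bar>y\<bar> > X + a + 1 \<Longrightarrow> ramp 1 y - ramp a (y - x) = 0" if "\<bar>x\<bar> \<le> X" for x y
    proof -
      show "\<bar>ramp 1 y - ramp a (y - x)\<bar> \<le> 1" using ramp_bounds[of 1 y] ramp_bounds[OF a, of "y - x"] by auto
      show "ramp 1 y - ramp a (y - x) = 0" if "\<bar>y\<bar> > X + a + 1"
        by (rule ramp_pair_support[OF a]) (use that \<open>\<bar>x\<bar> \<le> X\<close> in \<open>unfold atLeastAtMost_iff, linarith\<close>)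
    qed
    then show "\<exists>R C. \<forall>x y. \<bar>x\<bar> \<le> X \<longrightarrow> \<bar>ramp 1 y - ramp a (y - x)\<bar> \<le> C \<and> (R < \<bar>y\<bar> \<longrightarrow> ramp 1 y - ramp a (y - x) = 0)"
      by (intro exI[of _ "X + a + 1"] exI[of _ 1]) blast
  qed
  have "continuous_on UNIV drift" using drift_deriv by (meson DERIV_isCont continuous_at_imp_continuous_on)
  then have "continuous_on (UNIV \<times> {0..}) (\<lambda>p. drift (snd p))"
    by (rule continuous_on_compose2) (auto intro!: continuous_intros)
  then show ?thesis using continuous_on_diff[OF 1] by (simp add: mollified_potential_def case_prod_unfold)
qed

text \<open>Uniform limit of mollified potentials: the error \<open>2 * M * a\<close> does not
  depend on the point.\<close>

lemma potential_continuous: "continuous_on (UNIV \<times> {0..}) (\<lambda>(x, t). potential x t)"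
proof (rule uniform_limit_theorem[where F=sequentially])
  show "\<forall>\<^sub>F n in sequentially. continuous_on (UNIV \<times> {0..}) (\<lambda>(x, t). mollified_potential (1 / real (Suc n)) x t)"
    by (intro always_eventually allI mollified_potential_continuous) auto
  show "uniform_limit (UNIV \<times> {0..}) (\<lambda>n (x, t). mollified_potential (1 / real (Suc n)) x t) (\<lambda>(x, t). potential x t) sequentially"
  proof (rule uniform_limitI)
    fix e :: real assume "e > 0"
    have "(\<lambda>n. 2 * M * (1 / real (Suc n))) \<longlonglongrightarrow> 2 * M * 0"
      by (intro tendsto_intros LIMSEQ_Suc lim_1_over_n)
    then have "\<forall>\<^sub>F n in sequentially. 2 * M * (1 / real (Suc n)) < e"
      using \<open>e > 0\<close> by (intro order_tendstoD(2)) auto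
    then show "\<forall>\<^sub>F n in sequentially. \<forall>p\<in>UNIV \<times> {0..}. dist (case p of (x, t) \<Rightarrow> mollified_potential (1 / real (Suc n)) x t) (case p of (x, t) \<Rightarrow> potential x t) < e"
    proof eventually_elim
      case (elim n)
      show ?case
      proof
        fix p :: "real \<times> real"
        obtain x t where p: "p = (x, t)" by force
        have "\<bar>mollified_potential (1 / real (Suc n)) x t - potential x t\<bar> \<le> 2 * M * (1 / real (Suc n))"
          by (rule mollified_potential_close) auto
        then show "dist (case p of (x, t) \<Rightarrow> mollified_potential (1 / real (Suc n)) x t) (case p of (x, t) \<Rightarrow> potential x t) < e"
          using elim by (simp add: p dist_real_def)
      qed
    qed
  qed
qed auto

lemma mollified_potential_time_lipschitz:
  assumes a: "a > 0" and t: "0 \<le> s" "s \<le> t" shows "\<bar>mollified_potential a x t - mollified_potential a x s\<bar> \<le> B * (t - s)"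
proof (cases "s = t")
  case False
  have "continuous_on {s..t} (\<lambda>r. (\<lambda>(x, t). mollified_potential a x t) (x, r))"
    by (rule continuous_on_compose2[OF mollified_potential_continuous[OF a]]) (use t in \<open>auto intro!: continuous_intros\<close>)
  then have "continuous_on {s..t} (mollified_potential a x)" by simp
  moreover have "(mollified_potential a x has_real_derivative - fu.mollified a x r) (at r)" if "s < r" "r < t" for r
    using mollified_potential_deriv_t[OF a, of r x] that t by simp
  ultimately obtain r where r: "s < r" "r < t" "mollified_potential a x t - mollified_potential a x s = (t - s) * - fu.mollified a x r"
    using MVT[of s t "mollified_potential a x"] False t by (metis DERIV_unique less_le real_differentiable_def)
  have "\<bar>fu.mollified a x r\<bar> * (t - s) \<le> B * (t - s)" using t by (intro mult_right_mono fu.mollified_bound a) auto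
  then show ?thesis using t unfolding r(3) by (simp add: abs_mult mult.commute)
qed simp

text \<open>The mollified potentials have this Lipschitz constant at every scale, down to time
  \<open>0\<close>.\<close>

lemma potential_time_lipschitz:
  assumes t: "0 \<le> s" "s \<le> t" shows "\<bar>potential x t - potential x s\<bar> \<le> B * (t - s)"
proof (rule field_le_epsilon)
  fix e :: real assume "e > 0"
  \<comment> \<open>Two mollification errors of \<open>2 * M * a\<close> must fit into
    \<open>e\<close>; the added \<open>1\<close> covers \<open>M = 0\<close>.\<close>
  define a where "a = e / (4 * M + 1)"
  have a: "a > 0" using \<open>e > 0\<close> bound_nonneg by (simp add: a_def)
  have "4 * M * a \<le> e" using \<open>e > 0\<close> bound_nonneg by (simp add: a_def field_simps)
  then show "\<bar>potential x t - potential x s\<bar> \<le> B * (t - s) + e"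
    using mollified_potential_close[OF a, of x t] mollified_potential_close[OF a, of x s] mollified_potential_time_lipschitz[OF a t, of x] by linarith
qed

lemma potential_increment:
  assumes "x1 \<le> x2" shows "potential x2 t - potential x1 t = (LBINT y:{x1..x2}. u y t)"
proof -
  have "potential x2 t - potential x1 t = (LBINT y. u y t * (ramp 1 y - indicator {x2..} y) - u y t * (ramp 1 y - indicator {x1..} y))"
    unfolding potential_def using potential_integrable by simp
  also have "\<dots> = (LBINT y:{x1..x2}. u y t)"
    unfolding set_lebesgue_integral_def
  proof (rule integral_cong_AE)
    \<comment> \<open>The difference of the two indicators is that of a half-open interval, which
      misses only the point \<open>x2\<close>.\<close>
    show "AE y in lborel. u y t * (ramp 1 y - indicator {x2..} y) - u y t * (ramp 1 y - indicator {x1..} y) = indicator {x1..x2} y *\<^sub>R u y t"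
      using AE_lborel_singleton[of x2] by eventually_elim (use assms in \<open>auto simp: indicator_def algebra_simps\<close>)
    show "(\<lambda>y. u y t * (ramp 1 y - indicator {x2..} y) - u y t * (ramp 1 y - indicator {x1..} y)) \<in> borel_measurable lborel"
      using potential_integrable by (intro borel_measurable_diff borel_measurable_integrable)
  qed measurable
  finally show ?thesis .
qed

end

section \<open>The potential is a viscosity supersolution\<close>

lemma continuous_on_glue_zero:
  fixes h :: "'a::topological_space \<Rightarrow> real"
  assumes "open S" "closed C" "C \<subseteq> S" and h: "continuous_on S h" "\<And>p. p \<in> S \<Longrightarrow> p \<notin> C \<Longrightarrow> h p = 0"
  shows "continuous_on UNIV (\<lambda>p. if p \<in> S then h p else 0)"
proof -
  have "continuous_on S (\<lambda>p. if p \<in> S then h p else 0)"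
    using h(1) by (subst continuous_on_cong[OF refl, of _ _ h]) auto
  moreover have "continuous_on (- C) (\<lambda>p. if p \<in> S then h p else 0)"
    using h(2) by (subst continuous_on_cong[OF refl, of _ _ "\<lambda>_. 0"]) auto
  ultimately have "continuous_on (S \<union> - C) (\<lambda>p. if p \<in> S then h p else 0)"
    using assms(1,2) by (intro continuous_on_open_Un) auto
  moreover have "S \<union> - C = UNIV" using \<open>C \<subseteq> S\<close> by auto
  ultimately show ?thesis by simp
qed

lemma open_slices:
  fixes S :: "(real \<times> real) set"
  assumes "open S" shows "open {x. (x, t) \<in> S}" "open {t. (x, t) \<in> S}"
proof -
  have "continuous_on UNIV (\<lambda>x::real. (x, t))" "continuous_on UNIV (\<lambda>t::real. (x, t))"
    by (intro continuous_intros)+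
  then show "open {x. (x, t) \<in> S}" "open {t. (x, t) \<in> S}"
    using open_vimage[of S "\<lambda>x. (x, t)"] open_vimage[of S "\<lambda>t. (x, t)"] assms by (auto simp: vimage_def)
qed

text \<open>The open sets \<open>S\<close> and \<open>- C\<close> cover the plane: on the first the
  glued function is \<open>h\<close>, on the second it is zero.\<close>

lemma C1_test_glue:
  assumes S: "open S" and C: "C = cbox (x1, t1) (x2, t2)" "C \<subseteq> S" and "t1 > 0"
    and c: "continuous_on S h" "continuous_on S hx" "continuous_on S ht"
    and dx: "\<And>x t. (x, t) \<in> S \<Longrightarrow> ((\<lambda>x. h (x, t)) has_real_derivative hx (x, t)) (at x)"
    and dt: "\<And>x t. (x, t) \<in> S \<Longrightarrow> ((\<lambda>t. h (x, t)) has_real_derivative ht (x, t)) (at t)"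
    and z: "\<And>p. p \<in> S \<Longrightarrow> p \<notin> C \<Longrightarrow> h p = 0 \<and> hx p = 0 \<and> ht p = 0"
  shows "C1_test (\<lambda>p. if p \<in> S then h p else 0) (\<lambda>p. if p \<in> S then hx p else 0) (\<lambda>p. if p \<in> S then ht p else 0)"
proof -
  have clC: "closed C" unfolding C(1) by (rule closed_cbox)
  let ?h = "\<lambda>p. if p \<in> S then h p else 0"
  have "((\<lambda>x. ?h (x, t)) has_real_derivative (if (x, t) \<in> S then hx (x, t) else 0)) (at x)" for x t
  proof (cases "(x, t) \<in> S")
    case True
    have "((\<lambda>x. ?h (x, t)) has_real_derivative hx (x, t)) (at x)"
      by (rule has_field_derivative_transform_within_open[OF dx[OF True] open_slices(1)[OF S, of t]]) (use True in auto)
    then show ?thesis using True by simp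
  next
    case False
    have "((\<lambda>x. ?h (x, t)) has_real_derivative 0) (at x)"
      by (rule has_field_derivative_transform_within_open[OF DERIV_const open_slices(1)[of "- C" t]])
         (use False clC C z in auto)
    then show ?thesis using False by simp
  qed
  moreover have "((\<lambda>t. ?h (x, t)) has_real_derivative (if (x, t) \<in> S then ht (x, t) else 0)) (at t)" for x t
  proof (cases "(x, t) \<in> S")
    case True
    have "((\<lambda>t. ?h (x, t)) has_real_derivative ht (x, t)) (at t)"
      by (rule has_field_derivative_transform_within_open[OF dt[OF True] open_slices(2)[OF S, of x]]) (use True in auto)
    then show ?thesis using True by simp
  next
    case False
    have "((\<lambda>t. ?h (x, t)) has_real_derivative 0) (at t)"
      by (rule has_field_derivative_transform_within_open[OF DERIV_const open_slices(2)[of "- C" x]])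
         (use False clC C z in auto)
    then show ?thesis using False by simp
  qed
  moreover have "?h p = 0" if "p \<notin> cbox (- max \<bar>x1\<bar> (max \<bar>x2\<bar> \<bar>t2\<bar>), t1) (max \<bar>x1\<bar> (max \<bar>x2\<bar> \<bar>t2\<bar>), max \<bar>x1\<bar> (max \<bar>x2\<bar> \<bar>t2\<bar>))" for p
  proof -
    have "p \<notin> C" using that unfolding C(1) by (cases p) auto
    then show ?thesis using z by auto
  qed
  moreover note continuous_on_glue_zero[OF S clC C(2) c(1)] continuous_on_glue_zero[OF S clC C(2) c(2)] continuous_on_glue_zero[OF S clC C(2) c(3)]
  ultimately show ?thesis
    unfolding C1_test_def using z \<open>t1 > 0\<close> by blast
qed

context bounded_entropy_solution
begin

abbreviation u2 :: "real \<times> real \<Rightarrow> real" where "u2 p \<equiv> u (fst p) (snd p)"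

lemma mollified_continuous_on:
  assumes "a > 0" "S \<subseteq> UNIV \<times> {0..}"
  shows "continuous_on S (\<lambda>p. mollified a (fst p) (snd p))" "continuous_on S (\<lambda>p. fu.mollified a (fst p) (snd p))"
    "continuous_on S (\<lambda>p. mollified_potential a (fst p) (snd p))" "continuous_on S (\<lambda>p. potential (fst p) (snd p))"
  using mollified_continuous[OF assms(1)] fu.mollified_continuous[OF assms(1)] mollified_potential_continuous[OF assms(1)] potential_continuous
    continuous_on_subset[OF _ assms(2)] by (auto simp: case_prod_unfold)

text \<open>Rests on \<open>sgn s * s = |s|\<close> for \<open>s = uv - k\<close>. It trades the
  irregular gradient \<open>(uv, - fv)\<close> of the potential for the constant vector
  \<open>(k, - fk)\<close>, so that only the continuous derivatives \<open>px\<close> and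
  \<open>pt\<close> remain to be compared with constants.\<close>

lemma entropy_integrand_identity:
  fixes uv fv fk k px pt :: real
  shows "\<bar>uv - k\<bar> * (- fv - pt) + sgn (uv - k) * (fv - fk) * (uv - px)
       = \<bar>uv - k\<bar> * (- fk - pt) + sgn (uv - k) * (fv - fk) * (k - px)"
  by (cases "uv - k" "0::real" rule: linorder_cases) (auto simp: sgn_if algebra_simps)

text \<open>A strict minimum of the potential minus a strict subsolution \<open>\<Phi>\<close> forces \<open>u\<close> to be constant
  nearby: the entropy inequality for the constant \<open>k\<close> is tested with \<open>((\<eta> - (potential - \<Phi>))\<^sub>+)\<^sup>2\<close>, and the
  leading terms cancel because the gradient of the potential is \<open>(u, - f(u))\<close>.\<close>

lemma locally_constant_near_strict_min:
  assumes \<rho>: "\<rho> > 0" "\<rho> < t0" and S: "S = {x0 - \<rho><..<x0 + \<rho>} \<times> {t0 - \<rho><..<t0 + \<rho>}"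
    and c: "continuous_on S \<Phi>" "continuous_on S \<Phi>x" "continuous_on S \<Phi>t"
    and dx: "\<And>x t. (x, t) \<in> S \<Longrightarrow> ((\<lambda>x. \<Phi> (x, t)) has_real_derivative \<Phi>x (x, t)) (at x)"
    and dt: "\<And>x t. (x, t) \<in> S \<Longrightarrow> ((\<lambda>t. \<Phi> (x, t)) has_real_derivative \<Phi>t (x, t)) (at t)"
    and \<gamma>: "\<gamma> > 0" and L: "L \<ge> 0" "\<And>z. \<bar>z\<bar> \<le> M \<Longrightarrow> \<bar>f z - f k\<bar> \<le> L * \<bar>z - k\<bar>"
    and sub: "\<And>p. p \<in> S \<Longrightarrow> \<Phi>t p + f k + L * \<bar>\<Phi>x p - k\<bar> \<le> - \<gamma>"
    and strict: "\<And>x t. (x, t) \<in> S \<Longrightarrow> potential x t - \<Phi> (x, t) \<ge> potential x0 t0 - \<Phi> (x0, t0) + ((x - x0)\<^sup>2 + (t - t0)\<^sup>2)"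
  obtains \<sigma> where "\<sigma> > 0" "\<sigma> < \<rho>"
    "(LBINT p. indicator (cbox (x0 - \<sigma>, t0 - \<sigma>) (x0 + \<sigma>, t0 + \<sigma>)) p * \<bar>u2 p - k\<bar>) = 0"
proof -
  define Dm where "Dm = potential x0 t0 - \<Phi> (x0, t0)"
  \<comment> \<open>Off \<open>C\<close> the squared distance is at least
    \<open>\<rho>\<^sup>2 / 4 = 2 * \<eta>\<close>. One \<open>\<eta>\<close> is the height of the
    cut-off, the other leaves room for the mollification error \<open>\<eta> / 2\<close>.\<close>
  define \<eta> where "\<eta> = \<rho>\<^sup>2 / 8"
  have \<eta>: "\<eta> > 0" using \<rho> by (simp add: \<eta>_def)
  define C where "C = cbox (x0 - \<rho>/2, t0 - \<rho>/2) (x0 + \<rho>/2, t0 + \<rho>/2)"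
  have Sopen: "open S" unfolding S by (intro open_Times) auto
  have memS: "(x, t) \<in> S \<longleftrightarrow> \<bar>x - x0\<bar> < \<rho> \<and> \<bar>t - t0\<bar> < \<rho>" for x t
    by (auto simp: S abs_less_iff)
  have memC: "(x, t) \<in> C \<longleftrightarrow> \<bar>x - x0\<bar> \<le> \<rho>/2 \<and> \<bar>t - t0\<bar> \<le> \<rho>/2" for x t
    by (auto simp: C_def abs_if split: if_splits)
  have CS: "C \<subseteq> S" using \<rho> by (auto simp: memS memC)
  have p0S: "(x0, t0) \<in> S" using \<rho> by (simp add: memS)
  have Spos: "S \<subseteq> UNIV \<times> {0<..}" using \<rho> by (auto simp: memS)
  then have Snn: "S \<subseteq> UNIV \<times> {0..}" by force
  define D where "D p = potential (fst p) (snd p) - \<Phi> p" for p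
  have Dc: "continuous_on S D" unfolding D_def by (intro continuous_on_diff mollified_continuous_on(4)[OF zero_less_one Snn] c)
  have Dlow: "D p \<ge> Dm" if "p \<in> S" for p
    using strict[of "fst p" "snd p"] that by (cases p) (auto simp: D_def Dm_def intro: order_trans[rotated])
  have Dfar: "D p \<ge> Dm + 2 * \<eta>" if "p \<in> S" "p \<notin> C" for p
  proof -
    obtain x t where p: "p = (x, t)" by force
    have "\<bar>x - x0\<bar> > \<rho>/2 \<or> \<bar>t - t0\<bar> > \<rho>/2" using that by (auto simp: p memC)
    then have "(\<rho>/2)\<^sup>2 \<le> \<bar>x - x0\<bar>\<^sup>2 \<or> (\<rho>/2)\<^sup>2 \<le> \<bar>t - t0\<bar>\<^sup>2"
      using \<rho> power_mono[of "\<rho>/2" "\<bar>x - x0\<bar>" 2] power_mono[of "\<rho>/2" "\<bar>t - t0\<bar>" 2] by linarith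
    then have "(\<rho>/2)\<^sup>2 \<le> (x - x0)\<^sup>2 + (t - t0)\<^sup>2" by (auto intro: add_increasing add_increasing2)
    then show ?thesis using strict[of x t] that by (simp add: p D_def Dm_def \<eta>_def power_divide)
  qed
  \<comment> \<open>On this smaller box the cut-off stays at least \<open>\<eta> / 4\<close>, the
    mollification error included.\<close>
  obtain \<sigma> where \<sigma>: "\<sigma> > 0" "\<sigma> < \<rho>/2" "\<And>x t. \<bar>x - x0\<bar> \<le> \<sigma> \<Longrightarrow> \<bar>t - t0\<bar> \<le> \<sigma> \<Longrightarrow> D (x, t) \<le> Dm + \<eta> / 4"
  proof -
    have "isCont D (x0, t0)" using Dc Sopen p0S by (simp add: continuous_on_eq_continuous_at)
    then obtain d where d: "d > 0" "\<And>p. dist p (x0, t0) < d \<Longrightarrow> dist (D p) (D (x0, t0)) < \<eta> / 4"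
      using \<eta> unfolding continuous_at_eps_delta by (metis divide_pos_pos zero_less_numeral)
    define \<sigma> where "\<sigma> = min (d / 4) (\<rho> / 4)"
    have "D (x, t) \<le> Dm + \<eta> / 4" if "\<bar>x - x0\<bar> \<le> \<sigma>" "\<bar>t - t0\<bar> \<le> \<sigma>" for x t
    proof -
      have "dist (x, t) (x0, t0) \<le> \<bar>x - x0\<bar> + \<bar>t - t0\<bar>"
        using sqrt_sum_squares_le_sum_abs[of "x - x0" "t - t0"] by (simp add: dist_Pair_Pair dist_real_def)
      then have "dist (x, t) (x0, t0) < d" using that d(1) by (auto simp: \<sigma>_def)
      from d(2)[OF this] have "\<bar>D (x, t) - Dm\<bar> < \<eta> / 4" by (simp add: dist_real_def D_def Dm_def)
      then show ?thesis by linarith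
    qed
    then show thesis using d \<rho> that[of \<sigma>] by (auto simp: \<sigma>_def)
  qed
  define C0 where "C0 = cbox (x0 - \<sigma>, t0 - \<sigma>) (x0 + \<sigma>, t0 + \<sigma>)"
  have memC0: "(x, t) \<in> C0 \<longleftrightarrow> \<bar>x - x0\<bar> \<le> \<sigma> \<and> \<bar>t - t0\<bar> \<le> \<sigma>" for x t
    by (auto simp: C0_def abs_if split: if_splits)
  have C0C: "C0 \<subseteq> C" using \<sigma> by (auto simp: memC memC0)
  define K where "K = M + \<bar>k\<bar>"
  have K: "K \<ge> 0" "\<bar>u x t - k\<bar> \<le> K" for x t using bound_nonneg bound[of x t] by (auto simp: K_def)
  define X where "X = \<bar>x0\<bar> + \<rho>"
  define T where "T = t0 + \<rho>"
  have CX: "C \<subseteq> cbox (-X, 0) (X, T)"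
  proof
    fix p assume "p \<in> C"
    moreover obtain x t where p: "p = (x, t)" by force
    ultimately have "\<bar>x - x0\<bar> \<le> \<rho>/2" "\<bar>t - t0\<bar> \<le> \<rho>/2" by (simp_all only: memC)
    then have "-X \<le> x" "x \<le> X" "0 \<le> t" "t \<le> T" using \<rho> unfolding X_def T_def by linarith+
    then show "p \<in> cbox (-X, 0) (X, T)" by (simp add: p)
  qed
  \<comment> \<open>Pointwise mollification error inside a fixed box, needed for \<open>u\<close>
    and for \<open>f(u)\<close>; its integral tends to zero by \<open>mollified_L1\<close>.\<close>
  define E where "E q a p = indicator (cbox (-X, 0) (X, T)) p * \<bar>L1_continuous.mollified q a (fst p) (snd p) - q (fst p) (snd p)\<bar>"
    for q :: "real \<Rightarrow> real \<Rightarrow> real" and a and p :: "real \<times> real"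
  let ?F = "\<lambda>x t. f (u x t)"
  \<comment> \<open>The tested inequality at a fixed scale. All terms carry a factor
    \<open>\<eta>\<close>, which is divided out, and the right-hand side vanishes as
    \<open>a\<close> tends to zero.\<close>
  have main: "\<gamma> / 2 * (LBINT p. indicator C0 p * \<bar>u2 p - k\<bar>)
      \<le> 3 * K * (LBINT p. E ?F a p) + 3 * (L * K) * (LBINT p. E u a p)"
    if a: "a > 0" "2 * M * a \<le> \<eta> / 2" for a
  proof -
    define Da where "Da p = mollified_potential a (fst p) (snd p) - \<Phi> p" for p
    have Da: "Da p \<le> D p + \<eta> / 2" "D p \<le> Da p + \<eta> / 2" for p
      using mollified_potential_close[OF a(1), of "fst p" "snd p"] a(2) unfolding Da_def D_def by linarith+
    have Dac: "continuous_on S Da" unfolding Da_def by (intro continuous_on_diff mollified_continuous_on(3)[OF a(1) Snn] c)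
    define w where "w p = max 0 (Dm + \<eta> - Da p)" for p
    have wc: "continuous_on S w" unfolding w_def by (intro continuous_intros Dac)
    have w0: "w p = 0" if "p \<in> S" "p \<notin> C" for p using Dfar[OF that] Da[of p] \<eta> unfolding w_def by linarith
    define hx where "hx p = - 2 * w p * (mollified a (fst p) (snd p) - \<Phi>x p)" for p
    define ht where "ht p = - 2 * w p * (- fu.mollified a (fst p) (snd p) - \<Phi>t p)" for p
    \<comment> \<open>Differentiability at zero is the reason for squaring the positive
      part.\<close>
    have sq: "((\<lambda>s. (max 0 s)\<^sup>2) has_real_derivative 2 * max 0 s) (at s)" for s :: real
    proof (cases s "0::real" rule: linorder_cases)
      case less
      have "((\<lambda>s. 0) has_real_derivative 2 * max 0 s) (at s)" using less by simp
      then show ?thesis by (rule has_field_derivative_transform_within_open[of _ _ _ "{..<0}"]) (use less in auto)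
    next
      case greater
      have "((\<lambda>s. s\<^sup>2) has_real_derivative 2 * max 0 s) (at s)" using greater by (auto intro!: derivative_eq_intros)
      then show ?thesis by (rule has_field_derivative_transform_within_open[of _ _ _ "{0<..}"]) (use greater in auto)
    next
      case equal
      have "((\<lambda>h. (max 0 h)\<^sup>2 / h) \<longlongrightarrow> 0) (at (0::real))"
      proof (rule Lim_null_comparison)
        show "\<forall>\<^sub>F h in at (0::real). norm ((max 0 h)\<^sup>2 / h) \<le> \<bar>h\<bar>"
          by (intro always_eventually allI) (auto simp: max_def power2_eq_square)
        show "((\<lambda>h. \<bar>h\<bar>) \<longlongrightarrow> 0) (at (0::real))" by (auto intro!: tendsto_eq_intros)
      qed
      then show ?thesis using equal by (simp add: DERIV_def)
    qed
    have test: "C1_test (\<lambda>p. if p \<in> S then (w p)\<^sup>2 else 0) (\<lambda>p. if p \<in> S then hx p else 0) (\<lambda>p. if p \<in> S then ht p else 0)"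
    proof (rule C1_test_glue[OF Sopen C_def CS])
      show "t0 - \<rho>/2 > 0" using \<rho> by simp
      show "continuous_on S (\<lambda>p. (w p)\<^sup>2)" "continuous_on S hx" "continuous_on S ht"
        unfolding hx_def ht_def by (intro continuous_intros wc c mollified_continuous_on[OF a(1) Snn])+
      show "(w p)\<^sup>2 = 0 \<and> hx p = 0 \<and> ht p = 0" if "p \<in> S" "p \<notin> C" for p using w0[OF that] by (simp add: hx_def ht_def)
      fix x t assume xt: "(x, t) \<in> S"
      have "((\<lambda>x. Dm + \<eta> - Da (x, t)) has_real_derivative - (mollified a x t - \<Phi>x (x, t))) (at x)"
        unfolding Da_def using DERIV_diff[OF DERIV_const[of "Dm + \<eta>"] DERIV_diff[OF mollified_potential_deriv_x[OF a(1), of t x] dx[OF xt]]] by simp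
      from DERIV_chain2[OF sq this]
      show "((\<lambda>x. (w (x, t))\<^sup>2) has_real_derivative hx (x, t)) (at x)"
        unfolding w_def hx_def by (rule DERIV_cong) (simp add: algebra_simps)
      have "t > 0" using Spos xt by auto
      have "((\<lambda>t. Dm + \<eta> - Da (x, t)) has_real_derivative - (- fu.mollified a x t - \<Phi>t (x, t))) (at t)"
        unfolding Da_def using DERIV_diff[OF DERIV_const[of "Dm + \<eta>"] DERIV_diff[OF mollified_potential_deriv_t[OF a(1) \<open>t > 0\<close>, of x] dt[OF xt]]] by simp
      from DERIV_chain2[OF sq this]
      show "((\<lambda>t. (w (x, t))\<^sup>2) has_real_derivative ht (x, t)) (at t)"
        unfolding w_def ht_def by (rule DERIV_cong) (simp add: algebra_simps)
    qed
    have ent: "0 \<le> (LBINT p. \<bar>u2 p - k\<bar> * (if p \<in> S then ht p else 0)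
        + sgn (u2 p - k) * (f (u2 p) - f k) * (if p \<in> S then hx p else 0))"
      by (rule entropy[OF test]) auto
    have Eint: "integrable lborel (E q a)" if "L1_continuous q Q" for q Q
    proof -
      interpret q: L1_continuous q Q by fact
      note [measurable] = q.meas q.mollified_measurable[OF a(1)]
      have "\<bar>q.mollified a x t - q x t\<bar> \<le> 2 * Q" for x t
        using q.mollified_bound[OF a(1), of x t] q.bound[of x t] by linarith
      then show ?thesis unfolding E_def using q.bound_nonneg
        by (intro integrable_bounded_cbox[of _ "2 * Q" "(-X, 0)" "(X, T)"]) (measurable, auto simp: indicator_def)
    qed
    have C0int: "integrable lborel (\<lambda>p. indicator C0 p * \<bar>u2 p - k\<bar>)"
    proof (rule integrable_bounded_cbox)
      note [measurable] = meas
      show "(\<lambda>p. indicator C0 p * \<bar>u2 p - k\<bar>) \<in> borel_measurable borel" unfolding C0_def by measurable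
    qed (use K in \<open>auto simp: indicator_def C0_def\<close>)
    \<comment> \<open>The coefficients come from \<open>w p \<ge> \<eta> / 4\<close> on
      \<open>C0\<close> and \<open>w p \<le> 3 / 2 * \<eta>\<close> on \<open>C\<close>, each with
      the factor \<open>2\<close> from differentiating the square.\<close>
    define rhs where "rhs p = - (\<gamma> * \<eta> / 2) * (indicator C0 p * \<bar>u2 p - k\<bar>) + (3 * \<eta> * K * E ?F a p + 3 * \<eta> * (L * K) * E u a p)" for p
    have rint: "integrable lborel rhs"
      unfolding rhs_def by (intro Bochner_Integration.integrable_add integrable_mult_right C0int Eint[OF fu.L1_continuous_axioms] Eint[OF L1_continuous_axioms])
    have pw: "\<bar>u2 p - k\<bar> * (if p \<in> S then ht p else 0)
        + sgn (u2 p - k) * (f (u2 p) - f k) * (if p \<in> S then hx p else 0) \<le> rhs p" for p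
    proof (cases "p \<in> C")
      case False
      then have "p \<notin> C0" using C0C by auto
      moreover have "E q a p \<ge> 0" for q by (simp add: E_def)
      ultimately have "rhs p \<ge> 0" using \<eta> K(1) L(1) by (auto simp: rhs_def intro!: add_nonneg_nonneg mult_nonneg_nonneg)
      moreover have "p \<in> S \<Longrightarrow> ht p = 0 \<and> hx p = 0" using w0 False by (simp add: ht_def hx_def)
      ultimately show ?thesis by auto
    next
      case True
      then have pS: "p \<in> S" and pX: "p \<in> cbox (-X, 0) (X, T)" using CS CX by auto
      define uv where "uv = u2 p"
      define ua where "ua = mollified a (fst p) (snd p)"
      define fa where "fa = fu.mollified a (fst p) (snd p)"
      define s where "s = sgn (uv - k) * (f uv - f k)"
      have uvM: "\<bar>uv\<bar> \<le> M" using bound by (simp add: uv_def)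
      have sabs: "\<bar>s\<bar> \<le> L * \<bar>uv - k\<bar>"
        using L(2)[OF uvM] by (auto simp: s_def abs_mult sgn_if)
      have uK: "\<bar>uv - k\<bar> \<le> K" using K by (simp add: uv_def)
      have Ea: "E ?F a p = \<bar>fa - f uv\<bar>" "E u a p = \<bar>ua - uv\<bar>"
        using pX by (simp_all add: E_def fa_def ua_def uv_def)
      have wb: "w p \<ge> 0" "w p \<le> 3 / 2 * \<eta>" using Dlow[OF pS] Da[of p] \<eta> unfolding w_def by linarith+
      have "\<bar>uv - k\<bar> * ht p + s * hx p
          = - 2 * w p * (\<bar>uv - k\<bar> * (- f uv - \<Phi>t p) + s * (uv - \<Phi>x p)) - 2 * w p * (\<bar>uv - k\<bar> * (f uv - fa) + s * (ua - uv))"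
        by (simp add: ht_def hx_def ua_def[symmetric] fa_def[symmetric] algebra_simps)
      also have "\<bar>uv - k\<bar> * (- f uv - \<Phi>t p) + s * (uv - \<Phi>x p) = \<bar>uv - k\<bar> * (- f k - \<Phi>t p) + s * (k - \<Phi>x p)"
        unfolding s_def by (rule entropy_integrand_identity)
      finally have eq: "\<bar>uv - k\<bar> * ht p + s * hx p
          = - 2 * w p * (\<bar>uv - k\<bar> * (- f k - \<Phi>t p) + s * (k - \<Phi>x p)) - 2 * w p * (\<bar>uv - k\<bar> * (f uv - fa) + s * (ua - uv))" .
      \<comment> \<open>The slope error \<open>\<Phi>x p - k\<close> is absorbed by the Lipschitz
        bound on the flux, since both terms are proportional to \<open>|uv - k|\<close>; the
        strictness \<open>\<gamma>\<close> is what is left.\<close>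
      have "\<gamma> * \<bar>uv - k\<bar> \<le> \<bar>uv - k\<bar> * (- f k - \<Phi>t p) + s * (k - \<Phi>x p)"
      proof -
        have "\<bar>s * (k - \<Phi>x p)\<bar> \<le> L * \<bar>uv - k\<bar> * \<bar>\<Phi>x p - k\<bar>"
          unfolding abs_mult abs_minus_commute[of k] by (intro mult_right_mono sabs) auto
        moreover have "\<gamma> * \<bar>uv - k\<bar> \<le> (- f k - \<Phi>t p - L * \<bar>\<Phi>x p - k\<bar>) * \<bar>uv - k\<bar>"
          using sub[OF pS] by (intro mult_right_mono) auto
        ultimately show ?thesis by (simp add: algebra_simps abs_le_iff)
      qed
      then have 1: "- 2 * w p * (\<bar>uv - k\<bar> * (- f k - \<Phi>t p) + s * (k - \<Phi>x p)) \<le> - 2 * w p * (\<gamma> * \<bar>uv - k\<bar>)"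
        using wb(1) by (simp add: mult_left_mono)
      have 2: "- 2 * w p * (\<gamma> * \<bar>uv - k\<bar>) \<le> - (\<gamma> * \<eta> / 2) * (indicator C0 p * \<bar>uv - k\<bar>)"
      proof (cases "p \<in> C0")
        case True
        obtain x t where p: "p = (x, t)" by force
        have "D p \<le> Dm + \<eta> / 4" using \<sigma>(3)[of x t] True by (simp add: p memC0)
        then have "w p \<ge> \<eta> / 4" using Da[of p] unfolding w_def by linarith
        then have "\<eta> / 4 * (\<gamma> * \<bar>uv - k\<bar>) \<le> w p * (\<gamma> * \<bar>uv - k\<bar>)" using \<gamma> by (intro mult_right_mono) auto
        then show ?thesis using True by (simp add: algebra_simps)
      next
        case False
        then show ?thesis using wb(1) \<gamma> by simp
      qed
      have 3: "- 2 * w p * (\<bar>uv - k\<bar> * (f uv - fa) + s * (ua - uv)) \<le> 3 * \<eta> * K * E ?F a p + 3 * \<eta> * (L * K) * E u a p"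
      proof -
        have "\<bar>\<bar>uv - k\<bar> * (f uv - fa)\<bar> \<le> K * \<bar>fa - f uv\<bar>"
          unfolding abs_mult abs_minus_commute[of "f uv"] using uK by (intro mult_right_mono) auto
        moreover have "\<bar>s * (ua - uv)\<bar> \<le> (L * K) * \<bar>ua - uv\<bar>"
          unfolding abs_mult using order_trans[OF sabs mult_left_mono[OF uK L(1)]] by (intro mult_right_mono) auto
        ultimately have b: "- (\<bar>uv - k\<bar> * (f uv - fa) + s * (ua - uv)) \<le> K * \<bar>fa - f uv\<bar> + (L * K) * \<bar>ua - uv\<bar>"
          by linarith
        have "(2 * w p) * (- (\<bar>uv - k\<bar> * (f uv - fa) + s * (ua - uv))) \<le> (2 * w p) * (K * \<bar>fa - f uv\<bar> + (L * K) * \<bar>ua - uv\<bar>)"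
          using b wb(1) by (intro mult_left_mono) auto
        also have "\<dots> \<le> (3 * \<eta>) * (K * \<bar>fa - f uv\<bar> + (L * K) * \<bar>ua - uv\<bar>)"
          using wb K(1) L(1) by (intro mult_right_mono add_nonneg_nonneg mult_nonneg_nonneg) auto
        finally show ?thesis unfolding Ea by (simp add: algebra_simps)
      qed
      show ?thesis using eq 1 2 3 pS by (simp add: rhs_def uv_def[symmetric] s_def[symmetric])
    qed
    have "0 \<le> integral\<^sup>L lborel rhs"
    proof (rule order_trans[OF ent])
      show "(LBINT p. \<bar>u2 p - k\<bar> * (if p \<in> S then ht p else 0)
        + sgn (u2 p - k) * (f (u2 p) - f k) * (if p \<in> S then hx p else 0)) \<le> integral\<^sup>L lborel rhs"
      proof (rule integral_mono[OF _ rint pw])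
        note [measurable] = meas fu.meas
        have cx: "continuous_on UNIV (\<lambda>p. if p \<in> S then hx p else 0)" and ct: "continuous_on UNIV (\<lambda>p. if p \<in> S then ht p else 0)"
          using test by (auto simp: C1_test_def)
        have z: "(if p \<in> S then hx p else 0) = 0" "(if p \<in> S then ht p else 0) = 0" if "p \<notin> C" for p
          using w0 that by (auto simp: hx_def ht_def)
        have ix: "integrable lborel (\<lambda>p. if p \<in> S then hx p else 0)" and it: "integrable lborel (\<lambda>p. if p \<in> S then ht p else 0)"
          using continuous_compact_support(1)[OF cx z(1)[unfolded C_def]] continuous_compact_support(1)[OF ct z(2)[unfolded C_def]] by auto
        show "integrable lborel (\<lambda>p. \<bar>u2 p - k\<bar> * (if p \<in> S then ht p else 0)
        + sgn (u2 p - k) * (f (u2 p) - f k) * (if p \<in> S then hx p else 0))"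
        proof (intro Bochner_Integration.integrable_add integrable_mult_bounded ix it)
          fix p
          show "\<bar>\<bar>u2 p - k\<bar>\<bar> \<le> K" using K by simp
          have "\<bar>sgn (u2 p - k) * (f (u2 p) - f k)\<bar> \<le> L * \<bar>u2 p - k\<bar>"
            using L(2)[OF bound[of "fst p" "snd p"]] by (auto simp: abs_mult sgn_if)
          also have "\<dots> \<le> L * K" using K L(1) by (intro mult_left_mono) auto
          finally show "\<bar>sgn (u2 p - k) * (f (u2 p) - f k)\<bar> \<le> L * K" .
        qed measurable
      qed
    qed
    also have "integral\<^sup>L lborel rhs = - (\<gamma> * \<eta> / 2) * (LBINT p. indicator C0 p * \<bar>u2 p - k\<bar>)
        + (3 * \<eta> * K * (LBINT p. E ?F a p) + 3 * \<eta> * (L * K) * (LBINT p. E u a p))"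
      unfolding rhs_def
      by (simp only: Bochner_Integration.integral_add integral_mult_right_zero Bochner_Integration.integrable_add integrable_mult_right
          C0int Eint[OF fu.L1_continuous_axioms] Eint[OF L1_continuous_axioms])
    finally have "0 \<le> \<eta> * (- (\<gamma> / 2) * (LBINT p. indicator C0 p * \<bar>u2 p - k\<bar>)
        + (3 * K * (LBINT p. E ?F a p) + 3 * (L * K) * (LBINT p. E u a p)))"
      by (simp add: algebra_simps)
    then show ?thesis using \<eta> by (simp add: zero_le_mult_iff)
  qed
  define Z where "Z = (LBINT p. indicator C0 p * \<bar>u2 p - k\<bar>)"
  have "Z \<ge> 0" unfolding Z_def by (intro integral_nonneg_AE) auto
  moreover have "\<gamma> / 2 * Z \<le> 0"
  proof (rule LIMSEQ_le_const)
    have "(\<lambda>n. 3 * K * (LBINT p. E ?F (1 / real (Suc n)) p) + 3 * (L * K) * (LBINT p. E u (1 / real (Suc n)) p))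
        \<longlonglongrightarrow> 3 * K * 0 + 3 * (L * K) * 0"
      unfolding E_def by (intro tendsto_intros fu.mollified_L1 mollified_L1)
    then show "(\<lambda>n. 3 * K * (LBINT p. E ?F (1 / real (Suc n)) p) + 3 * (L * K) * (LBINT p. E u (1 / real (Suc n)) p)) \<longlonglongrightarrow> 0"
      by simp
    have "(\<lambda>n. 2 * M * (1 / real (Suc n))) \<longlonglongrightarrow> 2 * M * 0"
      by (intro tendsto_intros LIMSEQ_Suc lim_1_over_n)
    then have "\<forall>\<^sub>F n in sequentially. 2 * M * (1 / real (Suc n)) < \<eta> / 2"
      using \<eta> by (intro order_tendstoD(2)) auto
    then obtain N where "\<And>n. n \<ge> N \<Longrightarrow> 2 * M * (1 / real (Suc n)) < \<eta> / 2" by (auto simp: eventually_sequentially)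
    then show "\<exists>N. \<forall>n\<ge>N. \<gamma> / 2 * Z \<le> 3 * K * (LBINT p. E ?F (1 / real (Suc n)) p) + 3 * (L * K) * (LBINT p. E u (1 / real (Suc n)) p)"
      unfolding Z_def by (intro exI[of _ N] allI impI main) (auto intro: less_imp_le)
  qed
  ultimately have "Z = 0" using \<gamma> by (simp add: mult_le_0_iff)
  then show thesis using that[of \<sigma>] \<sigma> by (simp add: Z_def C0_def)
qed

text \<open>The vanishing integral gives \<open>u = k\<close> only almost everywhere in the box. The
  mollification of \<open>|u - k|\<close> at \<open>x0\<close> is nonnegative and continuous in time
  with zero integral, hence zero at every time, and the Lipschitz bound carries this over to the
  flux.\<close>

lemma smooth_flux_eq_of_locally_constant:
  assumes \<sigma>: "\<sigma> > 0" "\<sigma> < t0"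
    and zero: "(LBINT p. indicator (cbox (x0 - \<sigma>, t0 - \<sigma>) (x0 + \<sigma>, t0 + \<sigma>)) p * \<bar>u2 p - k\<bar>) = 0"
    and a: "a > 0" "a \<le> \<sigma>" and r: "\<bar>r - t0\<bar> \<le> \<sigma>"
  shows "fu.mollified a x0 r = f k"
proof -
  define K where "K = M + \<bar>k\<bar>"
  have K: "K \<ge> 0" "\<bar>u x t - k\<bar> \<le> K" for x t using bound_nonneg bound[of x t] by (auto simp: K_def)
  obtain L where L: "L > 0" "\<And>x y. \<bar>x\<bar> \<le> max M \<bar>k\<bar> \<Longrightarrow> \<bar>y\<bar> \<le> max M \<bar>k\<bar> \<Longrightarrow> \<bar>f x - f y\<bar> \<le> L * \<bar>x - y\<bar>"
    using convex_locally_lipschitz[OF f_convex] by blast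
  have d: "L1_continuous (\<lambda>x t. \<bar>u x t - k\<bar>) K"
  proof (rule L1_continuous_compose[OF L1_continuous_axioms, of "\<lambda>z. \<bar>z - k\<bar>" K 1])
    show "\<bar>\<bar>x - k\<bar>\<bar> \<le> K \<or> \<bar>x\<bar> > M" for x by (auto simp: K_def)
    show "continuous_on UNIV (\<lambda>z. \<bar>z - k\<bar>)" by (intro continuous_intros)
  qed auto
  then interpret d: L1_continuous "\<lambda>x t. \<bar>u x t - k\<bar>" K .
  obtain C where C: "C > 0" "\<And>a z. a > 0 \<Longrightarrow> mol a z \<le> C / a" using mol_le by blast
  let ?Q = "cbox (x0 - \<sigma>, t0 - \<sigma>) (x0 + \<sigma>, t0 + \<sigma>)"
  define G where "G p = indicator ?Q p * (\<bar>u2 p - k\<bar> * mol a (fst p - x0))" for p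
  note [measurable] = meas
  have molm: "(\<lambda>p::real \<times> real. mol a (fst p - x0)) \<in> borel_measurable borel"
    by (intro borel_measurable_continuous_onI continuous_on_compose2[OF mol_continuous[OF a(1), of UNIV]] continuous_intros) auto
  note [measurable] = molm
  have Gb: "0 \<le> G p" "G p \<le> C / a * (indicator ?Q p * \<bar>u2 p - k\<bar>)" for p
    using mol_nonneg[OF a(1), of "fst p - x0"] mult_left_mono[OF C(2)[OF a(1), of "fst p - x0"], of "\<bar>u2 p - k\<bar>"]
    by (auto simp: G_def indicator_def mult.commute)
  have Qint: "integrable lborel (\<lambda>p. indicator ?Q p * \<bar>u2 p - k\<bar>)"
    using K by (intro integrable_bounded_cbox[of _ K]) (measurable, auto simp: indicator_def)
  have Gint: "integrable lborel G"
  proof (rule Bochner_Integration.integrable_bound[OF integrable_mult_right[OF Qint, of "C / a"]])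
    show "G \<in> borel_measurable lborel" unfolding G_def by measurable
    show "AE p in lborel. norm (G p) \<le> norm (C / a * (indicator ?Q p * \<bar>u2 p - k\<bar>))"
    proof (rule AE_I2)
      fix p show "norm (G p) \<le> norm (C / a * (indicator ?Q p * \<bar>u2 p - k\<bar>))"
        unfolding real_norm_def using Gb[of p] by linarith
    qed
  qed
  have "integral\<^sup>L lborel G \<le> C / a * 0"
    unfolding zero[symmetric] integral_mult_right_zero[symmetric]
    by (rule integral_mono[OF Gint integrable_mult_right[OF Qint] Gb(2)])
  moreover have "integral\<^sup>L lborel G \<ge> 0" by (intro integral_nonneg_AE AE_I2 Gb)
  ultimately have G0: "integral\<^sup>L lborel G = 0" by simp
  have Gpair: "integrable (lborel \<Otimes>\<^sub>M lborel) (\<lambda>(x, t). G (x, t))" using Gint by (simp add: lborel_prod)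
  \<comment> \<open>Since \<open>a \<le> \<sigma>\<close>, the kernel at \<open>x0\<close> is
    supported inside the box and the cut-off in space has no effect.\<close>
  have slice: "(LBINT x. G (x, t)) = indicator {t0 - \<sigma>..t0 + \<sigma>} t *\<^sub>R d.mollified a x0 t" for t
  proof -
    have "G (x, t) = indicator {t0 - \<sigma>..t0 + \<sigma>} t * (\<bar>u x t - k\<bar> * mol a (x - x0))" for x
    proof (cases "x \<in> {x0 - \<sigma>..x0 + \<sigma>}")
      case False
      then have "mol a (x - x0) = 0" using a by (intro mol_support) auto
      then show ?thesis by (simp add: G_def)
    qed (auto simp: G_def indicator_def)
    then show ?thesis by (simp add: d.mollified_def)
  qed
  have "(LBINT t. indicator {t0 - \<sigma>..t0 + \<sigma>} t *\<^sub>R d.mollified a x0 t) = 0"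
    using lborel_pair.integral_snd[OF Gpair] G0 by (simp add: slice lborel_prod)
  moreover have dc: "continuous_on {t0 - \<sigma>..t0 + \<sigma>} (\<lambda>t. d.mollified a x0 t)"
  proof -
    have "continuous_on {t0 - \<sigma>..t0 + \<sigma>} (\<lambda>t. (\<lambda>(x, t). d.mollified a x t) (x0, t))"
      by (rule continuous_on_compose2[OF d.mollified_continuous[OF a(1)]]) (use \<sigma> in \<open>auto intro!: continuous_intros\<close>)
    then show ?thesis by simp
  qed
  moreover have "set_integrable lborel {t0 - \<sigma>..t0 + \<sigma>} (\<lambda>t. d.mollified a x0 t)"
    unfolding set_integrable_def using dc by (intro borel_integrable_compact) auto
  ultimately have HI: "((\<lambda>t. d.mollified a x0 t) has_integral 0) (cbox (t0 - \<sigma>) (t0 + \<sigma>))"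
    using set_borel_integral_eq_integral[of "{t0 - \<sigma>..t0 + \<sigma>}" "\<lambda>t. d.mollified a x0 t"]
    by (auto simp: set_lebesgue_integral_def has_integral_integral)
  have dnn: "d.mollified a x0 t \<ge> 0" for t
    unfolding d.mollified_def using mol_nonneg[OF a(1)] by (intro integral_nonneg_AE AE_I2) auto
  have d0: "d.mollified a x0 r = 0"
    by (rule has_integral_0_cbox_imp_0[OF _ _ HI]) (use dc dnn \<sigma> r in \<open>auto simp: abs_le_iff\<close>)
  have i: "integrable lborel (\<lambda>y. f (u y r) * mol a (y - x0))" by (rule mol_pairing_integrable[OF a(1) _ fu.bound]) measurable
  have i2: "integrable lborel (\<lambda>y. \<bar>u y r - k\<bar> * mol a (y - x0))" by (rule mol_pairing_integrable[OF a(1) _ d.bound]) measurable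
  have m: "integrable lborel (\<lambda>y. mol a (y - x0))" "(LBINT y. mol a (y - x0)) = 1"
    using mol_has_integral[OF a(1), of x0] by (auto simp: has_bochner_integral_iff)
  have "\<bar>fu.mollified a x0 r - f k\<bar> = \<bar>LBINT y. f (u y r) * mol a (y - x0) - f k * mol a (y - x0)\<bar>"
    unfolding fu.mollified_def using i m by simp
  also have "\<dots> \<le> (LBINT y. \<bar>f (u y r) * mol a (y - x0) - f k * mol a (y - x0)\<bar>)" by (rule integral_abs_bound)
  also have "\<dots> \<le> (LBINT y. L * (\<bar>u y r - k\<bar> * mol a (y - x0)))"
  proof (rule integral_mono)
    fix y
    have "\<bar>f (u y r) - f k\<bar> * mol a (y - x0) \<le> L * \<bar>u y r - k\<bar> * mol a (y - x0)"
      using bound[of y r] by (intro mult_right_mono L mol_nonneg a) auto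
    then show "\<bar>f (u y r) * mol a (y - x0) - f k * mol a (y - x0)\<bar> \<le> L * (\<bar>u y r - k\<bar> * mol a (y - x0))"
      using mol_nonneg[OF a(1), of "y - x0"] by (simp add: left_diff_distrib[symmetric] abs_mult)
  qed (use i i2 m in auto)
  also have "\<dots> = 0" using d0 by (simp add: d.mollified_def)
  finally show ?thesis by simp
qed

text \<open>If the inequality failed, the tested entropy inequality with \<open>k\<close> the slope
  of \<open>\<phi>\<close> at the contact point would make \<open>u\<close> equal to
  \<open>k\<close> nearby. Then the potential is affine in time on the line \<open>x = x0\<close>,
  and the minimum fixes \<open>\<phi>t (x0, t0)\<close> to the value \<open>- f k\<close>, so the
  inequality holds after all.\<close>

lemma viscosity_supersolution:
  assumes r: "r > 0" "r < t0" and S: "S = {x0 - r<..<x0 + r} \<times> {t0 - r<..<t0 + r}"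
    and c: "continuous_on S \<phi>" "continuous_on S \<phi>x" "continuous_on S \<phi>t"
    and dx: "\<And>x t. (x, t) \<in> S \<Longrightarrow> ((\<lambda>x. \<phi> (x, t)) has_real_derivative \<phi>x (x, t)) (at x)"
    and dt: "\<And>x t. (x, t) \<in> S \<Longrightarrow> ((\<lambda>t. \<phi> (x, t)) has_real_derivative \<phi>t (x, t)) (at t)"
    and min: "\<And>x t. (x, t) \<in> S \<Longrightarrow> potential x t - \<phi> (x, t) \<ge> potential x0 t0 - \<phi> (x0, t0)"
  shows "\<phi>t (x0, t0) + f (\<phi>x (x0, t0)) \<ge> 0"
proof (rule ccontr)
  assume neg: "\<not> ?thesis"
  define k where "k = \<phi>x (x0, t0)"
  \<comment> \<open>Half of the defect: \<open>Q\<close> equals \<open>- 2 * \<gamma>\<close> at the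
    contact point, so by continuity it stays below \<open>- \<gamma>\<close> on a small
    square.\<close>
  define \<gamma> where "\<gamma> = - (\<phi>t (x0, t0) + f k) / 2"
  have \<gamma>: "\<gamma> > 0" using neg by (simp add: \<gamma>_def k_def)
  obtain L where L: "L > 0" "\<And>x y. \<bar>x\<bar> \<le> max M \<bar>k\<bar> \<Longrightarrow> \<bar>y\<bar> \<le> max M \<bar>k\<bar> \<Longrightarrow> \<bar>f x - f y\<bar> \<le> L * \<bar>x - y\<bar>"
    using convex_locally_lipschitz[OF f_convex] by blast
  \<comment> \<open>Subtracting the squared distance makes the minimum strict and leaves the value
    and the gradient at the contact point unchanged.\<close>
  define \<Phi> where "\<Phi> p = \<phi> p - ((fst p - x0)\<^sup>2 + (snd p - t0)\<^sup>2)" for p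
  define \<Phi>x where "\<Phi>x p = \<phi>x p - 2 * (fst p - x0)" for p
  define \<Phi>t where "\<Phi>t p = \<phi>t p - 2 * (snd p - t0)" for p
  have Sopen: "open S" unfolding S by (intro open_Times) auto
  have p0S: "(x0, t0) \<in> S" using r by (simp add: S)
  define Q where "Q p = \<Phi>t p + f k + L * \<bar>\<Phi>x p - k\<bar>" for p
  have cx: "continuous_on S \<Phi>x" and ct: "continuous_on S \<Phi>t" and c0: "continuous_on S \<Phi>"
    unfolding \<Phi>x_def \<Phi>t_def \<Phi>_def by (intro continuous_intros c)+
  have "continuous_on S Q" unfolding Q_def by (intro continuous_intros cx ct)
  then have "isCont Q (x0, t0)" using Sopen p0S by (simp add: continuous_on_eq_continuous_at)
  then obtain d where d: "d > 0" "\<And>p. dist p (x0, t0) < d \<Longrightarrow> dist (Q p) (Q (x0, t0)) < \<gamma>"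
    using \<gamma> unfolding continuous_at_eps_delta by metis
  have Q0: "Q (x0, t0) = - 2 * \<gamma>" by (simp add: Q_def \<Phi>t_def \<Phi>x_def k_def \<gamma>_def field_simps)
  define \<rho> where "\<rho> = min r (d / 2)"
  have \<rho>: "\<rho> > 0" "\<rho> \<le> r" "\<rho> \<le> d / 2" "\<rho> < t0" using r d by (auto simp: \<rho>_def)
  define S' where "S' = {x0 - \<rho><..<x0 + \<rho>} \<times> {t0 - \<rho><..<t0 + \<rho>}"
  have S'S: "S' \<subseteq> S" using \<rho> unfolding S S'_def by (intro Sigma_mono) auto
  have sub: "\<Phi>t p + f k + L * \<bar>\<Phi>x p - k\<bar> \<le> - \<gamma>" if "p \<in> S'" for p
  proof -
    obtain x t where p: "p = (x, t)" by force
    have "dist (x, t) (x0, t0) \<le> \<bar>x - x0\<bar> + \<bar>t - t0\<bar>"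
      using sqrt_sum_squares_le_sum_abs[of "x - x0" "t - t0"] by (simp add: dist_Pair_Pair dist_real_def)
    moreover have "\<bar>x - x0\<bar> < \<rho>" "\<bar>t - t0\<bar> < \<rho>" using that by (auto simp: p S'_def abs_less_iff)
    ultimately have "dist p (x0, t0) < d" using \<rho>(3) unfolding p by linarith
    from d(2)[OF this] have "\<bar>Q p - Q (x0, t0)\<bar> < \<gamma>" by (simp add: dist_real_def)
    then have "Q p \<le> - \<gamma>" using Q0 by linarith
    then show ?thesis by (simp add: Q_def)
  qed
  obtain \<sigma> where \<sigma>: "\<sigma> > 0" "\<sigma> < \<rho>"
    and zero: "(LBINT p. indicator (cbox (x0 - \<sigma>, t0 - \<sigma>) (x0 + \<sigma>, t0 + \<sigma>)) p * \<bar>u2 p - k\<bar>) = 0"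
  proof (rule locally_constant_near_strict_min[OF \<rho>(1) \<rho>(4) S'_def continuous_on_subset[OF c0 S'S]
        continuous_on_subset[OF cx S'S] continuous_on_subset[OF ct S'S] _ _ \<gamma> less_imp_le[OF L(1)] _ sub])
    show "((\<lambda>x. \<Phi> (x, t)) has_real_derivative \<Phi>x (x, t)) (at x)" if "(x, t) \<in> S'" for x t
      unfolding \<Phi>_def \<Phi>x_def using dx[of x t] that S'S by (auto intro!: derivative_eq_intros)
    show "((\<lambda>t. \<Phi> (x, t)) has_real_derivative \<Phi>t (x, t)) (at t)" if "(x, t) \<in> S'" for x t
      unfolding \<Phi>_def \<Phi>t_def using dt[of x t] that S'S by (auto intro!: derivative_eq_intros)
    show "\<bar>f z - f k\<bar> \<le> L * \<bar>z - k\<bar>" if "\<bar>z\<bar> \<le> M" for z using that by (intro L(2)) auto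
    show "potential x0 t0 - \<Phi> (x0, t0) + ((x - x0)\<^sup>2 + (t - t0)\<^sup>2) \<le> potential x t - \<Phi> (x, t)" if "(x, t) \<in> S'" for x t
      using min[of x t] that S'S by (auto simp: \<Phi>_def)
  qed blast
  have smooth_line: "mollified_potential a x0 t - mollified_potential a x0 t0 = - f k * (t - t0)" if a: "a > 0" "a \<le> \<sigma>" and t: "\<bar>t - t0\<bar> \<le> \<sigma>" for a t
  proof -
    have der: "(mollified_potential a x0 has_real_derivative - f k) (at s)" if "\<bar>s - t0\<bar> \<le> \<sigma>" for s
      using mollified_potential_deriv_t[OF a(1), of s x0] smooth_flux_eq_of_locally_constant[OF \<sigma>(1) _ zero a that] that \<sigma> \<rho> by auto
    show ?thesis
    proof (cases t t0 rule: linorder_cases)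
      case less
      then obtain z where "mollified_potential a x0 t0 - mollified_potential a x0 t = (t0 - t) * - f k"
        using MVT2[of t t0 "mollified_potential a x0" "\<lambda>_. - f k"] der t by (smt (verit, best))
      then show ?thesis by (simp add: algebra_simps)
    next
      case greater
      then obtain z where "mollified_potential a x0 t - mollified_potential a x0 t0 = (t - t0) * - f k"
        using MVT2[of t0 t "mollified_potential a x0" "\<lambda>_. - f k"] der t by (smt (verit, best))
      then show ?thesis by (simp add: algebra_simps)
    qed simp
  qed
  have line: "potential x0 t - potential x0 t0 = - f k * (t - t0)" if t: "\<bar>t - t0\<bar> \<le> \<sigma>" for t
  proof -
    have "\<bar>potential x0 t - potential x0 t0 + f k * (t - t0)\<bar> \<le> 0 + e" if "e > 0" for e
    proof -
      define a where "a = min \<sigma> (e / (4 * M + 1))"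
      have a: "a > 0" "a \<le> \<sigma>" using \<sigma> that bound_nonneg by (auto simp: a_def)
      have "4 * M * a \<le> 4 * M * (e / (4 * M + 1))" using bound_nonneg by (intro mult_left_mono) (auto simp: a_def)
      also have "\<dots> \<le> e" using that bound_nonneg by (simp add: field_simps)
      finally show ?thesis
        using smooth_line[OF a t] mollified_potential_close[OF a(1), of x0 t] mollified_potential_close[OF a(1), of x0 t0] by linarith
    qed
    then have "\<bar>potential x0 t - potential x0 t0 + f k * (t - t0)\<bar> \<le> 0" by (rule field_le_epsilon)
    then show ?thesis by simp
  qed
  \<comment> \<open>On the vertical line the potential is replaced by its affine form. The minimum
    at \<open>t0\<close> makes this derivative vanish, although it equals
    \<open>2 * \<gamma>\<close>.\<close>
  have "((\<lambda>t. potential x0 t0 - f k * (t - t0) - \<phi> (x0, t)) has_real_derivative - f k - \<phi>t (x0, t0)) (at t0)"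
    using dt[OF p0S] by (auto intro!: derivative_eq_intros)
  then have "- f k - \<phi>t (x0, t0) = 0"
  proof (rule DERIV_local_min[OF _ \<sigma>(1)], intro allI impI)
    fix t assume "\<bar>t0 - t\<bar> < \<sigma>"
    then have t: "\<bar>t - t0\<bar> \<le> \<sigma>" by linarith
    then have "t0 - r < t" "t < t0 + r" using \<sigma>(2) \<rho>(2) by linarith+
    then have "(x0, t) \<in> S" using r by (simp add: S)
    from min[OF this] line[OF t]
    show "potential x0 t0 - f k * (t0 - t0) - \<phi> (x0, t0) \<le> potential x0 t0 - f k * (t - t0) - \<phi> (x0, t)" by simp
  qed
  then show False using \<gamma> by (simp add: \<gamma>_def)
qed

end

section \<open>Comparison of potentials\<close>

text \<open>The supporting line of \<open>f\<close> at the averaged value, integrated against a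
  kernel of unit mass.\<close>

lemma (in bounded_entropy_solution) jensen_mollified:
  assumes a: "a > 0" shows "f (mollified a x t) \<le> fu.mollified a x t"
proof -
  define p where "p = mollified a x t"
  obtain m where m: "\<And>y. f y \<ge> f p + m * (y - p)" using convex_subgradient[OF f_convex] by blast
  have i1: "integrable lborel (\<lambda>y. u y t * mol a (y - x))" by (rule mol_pairing_integrable[OF a _ bound]) measurable
  have i2: "integrable lborel (\<lambda>y. f (u y t) * mol a (y - x))" by (rule mol_pairing_integrable[OF a _ fu.bound]) measurable
  have i3: "integrable lborel (\<lambda>y. mol a (y - x))" "(LBINT y. mol a (y - x)) = 1"
    using mol_has_integral[OF a, of x] by (auto simp: has_bochner_integral_iff)
  have "(LBINT y. (f p - m * p) * mol a (y - x) + m * (u y t * mol a (y - x))) \<le> (LBINT y. f (u y t) * mol a (y - x))"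
  proof (rule integral_mono)
    show "(f p - m * p) * mol a (y - x) + m * (u y t * mol a (y - x)) \<le> f (u y t) * mol a (y - x)" for y
      using mult_right_mono[OF m[of "u y t"] mol_nonneg[OF a, of "y - x"]] by (simp add: algebra_simps)
  qed (use i1 i2 i3 in auto)
  then show ?thesis using i1 i3 by (simp add: p_def mollified_def fu.mollified_def)
qed

lemma sqrt_one_plus_square_deriv:
  "((\<lambda>x. sqrt (1 + x\<^sup>2)) has_real_derivative x / sqrt (1 + x\<^sup>2)) (at x)" for x :: real
proof -
  have "1 + x\<^sup>2 > 0" by (simp add: add_pos_nonneg)
  then show ?thesis by (auto intro!: derivative_eq_intros simp: divide_simps)
qed

lemma abs_le_sqrt_one_plus_square: "\<bar>x\<bar> \<le> sqrt (1 + x\<^sup>2)" for x :: real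
  by (rule real_le_rsqrt) simp

locale entropy_solution_pair = U: bounded_entropy_solution u M f B + V: bounded_entropy_solution v M f B
  for u v :: "real \<Rightarrow> real \<Rightarrow> real" and M :: real and f :: "real \<Rightarrow> real" and B :: real
begin

text \<open>\<open>V\<close> mollified in space is a classical subsolution by Jensen's inequality, and the penalty makes
  it strict and lets the minimum be attained.\<close>

lemma penalised_comparison:
  assumes init: "\<And>x. m \<le> U.potential x 0 - V.potential x 0" and t1: "t1 > 0" and \<epsilon>: "\<epsilon> > 0"
    and L: "L > 0" "\<And>x y. \<bar>x\<bar> \<le> M + 1 \<Longrightarrow> \<bar>y\<bar> \<le> M + 1 \<Longrightarrow> \<bar>f x - f y\<bar> \<le> L * \<bar>x - y\<bar>"
    and \<delta>: "\<delta> > 0" "\<delta> \<le> L" and \<kappa>: "\<kappa> = 1 / (2 * L * (t1 + 1)\<^sup>2)"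
  shows "m - 4 * M * \<epsilon> - \<delta> * (\<kappa> * sqrt (1 + x1\<^sup>2) + 1) \<le> U.potential x1 t1 - V.potential x1 t1"
proof -
  \<comment> \<open>The time penalty \<open>\<delta> / (T - t)\<close> blows up at \<open>T\<close>
    and equals \<open>\<delta>\<close> at \<open>t1\<close>; this is the summand \<open>1\<close> in
    the claim.\<close>
  define T where "T = t1 + 1"
  have T: "T > 1" "t1 < T" using t1 by (auto simp: T_def)
  have \<kappa>0: "\<kappa> > 0" using L T by (simp add: \<kappa> T_def)
  \<comment> \<open>The origin of \<open>\<kappa>\<close>: the spatial penalty changes the flux by
    at most \<open>L * (\<delta> * \<kappa>)\<close>, which is half of
    \<open>\<delta> / T\<^sup>2\<close>, the least gain from the time penalty.\<close>
  have L\<kappa>: "L * (\<delta> * \<kappa>) = \<delta> / (2 * T\<^sup>2)" using L by (simp add: \<kappa> T_def)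
  \<comment> \<open>Keeps the perturbed slope within \<open>M + 1\<close>, where \<open>L\<close> is
    a Lipschitz constant of \<open>f\<close>.\<close>
  have \<delta>\<kappa>: "\<delta> * \<kappa> \<le> 1"
  proof -
    have "\<delta> * \<kappa> \<le> L * \<kappa>" using \<delta> \<kappa>0 by (intro mult_right_mono) auto
    also have "\<dots> = 1 / (2 * T\<^sup>2)" using L by (simp add: \<kappa> T_def)
    also have "\<dots> \<le> 1"
    proof -
      have "1 \<le> T\<^sup>2" using T by (intro one_le_power) simp
      then show ?thesis by (simp add: divide_le_eq)
    qed
    finally show ?thesis .
  qed
  define pen where "pen p = \<delta> * \<kappa> * sqrt (1 + (fst p)\<^sup>2) + \<delta> / (T - snd p)" for p
  define D where "D p = U.potential (fst p) (snd p) - V.mollified_potential \<epsilon> (fst p) (snd p) + pen p" for p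
  \<comment> \<open>A crude lower bound up to time \<open>T\<close>, from the initial inequality and
    the time Lipschitz constant \<open>B\<close> of both potentials; together with the penalty it
    makes \<open>D\<close> coercive.\<close>
  define b where "b = - (m - 2 * (B * T) - 2 * M * \<epsilon>)"
  have B0: "B \<ge> 0" using U.fu.bound_nonneg .
  have vclose: "V.mollified_potential \<epsilon> x t \<le> V.potential x t + 2 * M * \<epsilon>" "V.potential x t \<le> V.mollified_potential \<epsilon> x t + 2 * M * \<epsilon>" for x t
    using V.mollified_potential_close[OF \<epsilon>, of x t] by linarith+
  have low: "- b + pen (x, t) \<le> D (x, t)" if "0 \<le> t" "t < T" for x t
  proof -
    have "B * (t - 0) \<le> B * T" using that B0 by (intro mult_left_mono) auto
    then show ?thesis
      using U.potential_time_lipschitz[OF order_refl that(1), of x] V.potential_time_lipschitz[OF order_refl that(1), of x] init[of x] vclose(1)[of x t]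
      unfolding D_def b_def fst_conv snd_conv by linarith
  qed
  have pen0: "pen (x, t) \<ge> 0" if "t < T" for x t using \<delta> \<kappa>0 that by (simp add: pen_def)
  \<comment> \<open>Once the penalty reaches \<open>H\<close>, \<open>D\<close> exceeds its value at
    \<open>(x1, t1)\<close>. \<open>X\<close> and \<open>\<tau>\<close> mark where one of the two
    penalties alone reaches \<open>H\<close>, so a minimum over the compact box \<open>Q\<close> is
    a minimum over all admissible points.\<close>
  define H where "H = D (x1, t1) + b + 1"
  have H: "H \<ge> 1" using low[of t1 x1] pen0[of t1 x1] t1 T by (simp add: H_def)
  define X where "X = H / (\<delta> * \<kappa>)"
  define \<tau> where "\<tau> = \<delta> / H"
  have \<tau>: "\<tau> > 0" using H \<delta> by (simp add: \<tau>_def)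
  define Q where "Q = cbox (- X, 0) (X, T - \<tau>)"
  have outside: "D (x, t) > D (x1, t1)" if xt: "0 \<le> t" "t < T" "(x, t) \<notin> Q" for x t
  proof -
    have "pen (x, t) \<ge> H"
    proof (cases "\<bar>x\<bar> \<le> X")
      case False
      then have "H \<le> (\<delta> * \<kappa>) * \<bar>x\<bar>" using \<delta> \<kappa>0 unfolding X_def not_le
        by (subst (asm) pos_divide_less_eq) (auto simp: mult.commute)
      also have "\<dots> \<le> (\<delta> * \<kappa>) * sqrt (1 + x\<^sup>2)" using \<delta> \<kappa>0 by (intro mult_left_mono abs_le_sqrt_one_plus_square) auto
      also have "\<dots> \<le> pen (x, t)" using \<delta> xt by (simp add: pen_def)
      finally show ?thesis .
    next
      case True
      then have "t > T - \<tau>" using xt by (auto simp: Q_def abs_le_iff)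
      then have "H * (T - t) \<le> H * \<tau>" using H by (intro mult_left_mono) auto
      also have "H * \<tau> = \<delta>" using H by (simp add: \<tau>_def)
      finally have "H \<le> \<delta> / (T - t)" using xt by (simp add: le_divide_eq)
      also have "\<dots> \<le> pen (x, t)" using \<delta> \<kappa>0 by (simp add: pen_def)
      finally show ?thesis .
    qed
    then show ?thesis using low[OF xt(1,2), of x] by (simp add: H_def)
  qed
  have x1Q: "(x1, t1) \<in> Q" using outside[of t1 x1] t1 T by auto
  have QS: "Q \<subseteq> UNIV \<times> {0..}" by (auto simp: Q_def)
  have "continuous_on Q D"
    unfolding D_def pen_def using \<tau>
    by (intro continuous_intros U.mollified_continuous_on(4)[OF zero_less_one QS] V.mollified_continuous_on(3)[OF \<epsilon> QS]) (auto simp: Q_def)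
  then obtain p0 where p0: "p0 \<in> Q" "\<And>p. p \<in> Q \<Longrightarrow> D p0 \<le> D p"
    using continuous_attains_inf[of Q D] x1Q compact_cbox unfolding Q_def by blast
  obtain x0 t0 where p0eq: "p0 = (x0, t0)" by force
  have t0: "0 \<le> t0" "t0 < T" using p0(1) \<tau> by (auto simp: p0eq Q_def)
  have glob: "D (x0, t0) \<le> D (x, t)" if "0 \<le> t" "t < T" for x t
    using p0(2)[of "(x, t)"] p0(2)[OF x1Q] outside[OF that] unfolding p0eq by fastforce
  \<comment> \<open>The mollification error \<open>2 * M * \<epsilon>\<close> enters a second time
    here, at \<open>(x1, t1)\<close>; together they give \<open>4 * M * \<epsilon>\<close>.\<close>
  have final: ?thesis if "m - 2 * M * \<epsilon> \<le> D (x0, t0)"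
  proof -
    have "pen (x1, t1) = \<delta> * (\<kappa> * sqrt (1 + x1\<^sup>2) + 1)" by (simp add: pen_def T_def algebra_simps)
    then show ?thesis using that glob[of t1 x1] t1 T vclose(2)[of x1 t1] unfolding D_def fst_conv snd_conv by linarith
  qed
  show ?thesis
  proof (cases "t0 = 0")
    case True
    have "m - 2 * M * \<epsilon> \<le> D (x0, 0)"
      using init[of x0] vclose(1)[of x0 0] pen0[of 0 x0] T unfolding D_def fst_conv snd_conv by linarith
    then show ?thesis using final True by simp
  next
    case False
    then have t0pos: "t0 > 0" using t0 by simp
    \<comment> \<open>The square around the minimum must avoid both the initial line and the blow-up
      time \<open>T\<close>.\<close>
    define r where "r = min (t0 / 2) ((T - t0) / 2)"
    have r: "r > 0" "r < t0" "t0 + r < T" using t0pos t0 by (auto simp: r_def min_def field_simps)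
    define S where "S = {x0 - r<..<x0 + r} \<times> {t0 - r<..<t0 + r}"
    have SS: "S \<subseteq> UNIV \<times> {0..}" using r by (auto simp: S_def)
    have ST: "snd p < T" "snd p > 0" if "p \<in> S" for p using that r by (auto simp: S_def)
    define \<phi> where "\<phi> p = V.mollified_potential \<epsilon> (fst p) (snd p) - pen p" for p
    define \<phi>x where "\<phi>x p = V.mollified \<epsilon> (fst p) (snd p) - \<delta> * \<kappa> * (fst p / sqrt (1 + (fst p)\<^sup>2))" for p
    define \<phi>t where "\<phi>t p = - V.fu.mollified \<epsilon> (fst p) (snd p) - \<delta> / (T - snd p)\<^sup>2" for p
    have nz: "sqrt (1 + (x::real)\<^sup>2) \<noteq> 0" for x by (simp add: add_nonneg_eq_0_iff)
    have "\<phi>t (x0, t0) + f (\<phi>x (x0, t0)) \<ge> 0"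
    proof (rule U.viscosity_supersolution[OF r(1,2) S_def, of \<phi> \<phi>x \<phi>t])
      show "continuous_on S \<phi>" unfolding \<phi>_def pen_def
        by (intro continuous_intros V.mollified_continuous_on(3)[OF \<epsilon> SS]) (use ST in force)
      show "continuous_on S \<phi>x" unfolding \<phi>x_def
        by (intro continuous_intros V.mollified_continuous_on(1)[OF \<epsilon> SS]) (use nz in auto)
      show "continuous_on S \<phi>t" unfolding \<phi>t_def
        by (intro continuous_intros V.mollified_continuous_on(2)[OF \<epsilon> SS]) (use ST in force)
      fix x t assume xt: "(x, t) \<in> S"
      have t: "0 < t" "t < T" using ST[OF xt] by auto
      have "((\<lambda>x. V.mollified_potential \<epsilon> x t - (\<delta> * \<kappa> * sqrt (1 + x\<^sup>2) + \<delta> / (T - t))) has_real_derivative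
          V.mollified \<epsilon> x t - (\<delta> * \<kappa> * (x / sqrt (1 + x\<^sup>2)) + 0)) (at x)"
        by (intro DERIV_diff DERIV_add V.mollified_potential_deriv_x[OF \<epsilon>] DERIV_cmult sqrt_one_plus_square_deriv DERIV_const)
      then show "((\<lambda>x. \<phi> (x, t)) has_real_derivative \<phi>x (x, t)) (at x)" by (simp add: \<phi>_def \<phi>x_def pen_def)
      have "((\<lambda>t. \<delta> / (T - t)) has_real_derivative \<delta> / (T - t)\<^sup>2) (at t)"
        using t by (auto intro!: derivative_eq_intros simp: power2_eq_square)
      then have "((\<lambda>t. V.mollified_potential \<epsilon> x t - (\<delta> * \<kappa> * sqrt (1 + x\<^sup>2) + \<delta> / (T - t))) has_real_derivative
          - V.fu.mollified \<epsilon> x t - (0 + \<delta> / (T - t)\<^sup>2)) (at t)"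
        by (intro DERIV_diff DERIV_add V.mollified_potential_deriv_t[OF \<epsilon> t(1)] DERIV_const)
      then show "((\<lambda>t. \<phi> (x, t)) has_real_derivative \<phi>t (x, t)) (at t)" by (simp add: \<phi>_def \<phi>t_def pen_def)
      show "U.potential x0 t0 - \<phi> (x0, t0) \<le> U.potential x t - \<phi> (x, t)"
        using glob[of t x] t by (simp add: D_def \<phi>_def)
    qed
    \<comment> \<open>Jensen's inequality handles the slope \<open>q\<close>, the Lipschitz bound
      its perturbation by \<open>y\<close>; the time penalty outweighs the latter, against the
      supersolution property.\<close>
    moreover have "\<phi>t (x0, t0) + f (\<phi>x (x0, t0)) < 0"
    proof -
      define q where "q = V.mollified \<epsilon> x0 t0"
      define y where "y = \<delta> * \<kappa> * (x0 / sqrt (1 + x0\<^sup>2))"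
      have "\<bar>x0 / sqrt (1 + x0\<^sup>2)\<bar> \<le> 1"
      proof -
        have "1 + x0\<^sup>2 > 0" by (simp add: add_pos_nonneg)
        then show ?thesis using abs_le_sqrt_one_plus_square[of x0] by (simp add: abs_divide divide_le_eq)
      qed
      then have "\<bar>\<delta> * \<kappa>\<bar> * \<bar>x0 / sqrt (1 + x0\<^sup>2)\<bar> \<le> \<bar>\<delta> * \<kappa>\<bar> * 1" by (intro mult_left_mono) auto
      then have y: "\<bar>y\<bar> \<le> \<delta> * \<kappa>" using \<delta> \<kappa>0 by (simp add: y_def abs_mult)
      have q: "\<bar>q\<bar> \<le> M" unfolding q_def by (rule V.mollified_bound[OF \<epsilon>])
      have "\<bar>f (q - y) - f q\<bar> \<le> L * \<bar>(q - y) - q\<bar>" using q y \<delta>\<kappa> by (intro L(2)) linarith+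
      also have "\<dots> \<le> L * (\<delta> * \<kappa>)" using y L(1) by (intro mult_left_mono) auto
      finally have "f (q - y) \<le> V.fu.mollified \<epsilon> x0 t0 + \<delta> / (2 * T\<^sup>2)"
        using V.jensen_mollified[OF \<epsilon>, of x0 t0] L\<kappa> unfolding q_def by linarith
      moreover have "\<delta> / (2 * T\<^sup>2) < \<delta> / (T - t0)\<^sup>2"
      proof -
        have "(T - t0)\<^sup>2 \<le> T\<^sup>2" using t0 by (intro power_mono) auto
        moreover have "T\<^sup>2 > 0" using T by simp
        ultimately have "(T - t0)\<^sup>2 < 2 * T\<^sup>2" by linarith
        then show ?thesis using \<delta> t0 T by (intro divide_strict_left_mono) auto
      qed
      ultimately show ?thesis by (simp add: \<phi>t_def \<phi>x_def q_def y_def)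
    qed
    ultimately show ?thesis by simp
  qed
qed

text \<open>Neither \<open>\<kappa>\<close> nor the penalty factor \<open>P\<close> at the given
  point depends on \<open>\<epsilon>\<close> or \<open>\<delta>\<close>, so the mollification error
  and the penalty can each be pushed below \<open>e / 2\<close>.\<close>

lemma potential_comparison:
  assumes init: "\<And>x. m \<le> U.potential x 0 - V.potential x 0" and t: "t > 0"
  shows "m \<le> U.potential x t - V.potential x t"
proof (rule field_le_epsilon)
  fix e :: real assume e: "e > 0"
  obtain L where L: "L > 0" "\<And>x y. \<bar>x\<bar> \<le> M + 1 \<Longrightarrow> \<bar>y\<bar> \<le> M + 1 \<Longrightarrow> \<bar>f x - f y\<bar> \<le> L * \<bar>x - y\<bar>"
    using convex_locally_lipschitz[OF U.f_convex] by blast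
  define \<kappa> where "\<kappa> = 1 / (2 * L * (t + 1)\<^sup>2)"
  define P where "P = \<kappa> * sqrt (1 + x\<^sup>2) + 1"
  have P: "P \<ge> 1" using L by (simp add: P_def \<kappa>_def)
  define \<epsilon> where "\<epsilon> = e / (8 * M + 1)"
  define \<delta> where "\<delta> = min L (e / (2 * P))"
  have \<epsilon>: "\<epsilon> > 0" using e U.bound_nonneg by (simp add: \<epsilon>_def)
  have \<delta>: "\<delta> > 0" "\<delta> \<le> L" using e P L by (auto simp: \<delta>_def)
  have "4 * M * \<epsilon> \<le> e / 2" using e U.bound_nonneg by (simp add: \<epsilon>_def field_simps)
  moreover have "\<delta> * P \<le> e / 2"
  proof -
    have "\<delta> * P \<le> e / (2 * P) * P" using P by (intro mult_right_mono) (auto simp: \<delta>_def)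
    then show ?thesis using P by simp
  qed
  ultimately show "m \<le> U.potential x t - V.potential x t + e"
    using penalised_comparison[OF init t \<epsilon> L \<delta> \<kappa>_def, of x] unfolding P_def by linarith
qed

end

section \<open>Bounded Borel representatives\<close>

lemma bounded_variation_bounded:
  assumes "bounded_variation g" obtains C where "\<And>x. \<bar>g x\<bar> \<le> C"
proof -
  obtain V where V: "\<And>s n. mono (s :: nat \<Rightarrow> real) \<Longrightarrow> (\<Sum>i<n. \<bar>g (s (Suc i)) - g (s i)\<bar>) \<le> V"
    using assms unfolding bounded_variation_def by blast
  have "\<bar>g x\<bar> \<le> \<bar>g 0\<bar> + V" for x
  proof -
    \<comment> \<open>A partition with the single step from \<open>min 0 x\<close> to
      \<open>max 0 x\<close>.\<close>
    have "mono (\<lambda>i::nat. if i = 0 then min 0 x else max 0 x)" by (auto simp: mono_def)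
    from V[OF this, of 1] have "\<bar>g (max 0 x) - g (min 0 x)\<bar> \<le> V" by simp
    then show ?thesis by (cases "0 \<le> x") (auto simp: max_def min_def)
  qed
  then show thesis by (rule that)
qed

text \<open>Jordan decomposition: \<open>TV\<close> and \<open>TV - g\<close> are both nondecreasing.\<close>

lemma bounded_variation_borel:
  assumes "bounded_variation g" shows "g \<in> borel_measurable borel"
proof -
  obtain V where V: "\<And>s n. mono (s :: nat \<Rightarrow> real) \<Longrightarrow> (\<Sum>i<n. \<bar>g (s (Suc i)) - g (s i)\<bar>) \<le> V"
    using assms unfolding bounded_variation_def by blast
  \<comment> \<open>Sums over partitions that end at or before \<open>x\<close>. No left end point
    is imposed, so \<open>TV x\<close> is the variation over the whole half line up to
    \<open>x\<close>.\<close>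
  define A where "A x = {(\<Sum>i<n. \<bar>g (s (Suc i)) - g (s i)\<bar>) | s n. mono (s :: nat \<Rightarrow> real) \<and> s n \<le> x}" for x
  define TV where "TV x = Sup (A x)" for x
  have bdd: "bdd_above (A x)" for x using V by (auto simp: A_def bdd_above_def)
  have ne: "A x \<noteq> {}" for x
  proof -
    have "(\<Sum>i<0. \<bar>g ((\<lambda>_. x) (Suc i)) - g ((\<lambda>_. x) i)\<bar>) \<in> A x"
      unfolding A_def by (intro CollectI exI[of _ "\<lambda>_. x"] exI[of _ 0]) (auto simp: mono_def)
    then show ?thesis by blast
  qed
  have increment: "TV x + \<bar>g y - g x\<bar> \<le> TV y" if xy: "x \<le> y" for x y
  proof -
    have "a \<le> TV y - \<bar>g y - g x\<bar>" if "a \<in> A x" for a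
    proof -
      from that obtain s n where s: "mono (s :: nat \<Rightarrow> real)" "s n \<le> x" and a: "a = (\<Sum>i<n. \<bar>g (s (Suc i)) - g (s i)\<bar>)"
        by (auto simp: A_def)
      \<comment> \<open>The partition is continued by \<open>x\<close> and then \<open>y\<close>;
        the last step contributes \<open>|g y - g x|\<close>, and the step from \<open>s n\<close>
        to \<open>x\<close> can only add to the sum.\<close>
      define r where "r i = (if i \<le> n then s i else if i = Suc n then x else y)" for i
      have "mono r"
      proof (rule monoI)
        fix i j :: nat assume "i \<le> j"
        moreover have "s i \<le> x" if "i \<le> n" for i using monoD[OF s(1) that] s(2) by simp
        ultimately show "r i \<le> r j" using monoD[OF s(1) \<open>i \<le> j\<close>] xy by (auto simp: r_def intro: order_trans)
      qed
      have "(\<Sum>i<n. \<bar>g (r (Suc i)) - g (r i)\<bar>) = a"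
        unfolding a by (intro sum.cong refl) (auto simp: r_def)
      then have "(\<Sum>i<n + 2. \<bar>g (r (Suc i)) - g (r i)\<bar>) = a + \<bar>g x - g (s n)\<bar> + \<bar>g y - g x\<bar>"
        by (simp add: r_def)
      moreover have "(\<Sum>i<n + 2. \<bar>g (r (Suc i)) - g (r i)\<bar>) \<in> A y"
        unfolding A_def using \<open>mono r\<close> by (intro CollectI exI[of _ r] exI[of _ "n + 2"]) (auto simp: r_def)
      ultimately have "a + \<bar>g x - g (s n)\<bar> + \<bar>g y - g x\<bar> \<le> TV y"
        unfolding TV_def using cSup_upper[OF _ bdd] by metis
      then show ?thesis by linarith
    qed
    then have "TV x \<le> TV y - \<bar>g y - g x\<bar>" unfolding TV_def[of x] by (intro cSup_least ne)
    then show ?thesis by simp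
  qed
  have "mono TV" "mono (\<lambda>x. TV x - g x)"
    using increment by (auto intro!: monoI simp: abs_le_iff) (smt (verit, best))+
  then have [measurable]: "TV \<in> borel_measurable borel" "(\<lambda>x. TV x - g x) \<in> borel_measurable borel"
    by (auto intro: borel_measurable_mono)
  have "(\<lambda>x. TV x - (TV x - g x)) \<in> borel_measurable borel" by measurable
  then show ?thesis by simp
qed

text \<open>An entropy solution is replaced by its pointwise bounded representative, extended to
  \<open>t \<le> 0\<close> by the initial data.\<close>

definition clamp_real :: "real \<Rightarrow> real \<Rightarrow> real" where
  "clamp_real M z = max (- M) (min M z)"

definition representative :: "real \<Rightarrow> (real \<Rightarrow> real) \<Rightarrow> (real \<Rightarrow> real \<Rightarrow> real) \<Rightarrow> real \<Rightarrow> real \<Rightarrow> real" where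
  "representative M w0 w x t = (if t > 0 then clamp_real M (w x t) else w0 x)"

lemma entropy_solution_slice_measurable:
  assumes "entropy_solution f w0 w" "t > 0" shows "(\<lambda>x. w x t) \<in> borel_measurable borel"
proof -
  have 1: "(\<lambda>p. indicator half_plane p *\<^sub>R w (fst p) (snd p)) \<in> borel_measurable borel"
    using assms(1) by (simp add: entropy_solution_def set_borel_measurable_def)
  have "(\<lambda>x. (x, t)) \<in> borel \<rightarrow>\<^sub>M (borel :: (real \<times> real) measure)"
    by (intro borel_measurable_continuous_onI continuous_intros)
  from measurable_compose[OF this 1] show ?thesis using assms(2) by (simp add: half_plane_def)
qed

text \<open>Null sections give a null set in the plane; measurability is what permits the exchange
  of the two quantifiers. The restriction to \<open>t > 0\<close> is left to
  \<open>Q\<close>.\<close>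

lemma AE_slices_half_plane:
  assumes meas: "{p. Q (fst p) (snd p)} \<in> sets (borel :: (real \<times> real) measure)" and AE: "\<And>t. AE x in lborel. Q x t"
  shows "AE p in lborel. Q (fst p) (snd p)"
proof -
  have m: "{p \<in> space (lborel \<Otimes>\<^sub>M lborel). Q (fst p) (snd p)} \<in> sets (lborel \<Otimes>\<^sub>M (lborel :: real measure) :: (real \<times> real) measure)"
    unfolding lborel_prod using meas by simp
  have "AE t in lborel. AE x in lborel. Q x t" using AE by simp
  then have "AE x in lborel. AE t in lborel. Q x t"
    using lborel_pair.AE_commute[OF m] by simp
  then have "AE p in lborel \<Otimes>\<^sub>M lborel. Q (fst p) (snd p)"
    by (intro lborel_pair.AE_pair_measure[OF m]) simp
  then show ?thesis by (simp only: lborel_prod)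
qed

text \<open>At each \<open>t > 0\<close> the representative differs from \<open>w\<close> only on a
  null set of \<open>x\<close>, so the integrals in \<open>entropy_solution\<close> keep their
  values; for the entropy integral this needs null sections in the plane. The attainment of the data
  becomes continuity at time \<open>0\<close>.\<close>

lemma representative_entropy_solution:
  assumes w: "entropy_solution f w0 w" and f: "convex_on UNIV f" and w0: "w0 \<in> borel_measurable borel" "\<And>x. \<bar>w0 x\<bar> \<le> M"
    and bd: "\<And>t. t > 0 \<Longrightarrow> AE x in lborel. \<bar>w x t\<bar> \<le> M" and B: "\<And>x. \<bar>x\<bar> \<le> M \<Longrightarrow> \<bar>f x\<bar> \<le> B"
  shows "bounded_entropy_solution (representative M w0 w) M f B"
    and "\<And>t. t > 0 \<Longrightarrow> AE x in lborel. representative M w0 w x t = w x t"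
proof -
  define u where "u = representative M w0 w"
  have M0: "M \<ge> 0" using w0(2)[of 0] by simp
  have wm: "(\<lambda>p. indicator half_plane p *\<^sub>R w (fst p) (snd p)) \<in> borel_measurable borel"
    using w by (simp add: entropy_solution_def set_borel_measurable_def)
  have half [measurable]: "half_plane \<in> sets borel"
    by (auto simp: half_plane_def intro!: borel_open open_Times)
  have w0m: "(\<lambda>p::real \<times> real. w0 (fst p)) \<in> borel_measurable borel"
    by (rule measurable_compose[OF borel_measurable_continuous_onI w0(1)]) (intro continuous_intros)
  note [measurable] = wm w0m
  have um: "(\<lambda>p. u (fst p) (snd p)) \<in> borel_measurable borel"
  proof -
    have "(\<lambda>p. u (fst p) (snd p)) = (\<lambda>p. if p \<in> half_plane then max (- M) (min M (indicator half_plane p *\<^sub>R w (fst p) (snd p))) else w0 (fst p))"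
      by (auto simp: fun_eq_iff u_def representative_def clamp_real_def half_plane_def)
    also have "\<dots> \<in> borel_measurable borel" by measurable
    finally show ?thesis .
  qed
  have ub: "\<bar>u x t\<bar> \<le> M" for x t using w0(2)[of x] M0 by (auto simp: u_def representative_def clamp_real_def)
  have eq: "AE x in lborel. u x t = w x t" if "t > 0" for t
    using bd[OF that] by eventually_elim (use that M0 in \<open>auto simp: u_def representative_def clamp_real_def\<close>)
  then show "\<And>t. t > 0 \<Longrightarrow> AE x in lborel. representative M w0 w x t = w x t" by (simp add: u_def)
  note ws [measurable] = entropy_solution_slice_measurable[OF w]
  have us [measurable]: "(\<lambda>x. u x t) \<in> borel_measurable borel" for t
  proof -
    have "(\<lambda>x. (x, t)) \<in> borel \<rightarrow>\<^sub>M (borel :: (real \<times> real) measure)"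
      by (intro borel_measurable_continuous_onI continuous_intros)
    from measurable_compose[OF this um] show ?thesis by simp
  qed
  have u0: "u x 0 = w0 x" for x by (simp add: u_def representative_def)
  have L1: "L1_continuous u M"
  proof
    fix t R :: real assume t: "t \<ge> 0"
    show "((\<lambda>s. LBINT x:{-R..R}. \<bar>u x s - u x t\<bar>) \<longlongrightarrow> 0) (at t within {0..})"
    proof (cases "t = 0")
      case True
      have "((\<lambda>s. LBINT x:{-R..R}. \<bar>w x s - w0 x\<bar>) \<longlongrightarrow> 0) (at_right 0)"
        using w by (simp add: entropy_solution_def)
      moreover have "\<forall>\<^sub>F s in at_right 0. (LBINT x:{-R..R}. \<bar>w x s - w0 x\<bar>) = (LBINT x:{-R..R}. \<bar>u x s - u x 0\<bar>)"
        using eventually_at_right_less[of 0]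
      proof eventually_elim
        case (elim s)
        note [measurable] = ws[OF elim] w0(1)
        show ?case unfolding set_lebesgue_integral_def u0
          by (intro integral_cong_AE) (use eq[OF elim] in \<open>auto elim: eventually_mono\<close>)
      qed
      ultimately have "((\<lambda>s. LBINT x:{-R..R}. \<bar>u x s - u x 0\<bar>) \<longlongrightarrow> 0) (at_right 0)"
        by (rule Lim_transform_eventually)
      then show ?thesis using True by (simp add: at_within_Ici_at_right)
    next
      case False
      then have t: "t > 0" using t by simp
      have "((\<lambda>s. LBINT x:{-R..R}. \<bar>w x s - w x t\<bar>) \<longlongrightarrow> 0) (at t)"
        using w t by (simp add: entropy_solution_def)
      moreover have "\<forall>\<^sub>F s in at t. (LBINT x:{-R..R}. \<bar>w x s - w x t\<bar>) = (LBINT x:{-R..R}. \<bar>u x s - u x t\<bar>)"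
      proof -
        have "\<forall>\<^sub>F s in at t. s > 0"
          using order_tendstoD(1)[OF tendsto_ident_at[of t UNIV] t] .
        then show ?thesis
        proof eventually_elim
          case (elim s)
          note [measurable] = ws[OF elim] ws[OF t]
          show ?case unfolding set_lebesgue_integral_def
          proof (rule integral_cong_AE)
            show "AE x in lborel. indicator {-R..R} x *\<^sub>R \<bar>w x s - w x t\<bar> = indicator {-R..R} x *\<^sub>R \<bar>u x s - u x t\<bar>"
              using eq[OF elim] eq[OF t] by eventually_elim simp
          qed measurable
        qed
      qed
      ultimately have "((\<lambda>s. LBINT x:{-R..R}. \<bar>u x s - u x t\<bar>) \<longlongrightarrow> 0) (at t)"
        by (rule Lim_transform_eventually)
      then show ?thesis by (rule tendsto_within_subset) simp
    qed
  qed (use um ub in auto)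
  interpret u: L1_continuous u M by fact
  have fc: "continuous_on UNIV f" by (rule convex_on_UNIV_continuous[OF f])
  have fm [measurable]: "f \<in> borel_measurable borel" using fc by (rule borel_measurable_continuous_onI)
  note [measurable] = um
  have AEp: "AE p in lborel. p \<in> half_plane \<longrightarrow> u (fst p) (snd p) = w (fst p) (snd p)"
  proof -
    have "{p. snd p > 0 \<longrightarrow> u (fst p) (snd p) = w (fst p) (snd p)} =
       {p \<in> space borel. p \<in> half_plane \<longrightarrow> u (fst p) (snd p) = indicator half_plane p *\<^sub>R w (fst p) (snd p)}"
      by (auto simp: half_plane_def)
    also have "\<dots> \<in> sets borel" by measurable
    finally have "{p. snd p > 0 \<longrightarrow> u (fst p) (snd p) = w (fst p) (snd p)} \<in> sets borel" .
    then have "AE p in lborel. snd p > 0 \<longrightarrow> u (fst p) (snd p) = w (fst p) (snd p)"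
      by (rule AE_slices_half_plane) (use eq in auto)
    then show ?thesis by (simp add: half_plane_def mem_Times_iff)
  qed
  have "bounded_entropy_solution u M f B"
  proof (intro bounded_entropy_solution.intro[OF L1] bounded_entropy_solution_axioms.intro f B)
    fix \<psi> \<psi>x \<psi>t k assume \<psi>: "C1_test \<psi> \<psi>x \<psi>t" and nn: "\<And>p. 0 \<le> \<psi> p"
    let ?A = "\<lambda>p. \<bar>u (fst p) (snd p) - k\<bar>" and ?B = "\<lambda>p. sgn (u (fst p) (snd p) - k) * (f (u (fst p) (snd p)) - f k)"
    have B0: "B \<ge> 0" using B[of 0] M0 by auto
    define N where "N = max (M + \<bar>k\<bar>) (B + \<bar>f k\<bar>)"
    show "0 \<le> (LBINT p. ?A p * \<psi>t p + ?B p * \<psi>x p)"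
    proof (rule entropy_inequality_C1[of ?A N ?B, OF _ _ _ _ _ \<psi> nn])
      show "?A \<in> borel_measurable borel" "?B \<in> borel_measurable borel" by measurable
      show "\<bar>?A p\<bar> \<le> N" for p using ub[of "fst p" "snd p"] by (auto simp: N_def)
      show "\<bar>?B p\<bar> \<le> N" for p
      proof -
        have "\<bar>?B p\<bar> \<le> \<bar>f (u (fst p) (snd p)) - f k\<bar>" by (auto simp: abs_mult sgn_if)
        also have "\<dots> \<le> B + \<bar>f k\<bar>" using B[OF ub[of "fst p" "snd p"]] by linarith
        finally show ?thesis by (simp add: N_def)
      qed
      fix \<phi> assume \<phi>: "\<phi> \<in> test_functions" "\<And>p. 0 \<le> \<phi> p"
      have "Ck (Suc 0) \<phi>" using \<phi>(1) unfolding test_functions_def by blast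
      then have [measurable]: "partial_x \<phi> \<in> borel_measurable borel" "partial_t \<phi> \<in> borel_measurable borel"
        by (auto intro: borel_measurable_continuous_onI)
      have "0 \<le> (LBINT p:half_plane. \<bar>w (fst p) (snd p) - k\<bar> * partial_t \<phi> p +
               sgn (w (fst p) (snd p) - k) * (f (w (fst p) (snd p)) - f k) * partial_x \<phi> p)"
        using w \<phi> unfolding entropy_solution_def by blast
      also have "\<dots> = (LBINT p:half_plane. ?A p * partial_t \<phi> p + ?B p * partial_x \<phi> p)"
        unfolding set_lebesgue_integral_def
      proof (rule integral_cong_AE)
        \<comment> \<open>Only the extension of \<open>w\<close> by zero is known to be Borel, so
          measurability of the integrand is obtained through it.\<close>
        let ?w = "\<lambda>p. indicator half_plane p *\<^sub>R w (fst p) (snd p)"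
        have "(\<lambda>p. indicator half_plane p *\<^sub>R (\<bar>w (fst p) (snd p) - k\<bar> * partial_t \<phi> p +
               sgn (w (fst p) (snd p) - k) * (f (w (fst p) (snd p)) - f k) * partial_x \<phi> p))
           = (\<lambda>p. indicator half_plane p *\<^sub>R (\<bar>?w p - k\<bar> * partial_t \<phi> p + sgn (?w p - k) * (f (?w p) - f k) * partial_x \<phi> p))"
          by (auto simp: fun_eq_iff indicator_def)
        also have "\<dots> \<in> borel_measurable lborel" by measurable
        finally show "(\<lambda>p. indicator half_plane p *\<^sub>R (\<bar>w (fst p) (snd p) - k\<bar> * partial_t \<phi> p +
               sgn (w (fst p) (snd p) - k) * (f (w (fst p) (snd p)) - f k) * partial_x \<phi> p)) \<in> borel_measurable lborel" .
        show "(\<lambda>p. indicator half_plane p *\<^sub>R (?A p * partial_t \<phi> p + ?B p * partial_x \<phi> p)) \<in> borel_measurable lborel" by measurable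
        show "AE p in lborel. indicator half_plane p *\<^sub>R (\<bar>w (fst p) (snd p) - k\<bar> * partial_t \<phi> p +
               sgn (w (fst p) (snd p) - k) * (f (w (fst p) (snd p)) - f k) * partial_x \<phi> p)
            = indicator half_plane p *\<^sub>R (?A p * partial_t \<phi> p + ?B p * partial_x \<phi> p)"
          using AEp by eventually_elim (auto simp: indicator_def)
      qed
      finally show "0 \<le> (LBINT p:half_plane. ?A p * partial_t \<phi> p + ?B p * partial_x \<phi> p)" .
    qed
  qed
  then show "bounded_entropy_solution (representative M w0 w) M f B" by (simp add: u_def)
qed

section \<open>Oscillation of the difference of two potentials\<close>

lemma (in entropy_solution_pair) potential_difference_increment:
  assumes "x1 \<le> x2"
  shows "(U.potential x2 t - V.potential x2 t) - (U.potential x1 t - V.potential x1 t) = (LBINT x=x1..x2. u x t - v x t)"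
proof -
  have i: "integrable lborel (\<lambda>y. indicator {x1..x2} y *\<^sub>R q y t)" if "L1_continuous q M" for q
  proof -
    interpret q: L1_continuous q M by fact
    show ?thesis
      by (rule integrable_bounded_support[of _ M x1 x2]) (auto simp: indicator_def q.bound q.bound_nonneg)
  qed
  have "(LBINT x=x1..x2. u x t - v x t) = (LBINT y:{x1..x2}. u y t - v y t)"
    using assms by (rule interval_integral_Icc)
  also have "\<dots> = (LBINT y:{x1..x2}. u y t) - (LBINT y:{x1..x2}. v y t)"
    using i[OF U.L1_continuous_axioms] i[OF V.L1_continuous_axioms]
    by (intro set_integral_diff) (simp_all add: set_integrable_def)
  finally show ?thesis using U.potential_increment[OF assms, of t] V.potential_increment[OF assms, of t] by linarith
qed

theorem lemma3p4:
  fixes f u0 v0 :: "real \<Rightarrow> real" and u v :: "real \<Rightarrow> real \<Rightarrow> real" and c :: real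
  assumes "bounded_variation u0" and "bounded_variation v0"
    and "convex_on UNIV f"
    and "entropy_solution f u0 u" and "entropy_solution f v0 v"
    and "c > 0"
    and "\<forall>(y1::real) (y2::real). \<bar>LBINT y=y1..y2. u0 y - v0 y\<bar> \<le> c"
  shows "\<forall>t>0. \<forall>(x1::real) (x2::real). \<bar>LBINT x=x1..x2. u x t - v x t\<bar> \<le> c"
proof -
  obtain N1 N2 where N: "\<And>x. \<bar>u0 x\<bar> \<le> N1" "\<And>x. \<bar>v0 x\<bar> \<le> N2"
    using bounded_variation_bounded[OF assms(1)] bounded_variation_bounded[OF assms(2)] by metis
  obtain Mu Mv where Mu: "\<forall>t>0. AE x in lborel. \<bar>u x t\<bar> \<le> Mu" and Mv: "\<forall>t>0. AE x in lborel. \<bar>v x t\<bar> \<le> Mv"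
    using assms(4,5) unfolding entropy_solution_def by blast
  \<comment> \<open>One constant for both data and both solutions, as the comparison locale uses a
    single bound.\<close>
  define M where "M = max (max N1 N2) (max Mu Mv)"
  have "bounded (f ` {-M..M})"
    using convex_on_UNIV_continuous[OF assms(3)]
    by (intro compact_imp_bounded compact_continuous_image) (auto intro: continuous_on_subset)
  then obtain B where "\<forall>x\<in>{-M..M}. \<bar>f x\<bar> \<le> B" by (auto simp: bounded_iff)
  then have B: "\<bar>f x\<bar> \<le> B" if "\<bar>x\<bar> \<le> M" for x using that by (simp add: abs_le_iff)
  have u0: "\<bar>u0 x\<bar> \<le> M" and v0: "\<bar>v0 x\<bar> \<le> M" for x using N[of x] by (auto simp: M_def)
  have ub: "AE x in lborel. \<bar>u x t\<bar> \<le> M" if "t > 0" for t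
    using Mu[rule_format, OF that] by eventually_elim (simp add: M_def)
  have vb: "AE x in lborel. \<bar>v x t\<bar> \<le> M" if "t > 0" for t
    using Mv[rule_format, OF that] by eventually_elim (simp add: M_def)
  define u' where "u' = representative M u0 u"
  define v' where "v' = representative M v0 v"
  have ru: "bounded_entropy_solution u' M f B" "\<And>t. t > 0 \<Longrightarrow> AE x in lborel. u' x t = u x t"
    unfolding u'_def
    by (rule representative_entropy_solution[OF assms(4,3) bounded_variation_borel[OF assms(1)] u0]; use ub B in blast)+
  have rv: "bounded_entropy_solution v' M f B" "\<And>t. t > 0 \<Longrightarrow> AE x in lborel. v' x t = v x t"
    unfolding v'_def
    by (rule representative_entropy_solution[OF assms(5,3) bounded_variation_borel[OF assms(2)] v0]; use vb B in blast)+
  interpret UV: entropy_solution_pair u' v' M f B by (intro entropy_solution_pair.intro ru(1) rv(1))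
  \<comment> \<open>The exchanged pair turns lower bounds on the difference into upper
    bounds.\<close>
  interpret VU: entropy_solution_pair v' u' M f B by (intro entropy_solution_pair.intro ru(1) rv(1))
  define W where "W x t = UV.U.potential x t - UV.V.potential x t" for x t
  have init: "u' x 0 - v' x 0 = u0 x - v0 x" for x by (simp add: u'_def v'_def representative_def)
  \<comment> \<open>The hypothesis on all intervals, read as an oscillation bound for
    \<open>W\<close> at time \<open>0\<close>; the order of the two points only decides the sign of
    the integral.\<close>
  have osc0: "W x 0 \<le> W y 0 + c" for x y
  proof (cases "x \<le> y")
    case True
    have "W y 0 - W x 0 = (LBINT z=x..y. u0 z - v0 z)"
      unfolding W_def UV.potential_difference_increment[OF True] init ..
    then show ?thesis using assms(7)[rule_format, of x y] by linarith
  next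
    case False
    then have "y \<le> x" by simp
    have "W x 0 - W y 0 = (LBINT z=y..x. u0 z - v0 z)"
      unfolding W_def UV.potential_difference_increment[OF \<open>y \<le> x\<close>] init ..
    then show ?thesis using assms(7)[rule_format, of y x] by linarith
  qed
  define m where "m = (INF x. W x 0)"
  have "bdd_below (range (\<lambda>x. W x 0))"
    using osc0[of 0] by (intro bdd_belowI[of _ "W 0 0 - c"]) (auto simp: diff_le_eq)
  then have low0: "m \<le> W x 0" for x unfolding m_def by (intro cINF_lower) auto
  have up0: "W x 0 \<le> m + c" for x
  proof -
    have "W x 0 - c \<le> m" unfolding m_def using osc0[of x] by (intro cINF_greatest) (auto simp: diff_le_eq)
    then show ?thesis by simp
  qed
  have low: "m \<le> W x t" if "t > 0" for x t
    unfolding W_def using low0 that unfolding W_def by (rule UV.potential_comparison)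
  \<comment> \<open>Comparison for the exchanged pair, started from the lower bound
    \<open>- (m + c)\<close>.\<close>
  have up: "W x t \<le> m + c" if "t > 0" for x t
  proof -
    have "- (m + c) \<le> UV.V.potential x 0 - UV.U.potential x 0" for x using up0[of x] unfolding W_def by linarith
    from VU.potential_comparison[OF this that, of x] show ?thesis unfolding W_def by linarith
  qed
  have ordered: "\<bar>LBINT x=x1..x2. u x t - v x t\<bar> \<le> c" if t: "t > 0" and x: "x1 \<le> x2" for t x1 x2 :: real
  proof -
    note [measurable] = entropy_solution_slice_measurable[OF assms(4) t] entropy_solution_slice_measurable[OF assms(5) t]
      UV.U.slice_measurable UV.V.slice_measurable
    have "(LBINT x=x1..x2. u x t - v x t) = (LBINT x:{x1..x2}. u x t - v x t)"
      using x by (rule interval_integral_Icc)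
    also have "\<dots> = (LBINT x:{x1..x2}. u' x t - v' x t)"
      unfolding set_lebesgue_integral_def
    proof (rule integral_cong_AE)
      show "AE x in lborel. indicator {x1..x2} x *\<^sub>R (u x t - v x t) = indicator {x1..x2} x *\<^sub>R (u' x t - v' x t)"
        using ru(2)[OF t] rv(2)[OF t] by eventually_elim simp
    qed measurable
    also have "\<dots> = (LBINT x=x1..x2. u' x t - v' x t)"
      using x by (rule interval_integral_Icc[symmetric])
    also have "\<dots> = W x2 t - W x1 t" unfolding W_def by (rule UV.potential_difference_increment[OF x, symmetric])
    finally show ?thesis using low[OF t, of x1] low[OF t, of x2] up[OF t, of x1] up[OF t, of x2] by linarith
  qed
  show ?thesis
  proof (intro allI impI)
    fix t x1 x2 :: real assume t: "t > 0"
    show "\<bar>LBINT x=x1..x2. u x t - v x t\<bar> \<le> c"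
    proof (cases "x1 \<le> x2")
      case False
      then have "\<bar>LBINT x=x2..x1. u x t - v x t\<bar> \<le> c" using t by (intro ordered) auto
      then show ?thesis by (subst interval_integral_endpoints_reverse) simp
    qed (use ordered t in auto)
  qed
qed

end
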